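(* Let $\mathbf{k}\subset \mathbf{K}$ be fields of characteristic zero, let $X=\{x_1,\dots,x_m\}$ be a finite set, and let $\int: F_X\times \mathrm{Ass}_X\to \mathbf{K}$, $(\delta,\omega)\mapsto\int_\delta\omega$, be an iterated integral. (a) If the induced bilinear map $$\int:\ \mathrm{gr}^kF_X\times L_X^k\to \mathbf{K},\quad (\delta,\omega)\mapsto \int_\delta\omega$$ is non-degenerate for $k=1$, then it is non-degenerate for all $k\in\mathbb{N}$. (b) Let $\omega\in \mathrm{Ass}_X^k$. The linear map $$\int\omega:\ \mathrm{gr}^kF_X\to \mathbf{K},\quad \delta\mapsto\int_\delta\omega$$ is the zero map if and only if $\omega\in S_X^k$.
   Context: $\mathrm{Ass}_X$ is the free associative unital $\mathbf{k}$-algebra on $X$ (non-commutative polynomials in $x_1,\dots,x_m$ with coefficients in $\mathbf{k}$), graded by degree; $L_X\subset \mathrm{Ass}_X$ is the free Lie algebra on $X$, i.e. the Lie subalgebra generated by $x_1,\dots,x_m$ for the bracket $[x,y]=xy-yx$. $\mathrm{Ass}_X^k$ and $L_X^k$ denote the homogeneous components of degree $k$. $F_X$ is the free group on $X$, $(x,y)=xyx^{-1}y^{-1}$; for $A,B\subset F_X$, $(A,B)$ is the subgroup generated by all $(a,b)$, $a\in A,b\in B$. $F_X^1=F_X$, $F_X^n=(F_X,F_X^{n-1})$ is the lower central series, and $\mathrm{gr}^nF_X=F_X^n/F_X^{n+1}$. Shuffle product: for $\omega_1,\dots,\omega_{r+s}\in \mathrm{Ass}_X^1$, $\omega_1\cdots\omega_r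 * \omega_{r+1}\cdots\omega_{r+s}=\sum \omega_{k_1}\omega_{k_2}\cdots\omega_{k_{r+s}}$, where $(k_1,\dots,k_{r+s})$ runs over all permutations of $(1,\dots,r+s)$ in which $1,\dots,r$ appear in their original order and $r+1,\dots,r+s$ appear in their original order. It is extended $\mathbf{k}$-bilinearly to $\mathrm{Ass}_X$. $S_X^k\subset \mathrm{Ass}_X^k$ is the $\mathbf{k}$-span of all $\omega_1*\omega_2$ with $\omega_1\in \mathrm{Ass}_X^{k_1}$, $\omega_2\in \mathrm{Ass}_X^{k_2}$, $k_1,k_2\ge 1$, $k_1+k_2=k$. An iterated integral is a map $\int:F_X\times \mathrm{Ass}_X\to \mathbf{K}$, $(\delta,\omega)\mapsto\int_\delta\omega$, which is $\mathbf{k}$-linear in $\omega$ and satisfies the following axioms (the empty product $\omega_1\cdots\omega_r$ with $r=0$ is $1$). (A1) For every $\omega\in \mathrm{Ass}_X$, $\int_1\omega\in\mathbf{k}$ is the constant term of $\omega$, and $\int_\delta 1=1$ for all $\delta\in F_X$. (A2) For $\alpha,\beta\in F_X$ and $\omega_1,\dots,\omega_r\in \mathrm{Ass}_X^1$: $\int_{\alpha\beta}\omega_1\cdots\omega_r=\sum_{i=0}^r\int_\alpha\omega_1\cdots\omega_i\int_\beta\omega_{i+1}\cdots\omega_r$. (A3) For $\alpha\in F_X$ and $\omega_1,\dots,\omega_r\in \mathrm{Ass}_X^1$: $\int_{\alpha^{-1}}\omega_1\cdots\omega_r=(-1)^r\int_\alpha\omega_r\cdots\omega_1$. (A4) For $\alpha\in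 F_X$ and $\omega_1,\dots,\omega_{r+s}\in \mathrm{Ass}_X^1$: $\int_\alpha\omega_1\cdots\omega_r\int_\alpha\omega_{r+1}\cdots\omega_{r+s}=\int_\alpha(\omega_1\cdots\omega_r*\omega_{r+1}\cdots\omega_{r+s})$. It follows from the axioms that $\int$ induces, for every $k\ge1$, a well-defined map $\mathrm{gr}^kF_X\times \mathrm{Ass}_X^k\to\mathbf{K}$, $(\delta,\omega)\mapsto\int_\delta\omega$, which is $\mathbb{Z}$-linear in the first and $\mathbf{k}$-linear in the second argument; the maps in (a) and (b) are obtained from it by restriction.
   Formalization: Non-degenerate means trivial kernels also after extending scalars to K (trivial kernels alone make (a) false: k=Q, K=R, rank-one 2x2 matrix). In (b), "zero map implies ω in S^k" assumes non-degeneracy for k=1, as the constant-term integral refutes it otherwise; k≥1 throughout. *)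

theory Defs
  imports Complex_Main "HOL-Algebra.Generated_Groups" "HOL-Library.Poly_Mapping"
begin

text \<open>
  A letter \<open>(True, x)\<close> stands for the generator \<open>x\<close> and \<open>(False, x)\<close> for its inverse.  Elements of
  the free group are the reduced words; the product reduces the concatenation.
\<close>

type_synonym 'x letter = "bool \<times> 'x"

definition inv_letter :: "'x letter \<Rightarrow> 'x letter"
  where "inv_letter a = (\<not> fst a, snd a)"

definition reduced :: "'x letter list \<Rightarrow> bool"
  where "reduced = successively (\<lambda>a b. b \<noteq> inv_letter a)"

fun push :: "'x letter \<Rightarrow> 'x letter list \<Rightarrow> 'x letter list" where
  "push a [] = [a]"
| "push a (b # w) = (if b = inv_letter a then w else a # b # w)"

definition free_group :: "'x set \<Rightarrow> 'x letter list monoid"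
  where "free_group X = \<lparr>carrier = {w \<in> lists (UNIV \<times> X). reduced w},
                          monoid.mult = (\<lambda>u v. foldr push u v), one = []\<rparr>"

definition commutator_subgroup :: "('a, 'b) monoid_scheme \<Rightarrow> 'a set \<Rightarrow> 'a set \<Rightarrow> 'a set"
  where "commutator_subgroup G A B =
    generate G {a \<otimes>\<^bsub>G\<^esub> b \<otimes>\<^bsub>G\<^esub> inv\<^bsub>G\<^esub> a \<otimes>\<^bsub>G\<^esub> inv\<^bsub>G\<^esub> b | a b. a \<in> A \<and> b \<in> B}"

text \<open>The series is indexed from 1; the value at 0 is a dummy.\<close>

fun lower_central :: "('a, 'b) monoid_scheme \<Rightarrow> nat \<Rightarrow> 'a set" where
  "lower_central G 0 = carrier G"
| "lower_central G (Suc 0) = carrier G"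
| "lower_central G (Suc (Suc n)) = commutator_subgroup G (carrier G) (lower_central G (Suc n))"

definition gr_group :: "('a, 'b) monoid_scheme \<Rightarrow> nat \<Rightarrow> 'a set monoid"
  where "gr_group G n = (G\<lparr>carrier := lower_central G n\<rparr>) Mod lower_central G (Suc n)"

lemma inv_letter_inv [simp]: "inv_letter (inv_letter a) = a"
  by (simp add: inv_letter_def)

lemma reduced_simps [simp]:
  "reduced []" "reduced (a # w) \<longleftrightarrow> (w = [] \<or> hd w \<noteq> inv_letter a) \<and> reduced w"
  by (auto simp: reduced_def successively_Cons)

lemma reduced_push: "reduced w \<Longrightarrow> reduced (push a w)"
  by (cases w) auto

lemma reduced_foldr_push: "reduced w \<Longrightarrow> reduced (foldr push u w)"
  by (induction u) (auto simp: reduced_push)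

lemma push_inv_push: "reduced w \<Longrightarrow> push (inv_letter a) (push a w) = w"
proof (cases w)
  case (Cons b v)
  then show "reduced w \<Longrightarrow> ?thesis" by (cases v) auto
qed simp

lemma push_push_inv: "reduced w \<Longrightarrow> push a (push (inv_letter a) w) = w"
  using push_inv_push[of w "inv_letter a"] by simp

lemma push_in_lists: "a \<in> A \<Longrightarrow> w \<in> lists A \<Longrightarrow> push a w \<in> lists A"
  by (cases w) auto

lemma foldr_push_in_lists: "u \<in> lists A \<Longrightarrow> w \<in> lists A \<Longrightarrow> foldr push u w \<in> lists A"
  by (induction u) (use push_in_lists in fastforce)+

lemma foldr_push_push:
  "reduced w \<Longrightarrow> foldr push (push a z) w = push a (foldr push z w)"
  by (cases z) (auto simp: push_push_inv reduced_foldr_push)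

lemma foldr_push_assoc:
  "reduced w \<Longrightarrow> foldr push (foldr push u v) w = foldr push u (foldr push v w)"
  by (induction u) (auto simp: foldr_push_push)

lemma foldr_push_Nil: "reduced w \<Longrightarrow> foldr push w [] = w"
proof (induction w)
  case (Cons a w)
  then show ?case by (cases w) auto
qed simp

lemma foldr_push_inverse:
  "foldr push (map inv_letter (rev w)) (foldr push w v) = v" if "reduced v"
  using that by (induction w arbitrary: v) (auto simp: push_inv_push reduced_foldr_push)

lemma group_free_group: "group (free_group X)"
proof (rule groupI)
  fix w assume w: "w \<in> carrier (free_group X)"
  let ?v = "foldr push (map inv_letter (rev w)) []"
  have "w \<in> lists (UNIV \<times> X)" using w by (simp add: free_group_def)
  then have "map inv_letter (rev w) \<in> lists (UNIV \<times> X)"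
    by (fastforce simp: inv_letter_def)
  then have "?v \<in> carrier (free_group X)"
    using foldr_push_in_lists[of _ "UNIV \<times> X" "[]"]
    by (auto simp: free_group_def reduced_foldr_push simp del: in_lists_conv_set)
  moreover have "?v \<otimes>\<^bsub>free_group X\<^esub> w = \<one>\<^bsub>free_group X\<^esub>"
    using w foldr_push_inverse[of "[]" w]
    by (simp add: free_group_def foldr_push_assoc foldr_push_Nil)
  ultimately show "\<exists>v\<in>carrier (free_group X). v \<otimes>\<^bsub>free_group X\<^esub> w = \<one>\<^bsub>free_group X\<^esub>"
    by blast
next
  fix u v assume "u \<in> carrier (free_group X)" "v \<in> carrier (free_group X)"
  then show "u \<otimes>\<^bsub>free_group X\<^esub> v \<in> carrier (free_group X)"
    using foldr_push_in_lists[of u "UNIV \<times> X" v]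
    by (auto simp: free_group_def reduced_foldr_push simp del: in_lists_conv_set)
qed (auto simp: free_group_def foldr_push_assoc)


definition scale_pm :: "'k::field \<Rightarrow> ('a \<Rightarrow>\<^sub>0 'k) \<Rightarrow> ('a \<Rightarrow>\<^sub>0 'k)"
  where "scale_pm c p = Poly_Mapping.map ((*) c) p"

lemma lookup_scale_pm [simp]: "Poly_Mapping.lookup (scale_pm c p) a = c * Poly_Mapping.lookup p a"
  by (simp add: scale_pm_def map.rep_eq when_def)

lemma vector_space_scale_pm: "vector_space scale_pm"
  by unfold_locales (auto intro!: poly_mapping_eqI simp: Poly_Mapping.lookup_add algebra_simps)

abbreviation span_pm :: "('a \<Rightarrow>\<^sub>0 'k::field) set \<Rightarrow> ('a \<Rightarrow>\<^sub>0 'k) set"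
  where "span_pm \<equiv> module.span scale_pm"


text \<open>
  With concatenation as addition on words, the convolution product of
  \<^theory>\<open>HOL-Library.Poly_Mapping\<close> on \<open>'x list \<Rightarrow>\<^sub>0 'k\<close> is the product of non-commutative
  polynomials.
\<close>

instantiation list :: (type) monoid_add
begin
definition zero_list :: "'a list" where "zero_list = []"
definition plus_list :: "'a list \<Rightarrow> 'a list \<Rightarrow> 'a list" where "plus_list = (@)"
instance by standard (auto simp: zero_list_def plus_list_def)
end

type_synonym ('x, 'k) ncpoly = "'x list \<Rightarrow>\<^sub>0 'k"

definition var :: "'x \<Rightarrow> ('x, 'k::field) ncpoly"
  where "var x = Poly_Mapping.single [x] 1"

definition Ass :: "'x set \<Rightarrow> ('x, 'k::field) ncpoly set"
  where "Ass X = {p. Poly_Mapping.keys p \<subseteq> lists X}"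

definition Ass_deg :: "'x set \<Rightarrow> nat \<Rightarrow> ('x, 'k::field) ncpoly set"
  where "Ass_deg X k = {p \<in> Ass X. \<forall>w\<in>Poly_Mapping.keys p. length w = k}"

inductive_set free_lie :: "'x set \<Rightarrow> ('x, 'k::field) ncpoly set" for X :: "'x set" where
  var: "x \<in> X \<Longrightarrow> var x \<in> free_lie X"
| zero: "0 \<in> free_lie X"
| add: "p \<in> free_lie X \<Longrightarrow> q \<in> free_lie X \<Longrightarrow> p + q \<in> free_lie X"
| scale: "p \<in> free_lie X \<Longrightarrow> scale_pm c p \<in> free_lie X"
| bracket: "p \<in> free_lie X \<Longrightarrow> q \<in> free_lie X \<Longrightarrow> p * q - q * p \<in> free_lie X"

definition free_lie_deg :: "'x set \<Rightarrow> nat \<Rightarrow> ('x, 'k::field) ncpoly set"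
  where "free_lie_deg X k = free_lie X \<inter> Ass_deg X k"

text \<open>
  \<open>shuffles\<close> returns a set and so forgets multiplicities; it is applied to lists of distinct
  indices here.
\<close>

definition shuffle_forms :: "('x, 'k::field) ncpoly list \<Rightarrow> ('x, 'k) ncpoly list \<Rightarrow> ('x, 'k) ncpoly"
  where "shuffle_forms us vs =
    (\<Sum>ks \<in> shuffles [0..<length us] [length us..<length us + length vs].
       prod_list (map (\<lambda>k. (us @ vs) ! k) ks))"

definition shuffle :: "('x, 'k::field) ncpoly \<Rightarrow> ('x, 'k) ncpoly \<Rightarrow> ('x, 'k) ncpoly"
  where "shuffle p q =
    (\<Sum>u\<in>Poly_Mapping.keys p. \<Sum>v\<in>Poly_Mapping.keys q.
       scale_pm (Poly_Mapping.lookup p u * Poly_Mapping.lookup q v) (shuffle_forms (map var u) (map var v)))"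

definition shuffle_span :: "'x set \<Rightarrow> nat \<Rightarrow> ('x, 'k::field) ncpoly set"
  where "shuffle_span X k =
    span_pm {shuffle p q | p q i j. p \<in> Ass_deg X i \<and> q \<in> Ass_deg X j \<and> 1 \<le> i \<and> 1 \<le> j \<and> i + j = k}"


text \<open>The inclusion of the base field into the larger field is an explicit embedding \<open>\<iota>\<close>.\<close>

locale field_embedding =
  fixes \<iota> :: "'k::field_char_0 \<Rightarrow> 'K::field_char_0"
  assumes emb_one: "\<iota> 1 = 1"
    and emb_add: "\<iota> (a + b) = \<iota> a + \<iota> b"
    and emb_mult: "\<iota> (a * b) = \<iota> a * \<iota> b"

locale iterated_integral = field_embedding \<iota>
  for \<iota> :: "'k::field_char_0 \<Rightarrow> 'K::field_char_0" +
  fixes X :: "'x set" and I :: "'x letter list \<Rightarrow> ('x, 'k) ncpoly \<Rightarrow> 'K"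
  assumes add: "\<lbrakk>\<alpha> \<in> carrier (free_group X); p \<in> Ass X; q \<in> Ass X\<rbrakk> \<Longrightarrow> I \<alpha> (p + q) = I \<alpha> p + I \<alpha> q"
    and scale: "\<lbrakk>\<alpha> \<in> carrier (free_group X); p \<in> Ass X\<rbrakk> \<Longrightarrow> I \<alpha> (scale_pm c p) = \<iota> c * I \<alpha> p"
    and const_path: "p \<in> Ass X \<Longrightarrow> I \<one>\<^bsub>free_group X\<^esub> p = \<iota> (Poly_Mapping.lookup p [])"
    and one_form: "\<alpha> \<in> carrier (free_group X) \<Longrightarrow> I \<alpha> 1 = 1"
    and path_mult: "\<lbrakk>\<alpha> \<in> carrier (free_group X); \<beta> \<in> carrier (free_group X); set ws \<subseteq> Ass_deg X 1\<rbrakk> \<Longrightarrow>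
      I (\<alpha> \<otimes>\<^bsub>free_group X\<^esub> \<beta>) (prod_list ws) =
        (\<Sum>i\<le>length ws. I \<alpha> (prod_list (take i ws)) * I \<beta> (prod_list (drop i ws)))"
    and path_inv: "\<lbrakk>\<alpha> \<in> carrier (free_group X); set ws \<subseteq> Ass_deg X 1\<rbrakk> \<Longrightarrow>
      I (inv\<^bsub>free_group X\<^esub> \<alpha>) (prod_list ws) = (- 1) ^ length ws * I \<alpha> (prod_list (rev ws))"
    and shuffle_rel: "\<lbrakk>\<alpha> \<in> carrier (free_group X); set us \<subseteq> Ass_deg X 1; set vs \<subseteq> Ass_deg X 1\<rbrakk> \<Longrightarrow>
      I \<alpha> (prod_list us) * I \<alpha> (prod_list vs) = I \<alpha> (shuffle_forms us vs)"

text \<open>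
  The value of the induced map on a class is the common value of the integral on its
  representatives.
\<close>

definition gr_integral :: "('g \<Rightarrow> 'v \<Rightarrow> 'K) \<Rightarrow> 'g set \<Rightarrow> 'v \<Rightarrow> 'K"
  where "gr_integral I C p = the_elem ((\<lambda>\<delta>. I \<delta> p) ` C)"


text \<open>
  Let \<open>G\<close> be an abelian group (written multiplicatively), \<open>V\<close> a vector space over the small field
  and \<open>B\<close> a bilinear map from \<open>G \<times> V\<close> to the large field \<open>K\<close>.  The space \<open>K \<otimes> G\<close>, tensor product over
  the integers, is the \<open>K\<close>-space with basis the elements of \<open>G\<close> modulo \<open>tensor_rel_group\<close>; likewise
  \<open>K \<otimes> V\<close>, tensor product over the small field, is the \<open>K\<close>-space with basis \<open>V\<close> modulo
  \<open>tensor_rel_space\<close>.  On representatives, the \<open>K\<close>-bilinear extension of \<open>B\<close> is \<open>ext_pairing B\<close>.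

  Triviality of the kernels in \<open>G\<close> and \<open>V\<close> is too weak a notion when \<open>K\<close> is larger than the small
  field: for \<open>V\<close> of dimension 2 over the rationals and \<open>G\<close> free abelian of rank 2, the rank one matrix
  with rows \<open>(1, sqrt 2)\<close> and \<open>(sqrt 3, sqrt 6)\<close> has trivial kernels.  So non-degeneracy is required
  both for \<open>B\<close> itself and for its extension to \<open>K\<close>.
\<close>

definition tensor_rel_group :: "('g, 'b) monoid_scheme \<Rightarrow> ('g \<Rightarrow>\<^sub>0 'K::field) set"
  where "tensor_rel_group G = span_pm
    {Poly_Mapping.single (a \<otimes>\<^bsub>G\<^esub> b) 1 - Poly_Mapping.single a 1 - Poly_Mapping.single b 1 | a b.
       a \<in> carrier G \<and> b \<in> carrier G}"

definition tensor_rel_space ::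
    "('k::field \<Rightarrow> 'K::field) \<Rightarrow> ('a \<Rightarrow>\<^sub>0 'k) set \<Rightarrow> (('a \<Rightarrow>\<^sub>0 'k) \<Rightarrow>\<^sub>0 'K) set"
  where "tensor_rel_space \<iota> V = span_pm
    ({Poly_Mapping.single (u + v) 1 - Poly_Mapping.single u 1 - Poly_Mapping.single v 1 | u v.
        u \<in> V \<and> v \<in> V} \<union>
     {Poly_Mapping.single (scale_pm c v) 1 - Poly_Mapping.single v (\<iota> c) | c v. v \<in> V})"

definition ext_pairing :: "('g \<Rightarrow> 'v \<Rightarrow> 'K::field) \<Rightarrow> ('g \<Rightarrow>\<^sub>0 'K) \<Rightarrow> ('v \<Rightarrow>\<^sub>0 'K) \<Rightarrow> 'K"
  where "ext_pairing B s t =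
    (\<Sum>a\<in>Poly_Mapping.keys s. \<Sum>v\<in>Poly_Mapping.keys t.
       Poly_Mapping.lookup s a * Poly_Mapping.lookup t v * B a v)"

definition nondegenerate ::
    "('k::field \<Rightarrow> 'K::field) \<Rightarrow> ('g, 'b) monoid_scheme \<Rightarrow> ('a \<Rightarrow>\<^sub>0 'k) set
      \<Rightarrow> ('g \<Rightarrow> ('a \<Rightarrow>\<^sub>0 'k) \<Rightarrow> 'K) \<Rightarrow> bool"
  where "nondegenerate \<iota> G V B \<longleftrightarrow>
    (\<forall>a\<in>carrier G. (\<forall>v\<in>V. B a v = 0) \<longrightarrow> a = \<one>\<^bsub>G\<^esub>) \<and>
    (\<forall>v\<in>V. (\<forall>a\<in>carrier G. B a v = 0) \<longrightarrow> v = 0) \<and>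
    (\<forall>s. Poly_Mapping.keys s \<subseteq> carrier G \<longrightarrow>
       (\<forall>t. Poly_Mapping.keys t \<subseteq> V \<longrightarrow> ext_pairing B s t = 0) \<longrightarrow> s \<in> tensor_rel_group G) \<and>
    (\<forall>t. Poly_Mapping.keys t \<subseteq> V \<longrightarrow>
       (\<forall>s. Poly_Mapping.keys s \<subseteq> carrier G \<longrightarrow> ext_pairing B s t = 0) \<longrightarrow> t \<in> tensor_rel_space \<iota> V)"

end

theory Submission
  imports Defs "HOL-Library.List_Lexorder"
begin

text \<open>
  Attach to a path \<open>\<delta>\<close> the series of its integrals over all words. By (A2) this is multiplicative in \<open>\<delta>\<close>,
  so on \<open>gr\<^sup>k F\<close> its part of degree \<open>k\<close> is an additive leading term, commutators go to Lie brackets,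
  and the pairing with a form is the standard inner product of words with the leading term.
  Non-degeneracy in degree 1 says that the leading terms of degree 1 span all linear forms over the
  large field; then those of degree \<open>k\<close> span the Lie polynomials of degree \<open>k\<close>. The inner product is
  non-degenerate on Lie polynomials, because these have a rational orthogonal basis.

  Injectivity of the leading term on \<open>gr\<^sup>k F\<close> and on its scalar extension is Witt's theorem: \<open>gr\<^sup>k F\<close> is
  generated by the commutators of the Hall trees of weight \<open>k\<close> (bracketed Lyndon words), and there are
  only as many of these as there are independent Lie polynomials.

  For (b), the orthogonal complement of the Lie polynomials consists of shuffles: modulo proper
  shuffles, \<open>k\<close> times a word \<open>w\<close> of length \<open>k\<close> is its image under the adjoint of the left-normed bracketing.
\<close>

section \<open>Lyndon words and Hall trees\<close>

text \<open>Two bounds meet in the counting. Rewriting in the group shows that the Hall commutators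
  generate \<open>gr\<close>, which bounds the rank from above; the lexicographic leading words of
  the Lie polynomials built from the letters bound it from below. Leading words say nothing about
  the Hall commutators directly: the degree 1 term of a generator of the free group is some linear
  form, not a letter, so no triangularity is visible in their leading terms. Full rank makes these
  terms span all Lie polynomials of the same degree, and a spanning family of the right size is a
  basis.

  A second obstacle is the field. The inner product of words is bilinear and \<open>K\<close>
  carries no order, so over the complex numbers x + i y is orthogonal to itself. Left-normed
  brackets have rational coefficients, and the orthogonal basis is built there before its span over
  \<open>K\<close> is taken.

  Finally, the hypothesis in degree 1 has to be read over \<open>K\<close>: a linear form that
  detects a failure of spanning has coefficients in \<open>K\<close>, and only the extended pairing
  sees it.\<close>

lemma less_append_right: "v \<noteq> [] \<Longrightarrow> u < u @ v" for u :: "'a::linorder list"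
  by (induction u) (auto simp: neq_Nil_conv)

lemma append_less_cancel [simp]: "u @ v < u @ w \<longleftrightarrow> v < w" for u :: "'a::linorder list"
  by (induction u) auto

lemma less_append_mono:
  fixes u :: "'a::linorder list"
  assumes "u < v" "length v \<le> length u"
  shows "u @ x < v @ y"
  using assms
proof (induction u arbitrary: v)
  case (Cons a u)
  then show ?case by (cases v) auto
qed auto

lemma less_append_cases:
  fixes u :: "'a::linorder list"
  assumes "u < v"
  obtains "\<And>x y. u @ x < v @ y" | z where "z \<noteq> []" "v = u @ z"
proof -
  have "(\<forall>x y. u @ x < v @ y) \<or> (\<exists>z. z \<noteq> [] \<and> v = u @ z)"
    using assms
  proof (induction u arbitrary: v)
    case Nil
    then show ?case by (cases v) auto
  next
    case (Cons a u)
    then show ?case by (cases v) auto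
  qed
  then show thesis using that by blast
qed

definition lyndon :: "'a::linorder list \<Rightarrow> bool"
  where "lyndon w \<longleftrightarrow> w \<noteq> [] \<and> (\<forall>u v. w = u @ v \<longrightarrow> u \<noteq> [] \<longrightarrow> v \<noteq> [] \<longrightarrow> w < v)"

lemma lyndonD: "lyndon (u @ v) \<Longrightarrow> u \<noteq> [] \<Longrightarrow> v \<noteq> [] \<Longrightarrow> u @ v < v"
  by (auto simp: lyndon_def)

lemma lyndon_single: "lyndon [x]"
  by (auto simp: lyndon_def append_eq_Cons_conv Cons_eq_append_conv)

text \<open>The delicate case is \<open>v = u @ z\<close>: there v < z because v is Lyndon, and
  prefixing u gives \<open>u @ v < u @ z = v\<close>.\<close>

lemma lyndon_append_less:
  assumes "lyndon u" "lyndon v" "u < v"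
  shows "u @ v < v"
  using \<open>u < v\<close>
proof (cases rule: less_append_cases)
  case 1
  from this[of v "[]"] show ?thesis by simp
next
  case (2 z)
  then have "v < z" using assms lyndonD[of u z] by (auto simp: lyndon_def)
  then show ?thesis by (subst (2) 2(2)) simp
qed

text \<open>A suffix longer than v is \<open>z @ v\<close> with z a suffix of u. If z is proper, u <
  z with z shorter than u, so a letter already decides the comparison; all other suffixes are
  compared through v.\<close>

lemma lyndon_append:
  assumes "lyndon u" "lyndon v" "u < v"
  shows "lyndon (u @ v)"
  unfolding lyndon_def
proof (intro conjI allI impI)
  show "u @ v \<noteq> []" using assms by (auto simp: lyndon_def)
  fix p s assume ps: "u @ v = p @ s" "p \<noteq> []" "s \<noteq> []"
  have uv: "u @ v < v" using assms by (rule lyndon_append_less)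
  from ps(1) consider z where "u = p @ z" "s = z @ v" | z where "p = u @ z" "v = z @ s"
    by (auto simp: append_eq_append_conv2)
  then show "u @ v < s"
  proof cases
    case (1 z)
    show ?thesis
    proof (cases "z = []")
      case False
      then have "u < z" using assms(1) 1 ps lyndonD by blast
      then show ?thesis using less_append_mono[of u z v v] 1 by simp
    qed (use uv 1 in simp)
  next
    case (2 z)
    show ?thesis
    proof (cases "z = []")
      case False
      then have "v < s" using assms(2) 2 ps lyndonD by blast
      then show ?thesis using uv by simp
    qed (use uv 2 in simp)
  qed
qed

text \<open>The least nonempty suffix works: its own proper suffixes are again suffixes of w, hence
  larger.\<close>

lemma lyndon_suffix_le:
  assumes "w \<noteq> []"
  obtains u s where "w = u @ s" "lyndon s" "s \<le> w"
proof -
  define A where "A = {s. s \<noteq> [] \<and> (\<exists>u. w = u @ s)}"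
  have "A \<subseteq> (\<lambda>n. drop n w) ` {..length w}"
  proof
    fix s assume "s \<in> A"
    then obtain u where "w = u @ s" by (auto simp: A_def)
    then have "s = drop (length u) w" "length u \<le> length w" by auto
    then show "s \<in> (\<lambda>n. drop n w) ` {..length w}" by blast
  qed
  then have "finite A" by (rule finite_subset) simp
  moreover have "w \<in> A" using assms by (auto simp: A_def)
  ultimately have m: "Min A \<in> A" "\<And>s. s \<in> A \<Longrightarrow> Min A \<le> s"
    using Min_in[of A] Min_le[of A] by blast+
  have "lyndon (Min A)" unfolding lyndon_def
  proof (intro conjI allI impI)
    show "Min A \<noteq> []" using m by (auto simp: A_def)
    fix u v assume uv: "Min A = u @ v" "u \<noteq> []" "v \<noteq> []"
    obtain p where "w = p @ Min A" using m(1) by (auto simp: A_def)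
    then have "w = (p @ u) @ v" using uv by simp
    then have "v \<in> A" using uv by (auto simp: A_def)
    moreover have "v \<noteq> Min A" using uv by auto
    ultimately show "Min A < v" using m(2) by (metis order_le_imp_less_or_eq)
  qed
  moreover obtain p where "w = p @ Min A" using m(1) by (auto simp: A_def)
  ultimately show thesis using that m(2)[OF \<open>w \<in> A\<close>] by blast
qed

section \<open>Hall trees and their words\<close>

datatype 'x tree = Leaf 'x | Br "'x tree" "'x tree"

fun foliage :: "'x tree \<Rightarrow> 'x list" where
  "foliage (Leaf x) = [x]"
| "foliage (Br a b) = foliage a @ foliage b"

lemma foliage_neq_Nil [simp]: "foliage t \<noteq> []"
  by (induction t) auto

text \<open>The letters carry no order of their own; a numbering e, injective on X in all
  applications, moves words to \<open>nat list\<close>, where they are compared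
  lexicographically.\<close>

definition key :: "('x \<Rightarrow> nat) \<Rightarrow> 'x tree \<Rightarrow> nat list"
  where "key e t = map e (foliage t)"

lemma key_simps [simp]: "key e (Leaf x) = [e x]" "key e (Br a b) = key e a @ key e b"
  by (auto simp: key_def)

lemma length_key [simp]: "length (key e t) = length (foliage t)"
  by (simp add: key_def)

lemma key_neq_Nil [simp]: "key e t \<noteq> []"
  by (simp add: key_def)

text \<open>The bracketings of Lyndon words obtained by splitting off the longest proper Lyndon suffix.\<close>

fun hall :: "('x \<Rightarrow> nat) \<Rightarrow> 'x set \<Rightarrow> 'x tree \<Rightarrow> bool" where
  "hall e X (Leaf x) \<longleftrightarrow> x \<in> X"
| "hall e X (Br a b) \<longleftrightarrow> hall e X a \<and> hall e X b \<and> key e a < key e b \<and>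
     (case a of Leaf _ \<Rightarrow> True | Br _ a2 \<Rightarrow> key e b \<le> key e a2)"

lemma lyndon_key: "hall e X t \<Longrightarrow> lyndon (key e t)"
  by (induction t) (auto simp: lyndon_single lyndon_append)

lemma key_Br_less: "hall e X a \<Longrightarrow> hall e X b \<Longrightarrow> key e a < key e b \<Longrightarrow> key e (Br a b) < key e b"
  by (simp add: lyndon_append_less lyndon_key)

lemma foliage_hall: "hall e X t \<Longrightarrow> foliage t \<in> lists X"
  by (induction t) auto

lemma append_eq_append_suffixE:
  assumes "a @ b = c @ d" "length b \<le> length d"
  obtains z where "a = c @ z" "d = z @ b"
  using assms by (auto simp: append_eq_append_conv2)

text \<open>Suppose a longer Lyndon suffix \<open>s = s' @ key e b\<close>. Then s' < s <
  \<open>key e b\<close>, so the Lyndon suffix t \<le> s' is below \<open>key e b\<close> \<le>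
  \<open>key e a2\<close>. But t is a proper Lyndon suffix of the word of a, so by induction it is a
  suffix of \<open>key e a2\<close>; that word is Lyndon, hence \<le> t, a contradiction.\<close>

lemma hall_longest_lyndon_suffix:
  assumes "hall e X (Br a b)" "key e (Br a b) = u @ s" "u \<noteq> []" "lyndon s"
  shows "length s \<le> length (key e b)"
  using assms
proof (induction a arbitrary: b u s)
  case (Leaf x)
  then show ?case by (cases u) auto
next
  case (Br a1 a2)
  let ?a = "Br a1 a2"
  show ?case
  proof (rule ccontr)
    assume long: "\<not> ?thesis"
    then obtain s' where s': "key e ?a = u @ s'" "s = s' @ key e b"
      using append_eq_append_suffixE[of "key e ?a" "key e b" u s] Br.prems(2) by auto
    have "s' \<noteq> []" using long s' by auto
    note s' = s' this
    have "s < key e b" using s' Br.prems(4) lyndonD by force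
    moreover have "s' < s" using s' by (simp add: less_append_right)
    moreover obtain v t where t: "s' = v @ t" "lyndon t" "t \<le> s'"
      using lyndon_suffix_le s'(3) by blast
    ultimately have "t < key e b" by simp
    moreover have "key e b \<le> key e a2" using Br.prems by simp
    moreover have "key e a2 \<le> t"
    proof -
      have *: "key e ?a = (u @ v) @ t" "u @ v \<noteq> []" using s' t Br.prems by auto
      then have "length t \<le> length (key e a2)" using Br.IH(1)[of a2 "u @ v" t] Br.prems t by auto
      then obtain z where "key e a2 = z @ t"
        using append_eq_append_suffixE[of "u @ v" t "key e a1" "key e a2"] *(1) by auto
      moreover have "lyndon (key e a2)" using Br.prems lyndon_key by auto
      ultimately show ?thesis using lyndonD[of z t] t(2)
        by (cases "z = []") (auto simp: lyndon_def intro: less_imp_le)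
    qed
    ultimately show False by simp
  qed
qed

text \<open>The longest proper Lyndon suffix depends on the word alone and is the word of the right
  subtree, so both trees split at the same place. Distinct Hall trees thus have distinct words, on
  which finiteness and triangularity rest.\<close>

lemma key_inj:
  assumes "inj_on e X" "hall e X s" "hall e X t" "key e s = key e t"
  shows "s = t"
  using assms(2-)
proof (induction s arbitrary: t)
  case (Leaf x)
  then show ?case
    using assms(1) by (cases t) (auto simp: inj_on_eq_iff append_eq_Cons_conv Cons_eq_append_conv)
next
  case (Br a b)
  show ?case
  proof (cases t)
    case (Leaf x)
    then show ?thesis using Br.prems by (auto simp: append_eq_Cons_conv)
  next
    case [simp]: (Br c d)
    have "length (key e b) = length (key e d)"
      using hall_longest_lyndon_suffix[of e X a b "key e c" "key e d"]
        hall_longest_lyndon_suffix[of e X c d "key e a" "key e b"] Br.prems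
      by (auto simp: lyndon_key intro: antisym)
    then have "key e a = key e c" "key e b = key e d"
      using Br.prems(3) by auto
    then show ?thesis using Br.IH Br.prems by auto
  qed
qed

lemma finite_hall:
  assumes "finite X" "inj_on e X"
  shows "finite {t. hall e X t \<and> length (foliage t) = n}"
proof (rule inj_on_finite)
  show "inj_on (key e) {t. hall e X t \<and> length (foliage t) = n}"
    using key_inj[OF assms(2)] by (auto intro!: inj_onI)
  show "key e ` {t. hall e X t \<and> length (foliage t) = n} \<subseteq> {w. set w \<subseteq> e ` X \<and> length w = n}"
    using foliage_hall by (fastforce simp: key_def)
  show "finite {w. set w \<subseteq> e ` X \<and> length w = n}"
    using assms by (simp add: finite_lists_length_eq)
qed

section \<open>The lower central series\<close>

context group
begin

definition comm :: "'a \<Rightarrow> 'a \<Rightarrow> 'a"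
  where "comm x y = x \<otimes> y \<otimes> inv x \<otimes> inv y"

lemma comm_closed [simp]: "x \<in> carrier G \<Longrightarrow> y \<in> carrier G \<Longrightarrow> comm x y \<in> carrier G"
  by (simp add: comm_def)

lemma inv_cancel_left:
  "x \<in> carrier G \<Longrightarrow> y \<in> carrier G \<Longrightarrow> x \<otimes> (inv x \<otimes> y) = y"
  "x \<in> carrier G \<Longrightarrow> y \<in> carrier G \<Longrightarrow> inv x \<otimes> (x \<otimes> y) = y"
  by (simp_all flip: m_assoc)

text \<open>Normalises group words: products nested to the right, inverses pushed to the letters,
  adjacent inverse pairs cancelled. Identities valid in all groups become equalities of normal
  forms.\<close>

lemmas group_word_simps = comm_def m_assoc inv_mult_group inv_cancel_left

lemma inv_comm: "x \<in> carrier G \<Longrightarrow> y \<in> carrier G \<Longrightarrow> inv (comm x y) = comm y x"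
  by (simp add: group_word_simps)

lemma comm_self: "x \<in> carrier G \<Longrightarrow> comm x x = \<one>"
  by (simp add: group_word_simps)

lemma comm_one: "x \<in> carrier G \<Longrightarrow> comm \<one> x = \<one>" "x \<in> carrier G \<Longrightarrow> comm x \<one> = \<one>"
  by (simp_all add: comm_def)

lemma comm_mult_left:
  assumes "a \<in> carrier G" "b \<in> carrier G" "c \<in> carrier G"
  shows "comm (a \<otimes> b) c = a \<otimes> comm b c \<otimes> inv a \<otimes> comm a c"
  using assms by (simp add: group_word_simps)

lemma comm_mult_conj:
  "a \<in> carrier G \<Longrightarrow> b \<in> carrier G \<Longrightarrow> a \<otimes> b \<otimes> inv a = comm a b \<otimes> b"
  by (simp add: group_word_simps)

lemma comm_inv_left:
  assumes "a \<in> carrier G" "b \<in> carrier G"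
  shows "comm (inv a) b = inv a \<otimes> inv (comm a b) \<otimes> a"
  using assms by (simp add: group_word_simps)

lemma Hall_Witt:
  assumes "x \<in> carrier G" "y \<in> carrier G" "z \<in> carrier G"
  shows "(inv x \<otimes> comm (comm x y) z \<otimes> x) \<otimes> (z \<otimes> comm (comm (inv z) (inv x)) y \<otimes> inv z) \<otimes>
    (y \<otimes> comm (comm (inv y) z) (inv x) \<otimes> inv y) = \<one>"
proof -
  \<comment> \<open>Each of the three factors is a word of ten letters whose last five letters
    cancel against the first five of the next one, cyclically.\<close>
  have "inv x \<otimes> comm (comm x y) z \<otimes> x = y \<otimes> inv x \<otimes> inv y \<otimes> z \<otimes> y \<otimes> x \<otimes> inv y \<otimes> inv x \<otimes> inv z \<otimes> x"
    using assms by (simp add: group_word_simps)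
  moreover have "z \<otimes> comm (comm (inv z) (inv x)) y \<otimes> inv z =
    inv x \<otimes> z \<otimes> x \<otimes> y \<otimes> inv x \<otimes> inv z \<otimes> x \<otimes> z \<otimes> inv y \<otimes> inv z"
    using assms by (simp add: group_word_simps)
  moreover have "y \<otimes> comm (comm (inv y) z) (inv x) \<otimes> inv y =
    z \<otimes> y \<otimes> inv z \<otimes> inv x \<otimes> z \<otimes> inv y \<otimes> inv z \<otimes> y \<otimes> x \<otimes> inv y"
    using assms by (simp add: group_word_simps)
  ultimately show ?thesis using assms by (simp add: group_word_simps)
qed

lemma normal_conj:
  assumes "N \<lhd> G" "x \<in> carrier G" "n \<in> N"
  shows "x \<otimes> n \<otimes> inv x \<in> N" "inv x \<otimes> n \<otimes> x \<in> N"
  using assms normal.inv_op_closed1 normal.inv_op_closed2 by fast+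

lemma normal_mem:
  assumes "N \<lhd> G"
  shows "\<one> \<in> N" "x \<in> N \<Longrightarrow> y \<in> N \<Longrightarrow> x \<otimes> y \<in> N" "x \<in> N \<Longrightarrow> inv x \<in> N" "x \<in> N \<Longrightarrow> x \<in> carrier G"
  using normal_imp_subgroup[OF assms]
  by (auto simp: subgroup.one_closed subgroup.m_closed subgroup.m_inv_closed subgroup.mem_carrier)

lemma normal_comm_inv:
  assumes "N \<lhd> G" "a \<in> carrier G" "b \<in> carrier G" "comm a b \<in> N"
  shows "comm (inv a) b \<in> N" "comm a (inv b) \<in> N" "comm b a \<in> N"
proof -
  have swap: "comm y x \<in> N" if "comm x y \<in> N" "x \<in> carrier G" "y \<in> carrier G" for x y
    using that normal_mem(3)[OF assms(1)] inv_comm by metis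
  have left: "comm (inv x) y \<in> N" if "comm x y \<in> N" "x \<in> carrier G" "y \<in> carrier G" for x y
    using that by (simp add: comm_inv_left normal_conj normal_mem assms)
  show "comm (inv a) b \<in> N" "comm b a \<in> N" using assms left swap by auto
  have "comm b a \<in> N" using assms swap by auto
  then show "comm a (inv b) \<in> N" using assms left swap by auto
qed

lemma normal_comm_mult:
  assumes "N \<lhd> G" "a \<in> carrier G" "b \<in> carrier G" "c \<in> carrier G" "comm a c \<in> N" "comm b c \<in> N"
  shows "comm (a \<otimes> b) c \<in> N"
  using assms by (simp add: comm_mult_left normal_conj normal_mem)

text \<open>The preimage in H of the centraliser of c modulo N. It reduces statements about
  commutators with c to generators.\<close>

lemma subgroup_comm_left:
  assumes "N \<lhd> G" "subgroup H G" "c \<in> carrier G"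
  shows "subgroup {a \<in> H. comm a c \<in> N} G"
proof
  show "{a \<in> H. comm a c \<in> N} \<subseteq> carrier G" using assms subgroup.subset by blast
qed (use assms in \<open>auto simp: comm_one normal_mem normal_comm_mult normal_comm_inv
    subgroup.m_closed subgroup.m_inv_closed subgroup.one_closed subgroup.mem_carrier\<close>)

lemma generate_subset_subgroup: "subgroup H G \<Longrightarrow> S \<subseteq> H \<Longrightarrow> generate G S \<subseteq> H"
  using generate_subgroup_incl by blast

text \<open>The three subgroups lemma for single elements: modulo N two factors of the Hall-Witt
  product are trivial, so the third one is.\<close>

lemma normal_comm_Jacobi:
  assumes "N \<lhd> G" "x \<in> carrier G" "y \<in> carrier G" "z \<in> carrier G"
    and 1: "comm (comm (inv z) (inv x)) y \<in> N"
    and 2: "comm (comm (inv y) z) (inv x) \<in> N"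
  shows "comm (comm x y) z \<in> N"
proof -
  define A where "A = inv x \<otimes> comm (comm x y) z \<otimes> x"
  define B where "B = (z \<otimes> comm (comm (inv z) (inv x)) y \<otimes> inv z) \<otimes>
    (y \<otimes> comm (comm (inv y) z) (inv x) \<otimes> inv y)"
  have c: "A \<in> carrier G" "B \<in> carrier G" using assms by (simp_all add: A_def B_def)
  have "A \<otimes> B = \<one>" unfolding A_def B_def using Hall_Witt[OF assms(2-4)] assms by (simp add: m_assoc)
  then have "A = inv B" using c inv_equality by metis
  moreover have "B \<in> N" unfolding B_def
    using assms by (intro normal_mem(2) normal_conj) auto
  ultimately have "A \<in> N" using normal_mem(3) assms(1) by simp
  then have "x \<otimes> A \<otimes> inv x \<in> N" using assms normal_conj(1) by blast
  moreover have "x \<otimes> A \<otimes> inv x = comm (comm x y) z"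
    unfolding A_def using assms by (simp add: m_assoc inv_cancel_left)
  ultimately show ?thesis by simp
qed

section \<open>Weights in the lower central series\<close>

abbreviation "\<gamma> \<equiv> lower_central G"

lemma lower_central_Suc:
  "n \<ge> 1 \<Longrightarrow> \<gamma> (Suc n) = generate G {comm a b | a b. a \<in> carrier G \<and> b \<in> \<gamma> n}"
  by (cases n) (auto simp: commutator_subgroup_def comm_def)

declare lower_central.simps(3) [simp del]

lemma normal_if_comm:
  assumes "subgroup N G" "\<And>a b. a \<in> carrier G \<Longrightarrow> b \<in> N \<Longrightarrow> comm a b \<in> N"
  shows "N \<lhd> G"
  unfolding normal_inv_iff using assms
  by (auto simp: comm_mult_conj subgroup.m_closed subgroup.mem_carrier)

text \<open>The claims are proved together: the next term is normal because it lies in the previous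
  one, so that its commutators with G are among its generators. The values at 0 and 1 coincide,
  hence the case split.\<close>

lemma lower_central_normal_Suc: "\<gamma> n \<lhd> G \<and> \<gamma> (Suc n) \<subseteq> \<gamma> n"
proof (induction n)
  case 0
  have "subgroup (carrier G) G" by (rule subgroup_self)
  then have "carrier G \<lhd> G" by (rule normal_if_comm) auto
  then show ?case by simp
next
  case (Suc n)
  have N: "\<gamma> (Suc n) \<lhd> G"
  proof (cases n)
    case 0
    have "subgroup (carrier G) G" by (rule subgroup_self)
    then have "carrier G \<lhd> G" by (rule normal_if_comm) auto
    then show ?thesis using 0 by simp
  next
    case (Suc m)
    let ?S = "{comm a b | a b. a \<in> carrier G \<and> b \<in> \<gamma> n}"
    have eq: "\<gamma> (Suc n) = generate G ?S" using Suc lower_central_Suc[of n] by simp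
    have "?S \<subseteq> carrier G" using Suc.IH normal_mem(4) by fastforce
    then have sg: "subgroup (\<gamma> (Suc n)) G" unfolding eq by (rule generate_is_subgroup)
    show ?thesis
    proof (rule normal_if_comm[OF sg])
      fix a b assume "a \<in> carrier G" "b \<in> \<gamma> (Suc n)"
      moreover from this have "b \<in> \<gamma> n" using Suc.IH by blast
      ultimately show "comm a b \<in> \<gamma> (Suc n)" unfolding eq by (auto intro: generate.incl)
    qed
  qed
  have "generate G {comm a b | a b. a \<in> carrier G \<and> b \<in> \<gamma> (Suc n)} \<subseteq> \<gamma> (Suc n)"
  proof (rule generate_subset_subgroup)
    show "subgroup (\<gamma> (Suc n)) G" using N by (rule normal_imp_subgroup)
    show "{comm a b |a b. a \<in> carrier G \<and> b \<in> \<gamma> (Suc n)} \<subseteq> \<gamma> (Suc n)"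
    proof clarify
      fix a b assume ab: "a \<in> carrier G" "b \<in> \<gamma> (Suc n)"
      have "comm a b = (a \<otimes> b \<otimes> inv a) \<otimes> inv b"
        using ab normal_mem(4)[OF N] by (simp add: comm_def)
      also have "\<dots> \<in> \<gamma> (Suc n)"
        using normal_mem(2,3)[OF N] normal_conj(1)[OF N] ab by simp
      finally show "comm a b \<in> \<gamma> (Suc n)" .
    qed
  qed
  then have "\<gamma> (Suc (Suc n)) \<subseteq> \<gamma> (Suc n)" by (simp add: lower_central_Suc)
  with N show ?case by blast
qed

lemma lower_central_normal: "\<gamma> n \<lhd> G"
  and lower_central_Suc_subset: "\<gamma> (Suc n) \<subseteq> \<gamma> n"
  using lower_central_normal_Suc by blast+

lemma lower_central_subgroup: "subgroup (\<gamma> n) G"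
  using lower_central_normal by (rule normal_imp_subgroup)

lemma lower_central_carrier: "x \<in> \<gamma> n \<Longrightarrow> x \<in> carrier G"
  using lower_central_normal by (rule normal_mem(4))

lemma comm_lower_central_Suc: "a \<in> carrier G \<Longrightarrow> b \<in> \<gamma> n \<Longrightarrow> n \<ge> 1 \<Longrightarrow> comm a b \<in> \<gamma> (Suc n)"
  unfolding lower_central_Suc by (auto intro: generate.incl)

lemma lower_central_between_normal:
  assumes "subgroup N G" "\<gamma> (Suc n) \<subseteq> N" "N \<subseteq> \<gamma> n" "n \<ge> 1"
  shows "N \<lhd> G"
  using assms comm_lower_central_Suc by (blast intro: normal_if_comm)

text \<open>By Hall-Witt, a commutator ((x, y), b) with y of weight i is traded for commutators
  built from (y, (x, b)) and (x, (y, b)). The first needs the induction hypothesis with j + 1, which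
  is why j is arbitrary; the second needs it with j.\<close>

lemma comm_lower_central:
  assumes "a \<in> \<gamma> i" "b \<in> \<gamma> j" "i \<ge> 1" "j \<ge> 1"
  shows "comm a b \<in> \<gamma> (i + j)"
  using assms(3,1,2,4)
proof (induction i arbitrary: a b j rule: dec_induct)
  case base
  then show ?case using comm_lower_central_Suc lower_central_carrier by simp
next
  case (step i)
  let ?N = "\<gamma> (Suc (i + j))"
  note N = lower_central_normal[of "Suc (i + j)"]
  have b: "b \<in> carrier G" using step.prems(2) by (rule lower_central_carrier)
  have "generate G {comm x y | x y. x \<in> carrier G \<and> y \<in> \<gamma> i} \<subseteq> {a \<in> carrier G. comm a b \<in> ?N}"
  proof (rule generate_subset_subgroup)
    show "subgroup {a \<in> carrier G. comm a b \<in> ?N} G"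
      using subgroup_comm_left[OF N subgroup_self b] .
    show "{comm x y | x y. x \<in> carrier G \<and> y \<in> \<gamma> i} \<subseteq> {a \<in> carrier G. comm a b \<in> ?N}"
    proof clarify
      fix x y assume x: "x \<in> carrier G" and y: "y \<in> \<gamma> i"
      have y': "y \<in> carrier G" using y by (rule lower_central_carrier)
      have inv: "inv c \<in> \<gamma> n" if "c \<in> \<gamma> n" for c n
        using normal_mem(3)[OF lower_central_normal that] .
      have "comm (inv x) (inv b) \<in> \<gamma> (Suc j)"
        using x inv[OF step.prems(2)] step.prems(3) by (intro comm_lower_central_Suc) simp_all
      from step.IH[OF y this] have "comm y (comm (inv x) (inv b)) \<in> ?N" by simp
      then have "comm (comm (inv x) (inv b)) y \<in> ?N"
        by (rule normal_comm_inv(3)[OF N, rotated 2]) (use x b y' in simp_all)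
      then have "comm (inv (comm (inv x) (inv b))) y \<in> ?N"
        by (rule normal_comm_inv(1)[OF N, rotated 2]) (use x b y' in simp_all)
      then have 1: "comm (comm (inv b) (inv x)) y \<in> ?N"
        using inv_comm[of "inv x" "inv b"] x b by simp
      have "comm (inv y) b \<in> \<gamma> (i + j)" using step.IH[OF inv[OF y] step.prems(2,3)] .
      from comm_lower_central_Suc[OF inv_closed[OF x] this]
      have "comm (inv x) (comm (inv y) b) \<in> ?N" using step.hyps by simp
      then have 2: "comm (comm (inv y) b) (inv x) \<in> ?N"
        by (rule normal_comm_inv(3)[OF N, rotated 2]) (use x b y' in simp_all)
      show "comm x y \<in> carrier G \<and> comm (comm x y) b \<in> ?N"
        using normal_comm_Jacobi[OF N x y' b 1 2] x y' by simp
    qed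
  qed
  then show ?case using step.prems(1) lower_central_Suc[OF step.hyps(1)] by auto
qed

text \<open>Removes the inverses that the Hall-Witt identity carries. The elements of weight i + j
  that commute with c modulo N form a group lying between consecutive terms of the series; such a
  group is normal, and normal subgroups tolerate inverses inside a commutator.\<close>

lemma lower_central_comm_inv:
  assumes N: "N \<lhd> G" "\<gamma> (Suc (i + j + k)) \<subseteq> N" "i \<ge> 1" "j \<ge> 1" "k \<ge> 1"
    and a: "a \<in> \<gamma> i" and b: "b \<in> \<gamma> j" and c: "c \<in> \<gamma> k" and abc: "comm (comm a b) c \<in> N"
  shows "comm (comm (inv a) b) c \<in> N" "comm (comm a (inv b)) c \<in> N"
    "comm (comm (inv a) (inv b)) c \<in> N"
proof -
  have [simp]: "a \<in> carrier G" "b \<in> carrier G" "c \<in> carrier G"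
    using a b c lower_central_carrier by auto
  define D where "D = {w \<in> \<gamma> (i + j). comm w c \<in> N}"
  have "D \<lhd> G"
  proof (rule lower_central_between_normal)
    show "subgroup D G" unfolding D_def
      using N lower_central_subgroup by (intro subgroup_comm_left) auto
    show "\<gamma> (Suc (i + j)) \<subseteq> D"
      using lower_central_Suc_subset comm_lower_central[of _ "Suc (i + j)" c k] c N
      by (auto simp: D_def)
  qed (use N in \<open>auto simp: D_def\<close>)
  moreover have "comm a b \<in> D" unfolding D_def using abc N a b comm_lower_central by simp
  ultimately have "comm (inv a) b \<in> D" "comm a (inv b) \<in> D" "comm (inv a) (inv b) \<in> D"
    using normal_comm_inv[of D a b] normal_comm_inv(2)[of D "inv a" b] by auto
  then show "comm (comm (inv a) b) c \<in> N" "comm (comm a (inv b)) c \<in> N"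
    "comm (comm (inv a) (inv b)) c \<in> N"
    by (auto simp: D_def)
qed

lemma lower_central_Jacobi:
  assumes N: "N \<lhd> G" "\<gamma> (Suc (i + j + k)) \<subseteq> N" "i \<ge> 1" "j \<ge> 1" "k \<ge> 1"
    and x: "x \<in> \<gamma> i" and y: "y \<in> \<gamma> j" and z: "z \<in> \<gamma> k"
    and 1: "comm (comm x z) y \<in> N"
    and 2: "comm (comm y z) x \<in> N"
  shows "comm (comm x y) z \<in> N"
proof -
  have [simp]: "x \<in> carrier G" "y \<in> carrier G" "z \<in> carrier G"
    using x y z lower_central_carrier by auto
  have "comm (comm (inv x) (inv z)) y \<in> N"
    using lower_central_comm_inv(3)[OF N(1) _ _ _ _ x z y 1] N by (simp add: algebra_simps)
  then have "comm (inv (comm (inv x) (inv z))) y \<in> N"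
    using normal_comm_inv(1)[OF N(1)] by simp
  then have "comm (comm (inv z) (inv x)) y \<in> N" by (simp add: inv_comm)
  moreover have "comm (comm (inv y) z) x \<in> N"
    using lower_central_comm_inv(1)[OF N(1) _ _ _ _ y z x 2] N by (simp add: algebra_simps)
  then have "comm (comm (inv y) z) (inv x) \<in> N"
    using normal_comm_inv(2)[OF N(1)] by simp
  ultimately show ?thesis using normal_comm_Jacobi[OF N(1)] by simp
qed

end

section \<open>Hall commutators generate the graded quotients\<close>

locale generated_group = group G for G (structure) +
  fixes s :: "'x \<Rightarrow> 'a" and X :: "'x set" and e :: "'x \<Rightarrow> nat"
  assumes gen_closed: "x \<in> X \<Longrightarrow> s x \<in> carrier G"
    and generated: "carrier G = generate G (s ` X)"
    and fin: "finite X"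
    and inj: "inj_on e X"
begin

primrec tree_comm :: "'x tree \<Rightarrow> 'a" where
  "tree_comm (Leaf x) = s x"
| "tree_comm (Br a b) = comm (tree_comm a) (tree_comm b)"

abbreviation weight :: "'x tree \<Rightarrow> nat"
  where "weight t \<equiv> length (foliage t)"

lemma weight_pos: "weight t \<ge> 1"
  by (cases "foliage t") (auto simp: Suc_le_eq)

lemma tree_comm_lower_central: "hall e X t \<Longrightarrow> tree_comm t \<in> \<gamma> (weight t)"
  by (induction t) (auto simp: gen_closed intro: comm_lower_central weight_pos)

lemma tree_comm_closed [simp]: "hall e X t \<Longrightarrow> tree_comm t \<in> carrier G"
  using tree_comm_lower_central lower_central_carrier by blast

text \<open>Stands for the subgroup of the graded quotient generated by the Hall commutators from H;
  adjoining \<gamma> (n + 1) avoids cosets. H records an order bound during rewriting and a finite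
  set when generators are eliminated one by one.\<close>

definition hall_gen :: "'x tree set \<Rightarrow> nat \<Rightarrow> 'a set"
  where "hall_gen H n = generate G (tree_comm ` {h \<in> H. hall e X h \<and> weight h = n} \<union> \<gamma> (Suc n))"

lemma hall_gen_subgroup: "subgroup (hall_gen H n) G"
  unfolding hall_gen_def using lower_central_carrier by (intro generate_is_subgroup) auto

lemma hall_gen_incl:
  "h \<in> H \<Longrightarrow> hall e X h \<Longrightarrow> weight h = n \<Longrightarrow> tree_comm h \<in> hall_gen H n"
  "\<gamma> (Suc n) \<subseteq> hall_gen H n"
  unfolding hall_gen_def by (auto intro: generate.incl)

lemma hall_gen_subset:
  assumes "subgroup K G" "\<gamma> (Suc n) \<subseteq> K"
    "\<And>h. h \<in> H \<Longrightarrow> hall e X h \<Longrightarrow> weight h = n \<Longrightarrow> tree_comm h \<in> K"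
  shows "hall_gen H n \<subseteq> K"
  unfolding hall_gen_def using assms by (intro generate_subset_subgroup) auto

lemma hall_gen_mono: "H \<subseteq> H' \<Longrightarrow> hall_gen H n \<subseteq> hall_gen H' n"
  using hall_gen_incl hall_gen_subgroup by (intro hall_gen_subset) auto

lemma hall_gen_lower_central: "hall_gen H n \<subseteq> \<gamma> n"
  using lower_central_Suc_subset lower_central_subgroup tree_comm_lower_central
  by (intro hall_gen_subset) auto

lemma hall_gen_normal: "n \<ge> 1 \<Longrightarrow> hall_gen H n \<lhd> G"
  using hall_gen_subgroup hall_gen_incl(2) hall_gen_lower_central
  by (rule lower_central_between_normal)

abbreviation below :: "nat list \<Rightarrow> 'x tree set"
  where "below v \<equiv> {h. key e h < v}"

lemma hall_comm_sym:
  assumes c: "hall e X c" "c \<in> H" and d: "hall e X d" "d \<in> H"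
    and cd: "key e c < key e d \<Longrightarrow> comm (tree_comm c) (tree_comm d) \<in> hall_gen H n"
    and dc: "key e d < key e c \<Longrightarrow> comm (tree_comm d) (tree_comm c) \<in> hall_gen H n"
    and n: "n \<ge> 1"
  shows "comm (tree_comm c) (tree_comm d) \<in> hall_gen H n"
proof (cases "key e c" "key e d" rule: linorder_cases)
  case equal
  then have "c = d" using key_inj[OF inj] c d by blast
  then show ?thesis using c comm_self normal_mem(1)[OF hall_gen_normal[OF n]] by simp
next
  case greater
  show ?thesis
    using normal_comm_inv(3)[OF hall_gen_normal[OF n] _ _ dc[OF greater]] c d by simp
qed (use cd in simp)

text \<open>In z the condition defines a subgroup, so generators suffice; those from \<gamma> (j +
  1) have commutators of weight above i + j.\<close>

lemma comm_hall_gen: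
  assumes x: "x \<in> \<gamma> i" "i \<ge> 1" and K: "K \<lhd> G" "\<gamma> (Suc (i + j)) \<subseteq> K"
    and z: "z \<in> hall_gen H j" and j: "j \<ge> 1"
    and gens: "\<And>h. h \<in> H \<Longrightarrow> hall e X h \<Longrightarrow> weight h = j \<Longrightarrow> comm (tree_comm h) x \<in> K"
  shows "comm z x \<in> K"
proof -
  have "hall_gen H j \<subseteq> {z \<in> carrier G. comm z x \<in> K}"
  proof (rule hall_gen_subset)
    show "subgroup {z \<in> carrier G. comm z x \<in> K} G"
      using subgroup_comm_left[OF K(1) subgroup_self] x(1) lower_central_carrier by blast
    have "comm z x \<in> K" if "z \<in> \<gamma> (Suc j)" for z
      using comm_lower_central[OF that x(1) _ x(2)] K(2) by (auto simp: algebra_simps)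
    then show "\<gamma> (Suc j) \<subseteq> {z \<in> carrier G. comm z x \<in> K}"
      using lower_central_carrier by auto
  qed (use gens in auto)
  then show ?thesis using z by auto
qed

text \<open>
  The group version of the rewriting of \<open>[P\<^sub>a, P\<^sub>b]\<close> in the Lyndon basis: if \<open>Br a b\<close> is not a Hall
  tree, the Jacobi identity leads to brackets of smaller weight or of pairs with a smaller maximum.
\<close>

lemma hall_comm_mem:
  assumes "hall e X a" "hall e X b" "key e a < key e b" "weight a + weight b = n"
  shows "comm (tree_comm a) (tree_comm b) \<in> hall_gen (below (key e b)) n"
  using assms
proof (induction n arbitrary: a b rule: less_induct)
  case (less n)
  note outer = less.IH
  have n: "n \<ge> 1" if "weight a + weight b = n" for a b :: "'x tree"
    using that weight_pos[of a] by simp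
  \<comment> \<open>The lexicographic order on all words has infinite descending chains. The
    induction on the larger key therefore counts the words of length at most n below it, a finite
    number since X is finite.\<close>
  define W where "W v = {w. set w \<subseteq> e ` X \<and> length w \<le> n \<and> w < v}" for v
  have finW: "finite (W v)" for v
    by (rule finite_subset[OF _ finite_lists_length_le[of "e ` X" n]]) (use fin in \<open>auto simp: W_def\<close>)
  show ?case using less.prems
  proof (induction "card (W (key e b))" arbitrary: a b rule: less_induct)
    case less
    note n = n[OF less.prems(4)]
    let ?v = "key e b"
    let ?Q = "hall_gen (below ?v) n"
    note Q = hall_gen_normal[OF n, of "below ?v"]
    have inner: "comm (tree_comm c) (tree_comm d) \<in> ?Q"
      if "hall e X c" "hall e X d" "key e c < key e d" "weight c + weight d = n" "key e d < ?v" for c d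
    proof -
      have "key e d \<in> W ?v" using that foliage_hall[OF that(2)] by (auto simp: W_def key_def)
      moreover have "W (key e d) \<subseteq> W ?v" "key e d \<notin> W (key e d)" using that by (auto simp: W_def)
      ultimately have "card (W (key e d)) < card (W ?v)"
        using finW by (intro psubset_card_mono) auto
      from less.hyps[OF this that(1-4)]
      have "comm (tree_comm c) (tree_comm d) \<in> hall_gen (below (key e d)) n" .
      moreover have "below (key e d) \<subseteq> below ?v" using that(5) by auto
      ultimately show ?thesis using hall_gen_mono by blast
    qed
    have sym: "comm (tree_comm c) (tree_comm d) \<in> ?Q"
      if cd: "hall e X c" "hall e X d" "weight c + weight d = n" "key e c < ?v" "key e d < ?v" for c d
    proof (rule hall_comm_sym)
      show "comm (tree_comm c) (tree_comm d) \<in> ?Q" if "key e c < key e d"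
        using inner[of c d] that cd by simp
      show "comm (tree_comm d) (tree_comm c) \<in> ?Q" if "key e d < key e c"
        using inner[of d c] that cd by simp
    qed (use cd n in simp_all)
    show ?case
    proof (cases "hall e X (Br a b)")
      case True
      then have "tree_comm (Br a b) \<in> ?Q"
        using key_Br_less[of e X a b] less.prems by (intro hall_gen_incl) auto
      then show ?thesis by simp
    next
      case False
      then obtain a1 a2 where a: "a = Br a1 a2" and a2b: "key e a2 < ?v"
        using less.prems by (cases a) auto
      have h: "hall e X a1" "hall e X a2" "hall e X b" using less.prems a by auto
      have a1b: "key e a1 < ?v"
        using less_append_right[of "key e a2" "key e a1"] less.prems(3) a by simp
      have wt: "weight a1 + weight a2 + weight b = n" using less.prems a by simp
      note g = h[THEN tree_comm_lower_central]
      \<comment> \<open>The bracket of c and b has smaller weight, so the outer induction writes it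
        in Hall commutators with keys below \<open>key e b\<close>. Paired with d, each of them has
        a smaller maximal key, and the inner induction applies.\<close>
      have step: "comm (comm (tree_comm c) (tree_comm b)) (tree_comm d) \<in> ?Q"
        if cd: "hall e X c" "hall e X d" "weight c + weight b + weight d = n" "key e c < ?v" "key e d < ?v"
        for c d
      proof (rule comm_hall_gen)
        let ?j = "weight c + weight b"
        show "tree_comm d \<in> \<gamma> (weight d)" using cd tree_comm_lower_central by blast
        show "comm (tree_comm c) (tree_comm b) \<in> hall_gen (below ?v) ?j"
          using outer[of ?j c b] cd h weight_pos[of d] by simp
        show "\<gamma> (Suc (weight d + ?j)) \<subseteq> ?Q"
          using hall_gen_incl(2)[of n] cd by (simp add: algebra_simps)
        show "?Q \<lhd> G" by (rule Q)
        show "comm (tree_comm h) (tree_comm d) \<in> ?Q"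
          if "h \<in> below ?v" "hall e X h" "weight h = ?j" for h
          using sym[of h d] that cd by simp
        show "weight d \<ge> 1" "?j \<ge> 1" using weight_pos[of d] weight_pos[of c] by auto
      qed
      have "comm (comm (tree_comm a1) (tree_comm a2)) (tree_comm b) \<in> ?Q"
      proof (rule lower_central_Jacobi[OF Q _ _ _ _ g])
        show "\<gamma> (Suc (weight a1 + weight a2 + weight b)) \<subseteq> ?Q"
          using hall_gen_incl(2)[of n] wt by simp
        show "comm (comm (tree_comm a1) (tree_comm b)) (tree_comm a2) \<in> ?Q"
          "comm (comm (tree_comm a2) (tree_comm b)) (tree_comm a1) \<in> ?Q"
          using step[of a1 a2] step[of a2 a1] wt h a1b a2b by simp_all
      qed (rule weight_pos)+
      then show ?thesis using a by simp
    qed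
  qed
qed

text \<open>In a generator (y, z) of \<gamma> (n + 1), y may be taken to be a letter and z a Hall
  commutator of weight n, because both conditions define subgroups. What remains is a pair of Hall
  trees, one of them a leaf.\<close>

lemma lower_central_eq_hall_gen:
  assumes "n \<ge> 1"
  shows "\<gamma> n = hall_gen UNIV n"
  using assms
proof (induction n rule: dec_induct)
  case base
  have "s ` X \<subseteq> hall_gen UNIV 1"
    using hall_gen_incl(1)[of "Leaf x" UNIV 1 for x] by auto
  then have "carrier G \<subseteq> hall_gen UNIV 1"
    unfolding generated by (intro generate_subset_subgroup hall_gen_subgroup)
  then show ?case using hall_gen_lower_central[of UNIV 1] by auto
next
  case (step n)
  let ?Q = "hall_gen UNIV (Suc n)"
  have Q: "?Q \<lhd> G" by (rule hall_gen_normal) simp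
  have leaf: "comm (s x) z \<in> ?Q" if x: "x \<in> X" and z: "z \<in> \<gamma> n" for x z
  proof -
    have "comm z (s x) \<in> ?Q"
    proof (rule comm_hall_gen)
      show "s x \<in> \<gamma> 1" using gen_closed x by simp
      show "\<gamma> (Suc (1 + n)) \<subseteq> ?Q" using hall_gen_incl(2)[of "Suc n"] by simp
      show "z \<in> hall_gen UNIV n" using z step.IH by simp
      show "comm (tree_comm h) (s x) \<in> ?Q"
        if h: "h \<in> UNIV" "hall e X h" "weight h = n" for h
      proof -
        have 1: "comm (tree_comm h) (tree_comm (Leaf x)) \<in> hall_gen UNIV (Suc n)"
          if "key e h < key e (Leaf x)"
          using hall_comm_mem[of h "Leaf x" "Suc n"] hall_gen_mono[of _ UNIV "Suc n"] that h x by auto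
        have 2: "comm (tree_comm (Leaf x)) (tree_comm h) \<in> hall_gen UNIV (Suc n)"
          if "key e (Leaf x) < key e h"
          using hall_comm_mem[of "Leaf x" h "Suc n"] hall_gen_mono[of _ UNIV "Suc n"] that h x by auto
        show ?thesis using hall_comm_sym[of h UNIV "Leaf x" "Suc n"] 1 2 h x by simp
      qed
    qed (use Q step.hyps in simp_all)
    then show ?thesis
      using normal_comm_inv(3)[OF Q, of z "s x"] gen_closed[OF x] lower_central_carrier[OF z] by simp
  qed
  have "comm y z \<in> ?Q" if y: "y \<in> carrier G" and z: "z \<in> \<gamma> n" for y z
  proof -
    have "carrier G \<subseteq> {y \<in> carrier G. comm y z \<in> ?Q}"
    proof (subst generated, rule generate_subset_subgroup)
      show "subgroup {y \<in> carrier G. comm y z \<in> ?Q} G"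
        using subgroup_comm_left[OF Q subgroup_self lower_central_carrier[OF z]] .
      show "s ` X \<subseteq> {y \<in> carrier G. comm y z \<in> ?Q}" using leaf z gen_closed by auto
    qed
    then show ?thesis using y by auto
  qed
  then have "\<gamma> (Suc n) \<subseteq> ?Q"
    unfolding lower_central_Suc[OF step.hyps(1)]
    by (intro generate_subset_subgroup hall_gen_subgroup) auto
  then show ?case using hall_gen_lower_central by auto
qed

end

section \<open>The free group as a group generated by its letters\<close>

lemma generated_free_group:
  assumes "finite X" "inj_on e X"
  shows "generated_group (free_group X) (\<lambda>x. [(True, x)]) X e"
proof -
  interpret group "free_group X" by (rule group_free_group)
  let ?S = "(\<lambda>x. [(True, x)]) ` X"
  have S: "?S \<subseteq> carrier (free_group X)" by (auto simp: free_group_def)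
  have "w \<in> generate (free_group X) ?S" if "w \<in> carrier (free_group X)" for w
    using that
  proof (induction w)
    case Nil
    then show ?case using generate.one[of "free_group X" ?S] by (simp add: free_group_def)
  next
    case (Cons a w)
    obtain b x where [simp]: "a = (b, x)" by (cases a)
    have x: "x \<in> X" and w: "w \<in> carrier (free_group X)" and red: "reduced (a # w)"
      using Cons.prems by (auto simp: free_group_def)
    have a: "[a] \<in> generate (free_group X) ?S"
    proof (cases b)
      case True
      then show ?thesis using x by (auto intro: generate.incl)
    next
      case False
      have "inv\<^bsub>free_group X\<^esub> [(True, x)] = [a]"
        using x False by (intro inv_equality) (auto simp: free_group_def inv_letter_def)
      then show ?thesis using generate.inv[of "[(True, x)]" ?S "free_group X"] x by auto
    qed
    have "[a] \<otimes>\<^bsub>free_group X\<^esub> w = a # w"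
      using red by (cases w) (auto simp: free_group_def)
    then show ?case using generate.eng[OF a Cons.IH[OF w]] by simp
  qed
  then have "carrier (free_group X) = generate (free_group X) ?S"
    using generate_incl[OF S] by blast
  then show ?thesis using S assms by unfold_locales auto
qed

section \<open>Non-commutative polynomials\<close>

abbreviation lookup :: "('a \<Rightarrow>\<^sub>0 'b::zero) \<Rightarrow> 'a \<Rightarrow> 'b"
  where "lookup \<equiv> Poly_Mapping.lookup"

interpretation pm: vector_space scale_pm
  by (rule vector_space_scale_pm)

text \<open>The pairs of words with product w are the cuts of w, so the convolution becomes a finite
  sum over cut positions, the shape of (A2).\<close>

lemma lookup_times_word:
  fixes p q :: "'x list \<Rightarrow>\<^sub>0 'k::semiring_0"
  shows "lookup (p * q) w = (\<Sum>i\<le>length w. lookup p (take i w) * lookup q (drop i w))"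
proof -
  let ?h = "\<lambda>u. lookup p u * (\<Sum>v. lookup q v when w = u + v)"
  have inner: "(\<Sum>v. lookup q v when w = take i w + v) = lookup q (drop i w)" for i
  proof -
    have eq: "w = take i w + v \<longleftrightarrow> v = drop i w" for v
      unfolding plus_list_def using same_append_eq[of "take i w" "drop i w" v] by auto
    show ?thesis unfolding eq by simp
  qed
  have zero: "?h u = 0" if "u \<notin> (\<lambda>i. take i w) ` {..length w}" for u
  proof -
    have "w \<noteq> u + v" for v
    proof
      assume "w = u + v"
      then have "u = take (length u) w" "length u \<le> length w" by (auto simp: plus_list_def)
      with that show False by blast
    qed
    then show ?thesis by simp
  qed
  have "lookup (p * q) w = (\<Sum>u. ?h u)" by (rule lookup_mult)
  also have "\<dots> = (\<Sum>u\<in>(\<lambda>i. take i w) ` {..length w}. ?h u)"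
    using zero by (intro Sum_any.expand_superset) auto
  also have "\<dots> = (\<Sum>i\<le>length w. ?h (take i w))"
  proof (rule sum.reindex_cong[OF _ refl refl])
    show "inj_on (\<lambda>i. take i w) {..length w}"
      by (rule inj_on_inverseI[of _ length]) simp
  qed
  finally show ?thesis by (simp only: inner)
qed

lemma scale_pm_mult:
  fixes p q :: "('x, 'k::field) ncpoly"
  shows "scale_pm c p * q = scale_pm c (p * q)" "p * scale_pm c q = scale_pm c (p * q)"
  by (intro poly_mapping_eqI; simp add: lookup_times_word sum_distrib_left mult_ac)+

lemma Ass_deg_iff:
  "p \<in> Ass_deg X k \<longleftrightarrow> (\<forall>w. lookup p w \<noteq> 0 \<longrightarrow> w \<in> lists X \<and> length w = k)"
  unfolding Ass_deg_def Ass_def mem_Collect_eq subset_iff Ball_def in_keys_iff by blast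

lemma Ass_degI: "(\<And>w. w \<notin> lists X \<or> length w \<noteq> k \<Longrightarrow> lookup p w = 0) \<Longrightarrow> p \<in> Ass_deg X k"
  unfolding Ass_deg_iff by blast

lemma Ass_degD: "p \<in> Ass_deg X k \<Longrightarrow> w \<notin> lists X \<or> length w \<noteq> k \<Longrightarrow> lookup p w = 0"
  unfolding Ass_deg_iff by blast

lemma Ass_deg_subspace: "pm.subspace (Ass_deg X k)"
  by (rule pm.subspaceI; rule Ass_degI; simp only: lookup_add lookup_zero lookup_scale_pm Ass_degD
    add_0_left mult_zero_right)

lemma var_Ass_deg: "x \<in> X \<Longrightarrow> var x \<in> Ass_deg X 1"
  by (auto simp: Ass_deg_iff var_def lookup_single when_def)

lemma lookup_times_Ass_deg:
  assumes "p \<in> Ass_deg X i"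
  shows "lookup (p * q) w = (if i \<le> length w then lookup p (take i w) * lookup q (drop i w) else 0)"
proof -
  have "lookup (p * q) w = (\<Sum>n\<le>length w. if n = i then lookup p (take i w) * lookup q (drop i w) else 0)"
    unfolding lookup_times_word by (intro sum.cong) (auto simp: Ass_degD[OF assms])
  then show ?thesis by simp
qed

lemma times_Ass_deg:
  assumes "p \<in> Ass_deg X i" "q \<in> Ass_deg X j"
  shows "p * q \<in> Ass_deg X (i + j)"
  unfolding Ass_deg_iff
proof (intro allI impI)
  fix w assume "lookup (p * q) w \<noteq> 0"
  then have "i \<le> length w" "lookup p (take i w) \<noteq> 0" "lookup q (drop i w) \<noteq> 0"
    unfolding lookup_times_Ass_deg[OF assms(1)] by (auto split: if_splits)
  moreover from this have "take i w \<in> lists X" "drop i w \<in> lists X" "length (drop i w) = j"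
    using assms unfolding Ass_deg_iff by blast+
  moreover from this have "take i w @ drop i w \<in> lists X" by (simp only: append_in_lists_conv)
  ultimately show "w \<in> lists X \<and> length w = i + j" by auto
qed

section \<open>Left-normed brackets span the free Lie algebra\<close>

definition bracket :: "('x, 'k::field) ncpoly \<Rightarrow> ('x, 'k) ncpoly \<Rightarrow> ('x, 'k) ncpoly"
  where "bracket p q = p * q - q * p"

lemma bracket_linear [simp]:
  "bracket 0 q = 0" "bracket p 0 = 0"
  "bracket (p + p') q = bracket p q + bracket p' q"
  "bracket p (q + q') = bracket p q + bracket p q'"
  "bracket (scale_pm c p) q = scale_pm c (bracket p q)"
  "bracket p (scale_pm c q) = scale_pm c (bracket p q)"
  by (auto simp: bracket_def algebra_simps scale_pm_mult pm.scale_right_diff_distrib)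

lemma bracket_Ass_deg:
  assumes "p \<in> Ass_deg X i" "q \<in> Ass_deg X j"
  shows "bracket p q \<in> Ass_deg X (i + j)"
  unfolding bracket_def
  using times_Ass_deg[OF assms] times_Ass_deg[OF assms(2,1)]
  by (auto intro!: pm.subspace_diff[OF Ass_deg_subspace] simp: add.commute)

lemma bracket_span:
  assumes "p \<in> span_pm S" "q \<in> span_pm T" "\<And>s t. s \<in> S \<Longrightarrow> t \<in> T \<Longrightarrow> bracket s t \<in> span_pm U"
  shows "bracket p q \<in> span_pm U"
proof -
  have 1: "bracket p t \<in> span_pm U" if "t \<in> T" for t
    using assms(1)
    by (rule pm.span_induct) (auto simp: pm.subspace_def assms that pm.span_zero pm.span_add pm.span_scale)
  show ?thesis
    using assms(2)
    by (rule pm.span_induct) (auto simp: pm.subspace_def 1 pm.span_zero pm.span_add pm.span_scale)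
qed

primrec left_normed :: "('x, 'k::field) ncpoly \<Rightarrow> 'x list \<Rightarrow> ('x, 'k) ncpoly" where
  "left_normed p [] = p"
| "left_normed p (z # zs) = left_normed (bracket p (var z)) zs"

lemma left_normed_snoc: "left_normed p (zs @ [z]) = bracket (left_normed p zs) (var z)"
  by (induction zs arbitrary: p) auto

definition left_normed_brackets :: "'x set \<Rightarrow> nat \<Rightarrow> ('x, 'k::field) ncpoly set"
  where "left_normed_brackets X k = {left_normed (var x) zs | x zs. x \<in> X \<and> zs \<in> lists X \<and> Suc (length zs) = k}"

lemma left_normed_brackets_1: "left_normed_brackets X 1 = var ` X"
  by (auto simp: left_normed_brackets_def)

lemma left_normed_brackets_Suc:
  assumes "k \<ge> 1"
  shows "left_normed_brackets X (Suc k) = {bracket p (var x) | p x. p \<in> left_normed_brackets X k \<and> x \<in> X}"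
    (is "?L = ?R")
proof (intro equalityI subsetI)
  fix q :: "('a, 'b) ncpoly" assume "q \<in> ?L"
  then obtain x zs where q: "q = left_normed (var x) zs" "x \<in> X" "zs \<in> lists X" "length zs = k"
    by (auto simp: left_normed_brackets_def)
  moreover obtain ys y where "zs = ys @ [y]" using q assms by (cases zs rule: rev_cases) auto
  ultimately show "q \<in> ?R"
    unfolding left_normed_brackets_def by (fastforce simp: left_normed_snoc)
next
  fix q :: "('a, 'b) ncpoly" assume "q \<in> ?R"
  then obtain x y zs where "q = left_normed (var x) (zs @ [y])" "x \<in> X" "y \<in> X" "zs \<in> lists X" "Suc (length zs) = k"
    by (auto simp: left_normed_brackets_def left_normed_snoc)
  then show "q \<in> ?L"
    unfolding left_normed_brackets_def by (intro CollectI exI[of _ x] exI[of _ "zs @ [y]"]) auto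
qed

lemma left_normed_free_lie: "p \<in> free_lie X \<Longrightarrow> zs \<in> lists X \<Longrightarrow> left_normed p zs \<in> free_lie X"
  by (induction zs arbitrary: p) (auto simp: bracket_def intro!: free_lie.bracket free_lie.var)

lemma left_normed_Ass_deg:
  "p \<in> Ass_deg X i \<Longrightarrow> zs \<in> lists X \<Longrightarrow> left_normed p zs \<in> Ass_deg X (i + length zs)"
proof (induction zs arbitrary: p i)
  case (Cons z zs)
  then have "bracket p (var z) \<in> Ass_deg X (i + 1)"
    by (intro bracket_Ass_deg var_Ass_deg) auto
  from Cons.IH[OF this] Cons.prems show ?case by simp
qed simp

lemma left_normed_brackets_free_lie_deg: "left_normed_brackets X k \<subseteq> free_lie_deg X k"
  unfolding left_normed_brackets_def free_lie_deg_def
  using left_normed_free_lie free_lie.var left_normed_Ass_deg[OF var_Ass_deg] by fastforce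

lemma left_normed_brackets_Ass_deg: "left_normed_brackets X k \<subseteq> Ass_deg X k"
  using left_normed_brackets_free_lie_deg unfolding free_lie_deg_def by blast

lemma finite_left_normed_brackets:
  assumes "finite X"
  shows "finite (left_normed_brackets X k)"
proof -
  have "finite {zs. set zs \<subseteq> X \<and> length zs = k - 1}" using assms by (rule finite_lists_length_eq)
  then have "finite (X \<times> {zs. set zs \<subseteq> X \<and> length zs = k - 1})" using assms by simp
  moreover have "left_normed_brackets X k \<subseteq> (\<lambda>(x, zs). left_normed (var x) zs) ` (X \<times> {zs. set zs \<subseteq> X \<and> length zs = k - 1})"
    by (fastforce simp: left_normed_brackets_def)
  ultimately show ?thesis by (rule finite_surj)
qed

text \<open>By the Jacobi identity [p, [q, z]] = [[p, q], z] - [[p, z], q]. Bracketing with a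
  left-normed bracket thus reduces to shorter ones and to letters; p changes on the way, so it is
  arbitrary in the induction.\<close>

lemma free_lie_subset_span:
  "free_lie X \<subseteq> (span_pm (\<Union>k. left_normed_brackets X k) :: ('a, 'b::field) ncpoly set)"
proof
  let ?A = "span_pm (\<Union>k. left_normed_brackets X k) :: ('a, 'b) ncpoly set"
  have var: "bracket p (var x) \<in> ?A" if "p \<in> ?A" "x \<in> X" for p x
  proof (rule bracket_span[OF that(1) pm.span_base[OF singletonI]])
    fix s t :: "('a, 'b) ncpoly" assume "s \<in> (\<Union>k. left_normed_brackets X k)" "t \<in> {var x}"
    moreover from this obtain y zs where "s = left_normed (var y) zs" "y \<in> X" "zs \<in> lists X"
      by (auto simp: left_normed_brackets_def)
    ultimately have "bracket s t = left_normed (var y) (zs @ [x])" "y \<in> X" "zs @ [x] \<in> lists X"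
      using that by (auto simp: left_normed_snoc)
    then have "bracket s t \<in> left_normed_brackets X (Suc (Suc (length zs)))"
      unfolding left_normed_brackets_def by force
    then show "bracket s t \<in> ?A" by (intro pm.span_base) blast
  qed
  have left_normed: "bracket p (left_normed (var x) zs) \<in> ?A" if "x \<in> X" "zs \<in> lists X" "p \<in> ?A" for p x zs
    using that
  proof (induction zs arbitrary: p rule: rev_induct)
    case Nil
    then show ?case using var by simp
  next
    case (snoc z zs)
    let ?q = "left_normed (var x) zs"
    have "bracket p (bracket ?q (var z)) = bracket (bracket p ?q) (var z) - bracket (bracket p (var z)) ?q"
      by (simp add: bracket_def algebra_simps)
    moreover have "bracket (bracket p ?q) (var z) \<in> ?A" "bracket (bracket p (var z)) ?q \<in> ?A"
      using snoc var by auto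
    ultimately show ?case by (simp add: left_normed_snoc pm.span_diff)
  qed
  have br: "bracket p q \<in> ?A" if "p \<in> ?A" "q \<in> ?A" for p q
  proof (rule bracket_span[OF pm.span_base[OF singletonI] that(2)])
    fix s t :: "('a, 'b) ncpoly" assume "s \<in> {p}" "t \<in> (\<Union>k. left_normed_brackets X k)"
    then show "bracket s t \<in> ?A" using left_normed that by (auto simp: left_normed_brackets_def)
  qed
  fix p :: "('a, 'b) ncpoly" assume "p \<in> free_lie X"
  then show "p \<in> ?A"
  proof induction
    case (var x)
    then show ?case using left_normed_brackets_1[of X] by (intro pm.span_base) blast
  qed (use br in \<open>auto simp: pm.span_zero pm.span_add pm.span_scale bracket_def\<close>)
qed

lemma span_left_normed_brackets_Ass_deg: "span_pm (left_normed_brackets X k) \<subseteq> Ass_deg X k"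
  using left_normed_brackets_Ass_deg Ass_deg_subspace by (intro pm.span_minimal)

text \<open>Projection to degree k: each left-normed bracket agrees, on words of length k, with
  itself or with 0 according to its degree, and linear combinations inherit such a partner in the
  span of degree k.\<close>

lemma free_lie_deg_subset_span: "free_lie_deg X k \<subseteq> span_pm (left_normed_brackets X k)"
proof
  fix p :: "('a, 'b) ncpoly" assume p: "p \<in> free_lie_deg X k"
  let ?C = "\<lambda>(p :: ('a, 'b) ncpoly) q. q \<in> span_pm (left_normed_brackets X k) \<and> (\<forall>w. length w = k \<longrightarrow> lookup q w = lookup p w)"
  have "p \<in> span_pm (\<Union>k. left_normed_brackets X k)"
    using p free_lie_subset_span by (auto simp: free_lie_deg_def)
  then have "\<exists>q. ?C p q"
  proof (rule pm.span_induct)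
    show "pm.subspace {p. \<exists>q. ?C p q}"
    proof (rule pm.subspaceI)
      show "0 \<in> {p. \<exists>q. ?C p q}" by (auto intro!: exI[of _ 0] pm.span_zero)
      fix p p' :: "('a, 'b) ncpoly" assume "p \<in> {p. \<exists>q. ?C p q}" "p' \<in> {p. \<exists>q. ?C p q}"
      then obtain q q' where "?C p q" "?C p' q'" by blast
      then have "?C (p + p') (q + q')" by (auto simp: pm.span_add lookup_add)
      then show "p + p' \<in> {p. \<exists>q. ?C p q}" by blast
    next
      fix c and p :: "('a, 'b) ncpoly" assume "p \<in> {p. \<exists>q. ?C p q}"
      then obtain q where "?C p q" by blast
      then have "?C (scale_pm c p) (scale_pm c q)" by (auto simp: pm.span_scale)
      then show "scale_pm c p \<in> {p. \<exists>q. ?C p q}" by blast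
    qed
    fix p :: "('a, 'b) ncpoly" assume "p \<in> (\<Union>k. left_normed_brackets X k)"
    then obtain j where j: "p \<in> left_normed_brackets X j" by blast
    then have "p \<in> Ass_deg X j" using left_normed_brackets_Ass_deg by blast
    then have "?C p (if j = k then p else 0)"
      using j by (auto simp: pm.span_base pm.span_zero Ass_degD)
    then show "\<exists>q. ?C p q" by blast
  qed
  then obtain q where q: "?C p q" by blast
  moreover have "q \<in> Ass_deg X k" "p \<in> Ass_deg X k"
    using q p span_left_normed_brackets_Ass_deg by (auto simp: free_lie_deg_def)
  ultimately have "lookup p w = lookup q w" for w by (cases "length w = k") (auto simp: Ass_degD)
  then have "p = q" by (rule poly_mapping_eqI)
  then show "p \<in> span_pm (left_normed_brackets X k)" using q by simp
qed

subsection \<open>Lie polynomials of Hall trees\<close>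

primrec lie_poly :: "'x tree \<Rightarrow> ('x, 'k::field) ncpoly" where
  "lie_poly (Leaf x) = var x"
| "lie_poly (Br a b) = bracket (lie_poly a) (lie_poly b)"

lemma lie_poly_free_lie_deg:
  "hall e X t \<Longrightarrow> (lie_poly t :: ('x, 'k::field) ncpoly) \<in> free_lie_deg X (length (foliage t))"
proof (induction t)
  case (Br a b)
  let ?P = "lie_poly :: 'x tree \<Rightarrow> ('x, 'k) ncpoly"
  have "?P a \<in> free_lie X" "?P b \<in> free_lie X" "?P a \<in> Ass_deg X (length (foliage a))"
    "?P b \<in> Ass_deg X (length (foliage b))"
    using Br by (auto simp: free_lie_deg_def)
  then show ?case
    using bracket_Ass_deg free_lie.bracket by (auto simp: free_lie_deg_def bracket_def)
qed (auto simp: free_lie_deg_def free_lie.var var_Ass_deg[simplified])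

lemma append_le_mono:
  fixes u u' :: "'a::linorder list"
  assumes "u \<le> u'" "v \<le> v'" "length u = length u'"
  shows "u @ v \<le> u' @ v'"
  using assms less_append_mono[of u u' v v'] by (auto simp: le_less)

text \<open>All words in a homogeneous polynomial have equal length, so least words concatenate.
  With u < v the words of a and b, the products contribute least words \<open>u @ v\<close> and
  \<open>v @ u\<close>, and \<open>u @ v < v < v @ u\<close> keeps the second product away from the
  word of the tree.\<close>

lemma lie_poly_triangular:
  assumes "hall e X t"
  shows "lookup (lie_poly t :: ('x, 'k::field) ncpoly) (foliage t) = 1"
    and "lookup (lie_poly t :: ('x, 'k) ncpoly) w \<noteq> 0 \<Longrightarrow> key e t \<le> map e w"
proof -
  have "lookup (lie_poly t :: ('x, 'k) ncpoly) (foliage t) = 1 \<and>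
    (\<forall>w. lookup (lie_poly t :: ('x, 'k) ncpoly) w \<noteq> 0 \<longrightarrow> key e t \<le> map e w)"
    using assms
  proof (induction t)
    case (Leaf x)
    then show ?case by (auto simp: var_def lookup_single when_def)
  next
    case (Br a b)
    let ?P = "lie_poly :: 'x tree \<Rightarrow> ('x, 'k) ncpoly"
    let ?i = "length (foliage a)" and ?j = "length (foliage b)"
    have deg: "?P a \<in> Ass_deg X ?i" "?P b \<in> Ass_deg X ?j"
      using Br.prems lie_poly_free_lie_deg by (auto simp: free_lie_deg_def)
    have len: "length w = ?i + ?j" if "lookup (?P (Br a b)) w \<noteq> 0" for w
      using that bracket_Ass_deg[OF deg] by (auto simp: Ass_deg_iff)
    have ab: "key e a @ key e b < key e b @ key e a"
      using key_Br_less[of e X a b] less_append_right[of "key e a" "key e b"] Br.prems by simp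
    have le: "key e s @ key e t \<le> map e w"
      if "lookup (?P s * ?P t) w \<noteq> 0" "hall e X s" "\<forall>w. lookup (?P s) w \<noteq> 0 \<longrightarrow> key e s \<le> map e w"
        "\<forall>w. lookup (?P t) w \<noteq> 0 \<longrightarrow> key e t \<le> map e w" for s t w
    proof -
      let ?n = "length (foliage s)"
      have "?P s \<in> Ass_deg X ?n" using lie_poly_free_lie_deg that(2) by (auto simp: free_lie_deg_def)
      note lookup_times_Ass_deg[OF this, of "?P t" w]
      then have "?n \<le> length w" "key e s \<le> map e (take ?n w)" "key e t \<le> map e (drop ?n w)"
        using that by (auto split: if_splits)
      then have "key e s @ key e t \<le> map e (take ?n w) @ map e (drop ?n w)"
        by (intro append_le_mono) auto
      then show ?thesis by (simp flip: map_append)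
    qed
    have IH: "hall e X a" "hall e X b" "lookup (?P a) (foliage a) = 1" "lookup (?P b) (foliage b) = 1"
      "\<forall>w. lookup (?P a) w \<noteq> 0 \<longrightarrow> key e a \<le> map e w" "\<forall>w. lookup (?P b) w \<noteq> 0 \<longrightarrow> key e b \<le> map e w"
      using Br by auto
    have "lookup (?P b * ?P a) (foliage (Br a b)) = 0"
      using le[of b a "foliage (Br a b)"] IH ab by (force simp: key_def)
    moreover have "lookup (?P a * ?P b) (foliage (Br a b)) = 1"
      using IH by (simp add: lookup_times_Ass_deg[OF deg(1)])
    moreover have "key e (Br a b) \<le> map e w" if "lookup (?P (Br a b)) w \<noteq> 0" for w
    proof -
      have "lookup (?P a * ?P b) w \<noteq> 0 \<or> lookup (?P b * ?P a) w \<noteq> 0"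
        using that by (auto simp: bracket_def lookup_minus)
      then show ?thesis using le[of a b w] le[of b a w] IH ab by force
    qed
    ultimately show ?case by (simp add: bracket_def lookup_minus)
  qed
  then show "lookup (lie_poly t :: ('x, 'k) ncpoly) (foliage t) = 1"
    "lookup (lie_poly t :: ('x, 'k) ncpoly) w \<noteq> 0 \<Longrightarrow> key e t \<le> map e w"
    by blast+
qed

text \<open>A relation is evaluated at the word of the smallest tree with nonzero coefficient. Other
  trees in the relation have only larger words, so this one coefficient remains and must
  vanish.\<close>

lemma lie_poly_independent:
  assumes "finite H" "\<And>h. h \<in> H \<Longrightarrow> hall e X h" "inj_on e X"
  shows "inj_on (lie_poly :: 'x tree \<Rightarrow> ('x, 'k::field) ncpoly) H"
    and "pm.independent ((lie_poly :: 'x tree \<Rightarrow> ('x, 'k) ncpoly) ` H)"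
proof -
  let ?P = "lie_poly :: 'x tree \<Rightarrow> ('x, 'k) ncpoly"
  show inj: "inj_on ?P H"
  proof (rule inj_onI)
    fix s t assume st: "s \<in> H" "t \<in> H" "?P s = ?P t"
    have "key e s \<le> key e t" "key e t \<le> key e s"
      using lie_poly_triangular[of e X, where 'k = 'k] st assms(2)
      unfolding key_def by (metis zero_neq_one)+
    then show "s = t" using key_inj[OF assms(3)] assms(2) st by force
  qed
  show "pm.independent (?P ` H)"
  proof (rule pm.independent_if_scalars_zero)
    show "finite (?P ` H)" using assms by simp
    fix c x assume sum: "(\<Sum>x\<in>?P ` H. scale_pm (c x) x) = 0" and x: "x \<in> ?P ` H"
    show "c x = 0"
    proof (rule ccontr)
      define N where "N = {h \<in> H. c (?P h) \<noteq> 0}"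
      assume "c x \<noteq> 0"
      then have N: "finite (key e ` N)" "key e ` N \<noteq> {}" using x assms(1) by (auto simp: N_def)
      from Min_in[OF N] obtain h where h: "h \<in> N" "key e h = Min (key e ` N)" by auto
      have "0 = (\<Sum>s\<in>H. c (?P s) * lookup (?P s) (foliage h))"
        using arg_cong[OF sum, of "\<lambda>p. lookup p (foliage h)"] by (simp add: sum.reindex[OF inj] lookup_sum)
      also have "\<dots> = (\<Sum>s\<in>{h}. c (?P s) * lookup (?P s) (foliage h))"
      proof (rule sum.mono_neutral_right)
        show "\<forall>s\<in>H - {h}. c (?P s) * lookup (?P s) (foliage h) = 0"
        proof (rule ballI, rule ccontr)
          fix s assume s: "s \<in> H - {h}" "c (?P s) * lookup (?P s) (foliage h) \<noteq> 0"
          then have "key e s \<le> key e h"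
            using lie_poly_triangular(2)[of e X s "foliage h"] assms(2) by (auto simp: key_def)
          moreover have "key e h \<le> key e s" using s h N by (auto simp: N_def)
          ultimately have "key e s = key e h" by (rule antisym)
          then show False using key_inj[OF assms(3), of s h] s h(1) assms(2) by (auto simp: N_def)
        qed
      qed (use h assms in \<open>auto simp: N_def\<close>)
      also have "\<dots> = c (?P h)" using lie_poly_triangular(1)[of e X h] h assms(2) by (simp add: N_def)
      finally show False using h by (simp add: N_def)
    qed
  qed
qed

subsection \<open>The standard inner product on the Lie polynomials\<close>

definition dot :: "'x set \<Rightarrow> nat \<Rightarrow> ('x, 'k::field) ncpoly \<Rightarrow> ('x, 'k) ncpoly \<Rightarrow> 'k"
  where "dot X k p q = (\<Sum>w | w \<in> lists X \<and> length w = k. lookup p w * lookup q w)"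

lemma dot_linear [simp]:
  "dot X k 0 q = 0" "dot X k p 0 = 0"
  "dot X k (p + p') q = dot X k p q + dot X k p' q"
  "dot X k p (q + q') = dot X k p q + dot X k p q'"
  "dot X k (p - p') q = dot X k p q - dot X k p' q"
  "dot X k p (q - q') = dot X k p q - dot X k p q'"
  "dot X k (scale_pm c p) q = c * dot X k p q"
  "dot X k p (scale_pm c q) = c * dot X k p q"
  by (simp_all add: dot_def lookup_add lookup_minus sum.distrib sum_subtractf sum_distrib_left algebra_simps)

lemma dot_sum: "dot X k (sum f A) q = (\<Sum>a\<in>A. dot X k (f a) q)"
  by (induction A rule: infinite_finite_induct) auto

lemma dot_commute: "dot X k p q = dot X k q p"
  by (simp add: dot_def mult.commute)

lemma dot_span_zero:
  assumes "\<And>q. q \<in> S \<Longrightarrow> dot X k p q = 0" "q \<in> span_pm S"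
  shows "dot X k p q = 0"
  using assms(2) by (rule pm.span_induct) (auto simp: pm.subspace_def assms(1))

lemma finite_words: "finite X \<Longrightarrow> finite {w. w \<in> lists X \<and> length w = k}"
  by (rule finite_subset[OF _ finite_lists_length_eq[of X k]]) auto

text \<open>The rationals embed into a field of characteristic zero, and a sum of rational squares
  vanishes only if each square does.\<close>

lemma dot_self_rational:
  fixes p :: "('x, 'k::field_char_0) ncpoly"
  assumes "finite X" "p \<in> Ass_deg X k" "\<And>w. lookup p w \<in> \<rat>" "dot X k p p = 0"
  shows "p = 0"
proof -
  have "\<exists>q. lookup p w = of_rat q" for w using assms(3)[of w] by (auto elim: Rats_cases)
  then obtain r where r: "\<And>w. lookup p w = of_rat (r w)" by metis
  let ?W = "{w. w \<in> lists X \<and> length w = k}"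
  have "of_rat (\<Sum>w\<in>?W. r w * r w) = (0 :: 'k)"
    using assms(4) by (simp add: dot_def r of_rat_mult of_rat_sum)
  then have "(\<Sum>w\<in>?W. r w * r w) = 0" by simp
  then have "\<forall>w\<in>?W. r w * r w = 0"
    using sum_nonneg_eq_0_iff[of ?W "\<lambda>w. r w * r w"] finite_words[OF assms(1)]
    by (simp del: mult_eq_0_iff)
  then have "r w = 0" if "w \<in> ?W" for w using that by simp
  then have "lookup p w = 0" if "w \<in> ?W" for w using r[of w] that by simp
  then have "lookup p w = 0" for w using Ass_degD[OF assms(2), of w] by blast
  then show ?thesis by (intro poly_mapping_eqI) simp
qed

text \<open>The vectors are not normalised, so no square roots leave the rationals, and the
  divisions are legitimate because nonzero rational vectors are anisotropic. A vector that projects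
  to v' = 0 depends on the others and is dropped.\<close>

lemma Gram_Schmidt_rational:
  fixes B :: "('x, 'k::field_char_0) ncpoly set"
  assumes "finite X" "finite B" "B \<subseteq> Ass_deg X k" "\<And>p w. p \<in> B \<Longrightarrow> lookup p w \<in> \<rat>"
  shows "\<exists>E. finite E \<and> E \<subseteq> Ass_deg X k \<and> (\<forall>p\<in>E. \<forall>w. lookup p w \<in> \<rat>) \<and> span_pm E = span_pm B \<and>
    (\<forall>p\<in>E. \<forall>q\<in>E. p \<noteq> q \<longrightarrow> dot X k p q = 0) \<and> (\<forall>p\<in>E. dot X k p p \<noteq> 0)"
  using assms(2-)
proof (induction B rule: finite_induct)
  case empty
  then show ?case by (intro exI[of _ "{}"]) auto
next
  case (insert v B)
  have "B \<subseteq> Ass_deg X k" "\<And>p w. p \<in> B \<Longrightarrow> lookup p w \<in> \<rat>" using insert.prems by blast+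
  from insert.IH[OF this] obtain E where E: "finite E" "E \<subseteq> Ass_deg X k" "\<forall>p\<in>E. \<forall>w. lookup p w \<in> \<rat>"
      "span_pm E = span_pm B" "\<forall>p\<in>E. \<forall>q\<in>E. p \<noteq> q \<longrightarrow> dot X k p q = 0" "\<forall>p\<in>E. dot X k p p \<noteq> 0"
    by blast
  note E_rat = E(3)[rule_format]
  define u where "u = (\<Sum>e\<in>E. scale_pm (dot X k v e / dot X k e e) e)"
  define v' where "v' = v - u"
  have u: "u \<in> span_pm E" unfolding u_def by (intro pm.span_sum pm.span_scale pm.span_base)
  have dot_rat: "dot X k p q \<in> \<rat>" if "\<And>w. lookup p w \<in> \<rat>" "\<And>w. lookup q w \<in> \<rat>"
    for p q :: "('x, 'k) ncpoly" unfolding dot_def using that by (auto intro!: Rats_sum Rats_mult)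
  have v'_rat: "lookup v' w \<in> \<rat>" for w
    unfolding v'_def u_def lookup_minus lookup_sum lookup_scale_pm
    by (intro Rats_diff Rats_sum Rats_mult Rats_divide dot_rat E_rat insert.prems(2) insertI1)
  have u_deg: "u \<in> Ass_deg X k" using u pm.span_minimal[OF E(2) Ass_deg_subspace] by blast
  have v'_deg: "v' \<in> Ass_deg X k"
    unfolding v'_def using insert.prems(1) u_deg by (intro pm.subspace_diff[OF Ass_deg_subspace]) auto
  have orth: "dot X k v' e = 0" if "e \<in> E" for e
  proof -
    have "dot X k u e = (\<Sum>f\<in>E. if f = e then dot X k v e else 0)"
      unfolding u_def dot_sum using E(5,6) that by (intro sum.cong) auto
    then show ?thesis using E(1) that by (simp add: v'_def)
  qed
  have span: "span_pm (insert v' E) = span_pm (insert v B)"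
  proof -
    have "span_pm (insert v' E) = span_pm (insert v E)"
    proof -
      have E_sub: "span_pm E \<subseteq> span_pm (insert x E)" for x by (rule pm.span_mono) blast
      have "v \<in> span_pm (insert v E)" "v' \<in> span_pm (insert v' E)" by (simp_all add: pm.span_base)
      then have "v - u \<in> span_pm (insert v E)" "v' + u \<in> span_pm (insert v' E)"
        using u E_sub by (blast intro: pm.span_diff pm.span_add)+
      then have "insert v' E \<subseteq> span_pm (insert v E)" "insert v E \<subseteq> span_pm (insert v' E)"
        using E_sub pm.span_superset[of E] by (auto simp: v'_def)
      then show ?thesis by (simp only: pm.span_eq)
    qed
    then show ?thesis using E(4) by (simp add: pm.span_insert)
  qed
  show ?case
  proof (cases "v' = 0")
    case True
    then have "span_pm E = span_pm (insert v B)" using span by (simp add: pm.span_insert_0)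
    then show ?thesis using E by (intro exI[of _ E]) auto
  next
    case False
    then have "dot X k v' v' \<noteq> 0" using dot_self_rational[OF assms(1) v'_deg v'_rat] by blast
    moreover have "dot X k e v' = 0" if "e \<in> E" for e using orth[OF that] by (simp add: dot_commute)
    ultimately show ?thesis
      using E(1-3,5,6) span v'_deg v'_rat orth by (intro exI[of _ "insert v' E"] conjI ballI allI impI) auto
  qed
qed

text \<open>Only the basis is rational; p may have any coefficients with respect to it.
  Orthogonality isolates each coefficient, multiplied by a nonzero self-product.\<close>

lemma dot_nondegenerate_rational:
  fixes B :: "('x, 'k::field_char_0) ncpoly set"
  assumes "finite X" "finite B" "B \<subseteq> Ass_deg X k" "\<And>p w. p \<in> B \<Longrightarrow> lookup p w \<in> \<rat>"
    and p: "p \<in> span_pm B" "\<And>q. q \<in> B \<Longrightarrow> dot X k p q = 0"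
  shows "p = 0"
proof -
  obtain E where E: "finite E" "span_pm E = span_pm B"
      "\<forall>p\<in>E. \<forall>q\<in>E. p \<noteq> q \<longrightarrow> dot X k p q = 0" "\<forall>p\<in>E. dot X k p p \<noteq> 0"
    using Gram_Schmidt_rational[OF assms(1-4)] by blast
  obtain c where c: "p = (\<Sum>e\<in>E. scale_pm (c e) e)"
    using p(1) unfolding E(2)[symmetric] pm.span_finite[OF E(1)] by blast
  have "c e = 0" if e: "e \<in> E" for e
  proof -
    have "e \<in> span_pm B" using E(2) e pm.span_base by blast
    then have "0 = dot X k p e" using dot_span_zero p(2) by metis
    also have "\<dots> = (\<Sum>f\<in>E. if f = e then c e * dot X k e e else 0)"
      unfolding c dot_sum using E(3) e by (intro sum.cong) auto
    also have "\<dots> = c e * dot X k e e" using E(1) e by simp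
    finally show ?thesis using E(4) e by simp
  qed
  then show ?thesis unfolding c by (simp add: sum.neutral)
qed

lemma times_Rats:
  fixes p q :: "('x, 'k::field_char_0) ncpoly"
  assumes "\<And>w. lookup p w \<in> \<rat>" "\<And>w. lookup q w \<in> \<rat>"
  shows "lookup (p * q) w \<in> \<rat>"
  unfolding lookup_times_word using assms by (auto intro!: Rats_sum Rats_mult)

lemma left_normed_Rats:
  fixes p :: "('x, 'k::field_char_0) ncpoly"
  assumes "\<And>w. lookup p w \<in> \<rat>"
  shows "lookup (left_normed p zs) w \<in> \<rat>"
  using assms
proof (induction zs arbitrary: p)
  case (Cons z zs)
  have "lookup (var z :: ('x, 'k) ncpoly) w \<in> \<rat>" for w by (simp add: var_def lookup_single when_def)
  then have "lookup (bracket p (var z)) w \<in> \<rat>" for w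
    using Cons.prems unfolding bracket_def lookup_minus by (intro Rats_diff times_Rats)
  then show ?case using Cons.IH by simp
qed simp

lemma dot_nondegenerate_lie:
  fixes p :: "('x, 'k::field_char_0) ncpoly"
  assumes "finite X" "p \<in> span_pm (left_normed_brackets X k)"
    "\<And>q. q \<in> left_normed_brackets X k \<Longrightarrow> dot X k p q = 0"
  shows "p = 0"
proof (rule dot_nondegenerate_rational[OF assms(1) _ _ _ assms(2,3)])
  fix q :: "('x, 'k) ncpoly" and w assume "q \<in> left_normed_brackets X k"
  moreover have "lookup (var z :: ('x, 'k) ncpoly) w \<in> \<rat>" for z w
    by (simp add: var_def lookup_single when_def)
  ultimately show "lookup q w \<in> \<rat>" by (auto simp: left_normed_brackets_def left_normed_Rats)
qed (use finite_left_normed_brackets[OF assms(1)] left_normed_brackets_Ass_deg in auto)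

section \<open>The leading term of the period series\<close>

lemma prod_list_var: "prod_list (map var w) = Poly_Mapping.single w (1 :: 'k::field)"
proof (induction w)
  case Nil
  show ?case using single_one[where 'a = "'a list", unfolded zero_list_def] by simp
next
  case (Cons x w)
  then show ?case by (simp add: var_def mult_single plus_list_def)
qed

lemma take_lists: "w \<in> lists A \<Longrightarrow> take i w \<in> lists A"
  and drop_lists: "w \<in> lists A \<Longrightarrow> drop i w \<in> lists A"
  using set_take_subset[of i w] set_drop_subset[of i w] by (auto simp: in_lists_conv_set)

locale finite_iterated_integral = iterated_integral \<iota> X I
  for \<iota> :: "'k::field_char_0 \<Rightarrow> 'K::field_char_0" and X :: "'x set"
    and I :: "'x letter list \<Rightarrow> ('x, 'k) ncpoly \<Rightarrow> 'K" +
  assumes finite_X: "finite X"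
begin

sublocale F: group "free_group X"
  by (rule group_free_group)

abbreviation FX where "FX \<equiv> free_group X"
abbreviation \<Gamma> where "\<Gamma> \<equiv> lower_central FX"

lemma emb_zero [simp]: "\<iota> 0 = 0"
  using emb_add[of 0 0] by simp

definition coef :: "'x letter list \<Rightarrow> 'x list \<Rightarrow> 'K"
  where "coef \<alpha> w = I \<alpha> (Poly_Mapping.single w 1)"

lemma single_Ass: "w \<in> lists X \<Longrightarrow> Poly_Mapping.single w c \<in> Ass X"
  by (auto simp: Ass_def)

lemma set_var_Ass_deg: "w \<in> lists X \<Longrightarrow> set (map var w) \<subseteq> Ass_deg X 1"
  by (auto simp: in_lists_conv_set intro!: var_Ass_deg[simplified])

lemma coef_mult:
  assumes "\<alpha> \<in> carrier FX" "\<beta> \<in> carrier FX" "w \<in> lists X"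
  shows "coef (\<alpha> \<otimes>\<^bsub>FX\<^esub> \<beta>) w = (\<Sum>i\<le>length w. coef \<alpha> (take i w) * coef \<beta> (drop i w))"
  using path_mult[OF assms(1,2) set_var_Ass_deg[OF assms(3)]]
  by (simp add: take_map drop_map prod_list_var coef_def)

lemma coef_inv:
  assumes "\<alpha> \<in> carrier FX" "w \<in> lists X"
  shows "coef (inv\<^bsub>FX\<^esub> \<alpha>) w = (- 1) ^ length w * coef \<alpha> (rev w)"
  using path_inv[OF assms(1) set_var_Ass_deg[OF assms(2)]]
  by (simp add: rev_map prod_list_var coef_def)

lemma coef_one: "w \<in> lists X \<Longrightarrow> coef \<one>\<^bsub>FX\<^esub> w = (if w = [] then 1 else 0)"
  using const_path[OF single_Ass, of w 1] by (simp add: coef_def lookup_single when_def emb_one)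

lemma coef_Nil: "\<alpha> \<in> carrier FX \<Longrightarrow> coef \<alpha> [] = 1"
  using one_form[of \<alpha>] by (simp add: coef_def flip: zero_list_def)

text \<open>The paths whose series is 1 plus terms of degree at least k.\<close>

definition deep :: "nat \<Rightarrow> 'x letter list set"
  where "deep k = {\<alpha> \<in> carrier FX. \<forall>w\<in>lists X. 0 < length w \<longrightarrow> length w < k \<longrightarrow> coef \<alpha> w = 0}"

lemma deepD: "\<alpha> \<in> deep k \<Longrightarrow> w \<in> lists X \<Longrightarrow> 0 < length w \<Longrightarrow> length w < k \<Longrightarrow> coef \<alpha> w = 0"
  by (simp add: deep_def)

lemma sum_atMost_ends:
  fixes f :: "nat \<Rightarrow> 'K"
  assumes "0 < n"
  shows "(\<Sum>i\<le>n. f i) = f 0 + f n + (\<Sum>i\<in>{1..<n}. f i)"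
proof -
  have "{..n} = insert 0 (insert n {1..<n})" using assms by auto
  then show ?thesis using assms by simp
qed

text \<open>In (1 + a)(1 + b) = 1 + a + b + ab the product ab starts in degree i + j. The terms a
  and b are the two end cuts in (A2); of the inner cuts only the one at i survives, and only for
  length i + j.\<close>

lemma coef_mult_deep:
  assumes a: "\<alpha> \<in> deep i" and b: "\<beta> \<in> deep j" and ij: "1 \<le> i" "1 \<le> j"
    and w: "w \<in> lists X" "0 < length w" "length w \<le> i + j"
  shows "coef (\<alpha> \<otimes>\<^bsub>FX\<^esub> \<beta>) w = coef \<alpha> w + coef \<beta> w +
    (if length w = i + j then coef \<alpha> (take i w) * coef \<beta> (drop i w) else 0)"
proof -
  let ?n = "length w" and ?f = "\<lambda>p. coef \<alpha> (take p w) * coef \<beta> (drop p w)"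
  have c: "\<alpha> \<in> carrier FX" "\<beta> \<in> carrier FX" using a b by (auto simp: deep_def)
  have "?f p = (if ?n = i + j \<and> p = i then ?f i else 0)" if p: "p \<in> {1..<?n}" for p
  proof (cases "p < i \<or> ?n - p < j")
    case True
    have "coef \<alpha> (take p w) = 0" if "p < i"
      by (rule deepD[OF a]) (use w p that in \<open>simp_all add: take_lists del: in_lists_conv_set\<close>)
    moreover have "coef \<beta> (drop p w) = 0" if "?n - p < j"
      by (rule deepD[OF b]) (use w p that in \<open>simp_all add: drop_lists del: in_lists_conv_set\<close>)
    ultimately have "?f p = 0" using True by auto
    moreover have "\<not> (?n = i + j \<and> p = i)" using True by auto
    ultimately show ?thesis by simp
  next
    case False
    then have "?n = i + j" "p = i" using w p by auto
    then show ?thesis by simp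
  qed
  then have "(\<Sum>p\<in>{1..<?n}. ?f p) = (\<Sum>p\<in>{1..<?n}. if ?n = i + j \<and> p = i then ?f i else 0)"
    by (rule sum.cong[OF refl])
  also have "\<dots> = (if ?n = i + j then ?f i else 0)" using ij by (cases "?n = i + j") simp_all
  finally show ?thesis
    using coef_mult[OF c w(1)] sum_atMost_ends[OF w(2), of ?f] c by (simp add: coef_Nil)
qed

text \<open>Compare coefficients in \<open>comm \<alpha> \<beta>\<close> times \<beta>\<alpha> =
  \<alpha>\<beta>, which avoids inverting series. By induction on the length, proper nonempty
  prefixes of w have coefficient 0 in the commutator, so it contributes additively; subtracting the
  two products leaves the bracket.\<close>

lemma coef_comm:
  assumes a: "\<alpha> \<in> deep i" and b: "\<beta> \<in> deep j" and ij: "1 \<le> i" "1 \<le> j"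
    and w: "w \<in> lists X" "0 < length w" "length w \<le> i + j"
  shows "coef (F.comm \<alpha> \<beta>) w = (if length w = i + j then
    coef \<alpha> (take i w) * coef \<beta> (drop i w) - coef \<beta> (take j w) * coef \<alpha> (drop j w) else 0)"
  using w
proof (induction "length w" arbitrary: w rule: less_induct)
  case less
  let ?\<gamma> = "F.comm \<alpha> \<beta>" and ?ba = "\<beta> \<otimes>\<^bsub>FX\<^esub> \<alpha>" and ?n = "length w"
  have c: "\<alpha> \<in> carrier FX" "\<beta> \<in> carrier FX" using a b by (auto simp: deep_def)
  have "?\<gamma> \<otimes>\<^bsub>FX\<^esub> ?ba = \<alpha> \<otimes>\<^bsub>FX\<^esub> \<beta>" using c by (simp add: F.group_word_simps)
  moreover have "?\<gamma> \<in> carrier FX" "?ba \<in> carrier FX" using c by simp_all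
  note coef_mult[OF this less.prems(1)]
  moreover have "coef ?\<gamma> (take p w) = 0" if "p \<in> {1..<?n}" for p
    using less.hyps[of "take p w"] that less.prems by (simp add: take_lists del: in_lists_conv_set)
  ultimately have "coef (\<alpha> \<otimes>\<^bsub>FX\<^esub> \<beta>) w = coef ?ba w + coef ?\<gamma> w"
    using sum_atMost_ends[OF less.prems(2), of "\<lambda>p. coef ?\<gamma> (take p w) * coef ?ba (drop p w)"] c
    by (simp add: coef_Nil)
  then show ?case
    using coef_mult_deep[OF a b ij less.prems] coef_mult_deep[OF b a ij(2,1), of w] less.prems
    by (cases "length w = i + j") (simp_all add: algebra_simps)
qed

lemma deep_subgroup: "k \<ge> 1 \<Longrightarrow> subgroup (deep k) FX"
proof
  show "deep k \<subseteq> carrier FX" by (auto simp: deep_def)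
  show "\<one>\<^bsub>FX\<^esub> \<in> deep k" by (auto simp: deep_def coef_one)
next
  fix \<alpha> \<beta> assume k: "k \<ge> 1" and a: "\<alpha> \<in> deep k" and b: "\<beta> \<in> deep k"
  have "coef (\<alpha> \<otimes>\<^bsub>FX\<^esub> \<beta>) w = 0" if "w \<in> lists X" "0 < length w" "length w < k" for w
    using coef_mult_deep[OF a b k k that(1,2)] that deepD[OF a that] deepD[OF b that] by simp
  then show "\<alpha> \<otimes>\<^bsub>FX\<^esub> \<beta> \<in> deep k" using a b by (simp add: deep_def del: in_lists_conv_set)
next
  fix \<alpha> assume a: "\<alpha> \<in> deep k"
  have "coef (inv\<^bsub>FX\<^esub> \<alpha>) w = 0" if "w \<in> lists X" "0 < length w" "length w < k" for w
  proof -
    have "rev w \<in> lists X" using that(1) by (simp add: in_lists_conv_set)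
    then have "coef \<alpha> (rev w) = 0" using deepD[OF a, of "rev w"] that by simp
    moreover have "\<alpha> \<in> carrier FX" using a by (simp add: deep_def)
    ultimately show ?thesis using coef_inv that(1) by simp
  qed
  then show "inv\<^bsub>FX\<^esub> \<alpha> \<in> deep k" using a by (simp add: deep_def del: in_lists_conv_set)
qed

lemma lower_central_deep: "k \<ge> 1 \<Longrightarrow> \<Gamma> k \<subseteq> deep k"
proof (induction k rule: dec_induct)
  case base
  then show ?case by (auto simp: deep_def)
next
  case (step k)
  show ?case unfolding F.lower_central_Suc[OF step.hyps(1)]
  proof (rule F.generate_subset_subgroup)
    show "subgroup (deep (Suc k)) FX" by (rule deep_subgroup) simp
    show "{F.comm a b | a b. a \<in> carrier FX \<and> b \<in> \<Gamma> k} \<subseteq> deep (Suc k)"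
    proof clarify
      fix a b assume ab: "a \<in> carrier FX" "b \<in> \<Gamma> k"
      then have "a \<in> deep 1" "b \<in> deep k" using step.IH by (auto simp: deep_def)
      then have "coef (F.comm a b) w = 0" if "w \<in> lists X" "0 < length w" "length w < Suc k" for w
        using coef_comm[of a 1 b k w] step.hyps that by simp
      moreover have "b \<in> carrier FX" using \<open>b \<in> deep k\<close> by (simp add: deep_def)
      ultimately show "F.comm a b \<in> deep (Suc k)" using ab by (simp add: deep_def del: in_lists_conv_set)
    qed
  qed
qed

definition lead :: "nat \<Rightarrow> 'x letter list \<Rightarrow> ('x, 'K) ncpoly"
  where "lead k \<alpha> = (\<Sum>w | w \<in> lists X \<and> length w = k. Poly_Mapping.single w (coef \<alpha> w))"

lemma lookup_lead: "lookup (lead k \<alpha>) w = (if w \<in> lists X \<and> length w = k then coef \<alpha> w else 0)"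
proof -
  let ?W = "{w. w \<in> lists X \<and> length w = k}"
  have "lookup (lead k \<alpha>) w = (\<Sum>v\<in>?W. if v = w then coef \<alpha> w else 0)"
    unfolding lead_def lookup_sum by (intro sum.cong) (auto simp: lookup_single when_def)
  also have "\<dots> = (if w \<in> ?W then coef \<alpha> w else 0)"
    using finite_words[OF finite_X, of k] by (simp del: in_lists_conv_set)
  finally show ?thesis by simp
qed

lemma lead_Ass_deg: "lead k \<alpha> \<in> Ass_deg X k"
  by (rule Ass_degI) (auto simp: lookup_lead simp del: in_lists_conv_set)

lemma lead_mult:
  assumes "k \<ge> 1" "\<alpha> \<in> \<Gamma> k" "\<beta> \<in> \<Gamma> k"
  shows "lead k (\<alpha> \<otimes>\<^bsub>FX\<^esub> \<beta>) = lead k \<alpha> + lead k \<beta>"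
proof (rule poly_mapping_eqI)
  have d: "\<alpha> \<in> deep k" "\<beta> \<in> deep k" using assms lower_central_deep by blast+
  fix w
  show "lookup (lead k (\<alpha> \<otimes>\<^bsub>FX\<^esub> \<beta>)) w = lookup (lead k \<alpha> + lead k \<beta>) w"
  proof (cases "w \<in> lists X \<and> length w = k")
    case True
    then have "0 < length w" using assms(1) by linarith
    then show ?thesis
      using coef_mult_deep[OF d assms(1,1), of w] True by (simp add: lookup_lead lookup_add)
  qed (auto simp: lookup_lead lookup_add)
qed

lemma lead_one: "k \<ge> 1 \<Longrightarrow> lead k \<one>\<^bsub>FX\<^esub> = 0"
  by (rule poly_mapping_eqI) (auto simp: lookup_lead coef_one simp del: in_lists_conv_set)

lemma lead_inv:
  assumes "k \<ge> 1" "\<alpha> \<in> \<Gamma> k"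
  shows "lead k (inv\<^bsub>FX\<^esub> \<alpha>) = - lead k \<alpha>"
proof -
  have "\<alpha> \<in> carrier FX" "inv\<^bsub>FX\<^esub> \<alpha> \<in> \<Gamma> k"
    using assms F.lower_central_carrier F.normal_mem(3)[OF F.lower_central_normal] by auto
  then show ?thesis
    using lead_mult[OF assms, of "inv\<^bsub>FX\<^esub> \<alpha>"] lead_one[OF assms(1)]
    by (simp add: eq_neg_iff_add_eq_0 add.commute)
qed

lemma lead_Suc_zero:
  assumes "k \<ge> 1" "\<alpha> \<in> \<Gamma> (Suc k)"
  shows "lead k \<alpha> = 0"
proof (rule poly_mapping_eqI)
  fix w
  have "\<alpha> \<in> deep (Suc k)" using lower_central_deep[of "Suc k"] assms by auto
  then show "lookup (lead k \<alpha>) w = lookup 0 w"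
    using deepD[of \<alpha> "Suc k" w] assms(1) by (cases "w \<in> lists X \<and> length w = k") (auto simp: lookup_lead)
qed

lemma lead_comm:
  assumes "\<alpha> \<in> \<Gamma> i" "\<beta> \<in> \<Gamma> j" "i \<ge> 1" "j \<ge> 1"
  shows "lead (i + j) (F.comm \<alpha> \<beta>) = bracket (lead i \<alpha>) (lead j \<beta>)"
proof (rule poly_mapping_eqI)
  have d: "\<alpha> \<in> deep i" "\<beta> \<in> deep j" using assms lower_central_deep by blast+
  fix w
  show "lookup (lead (i + j) (F.comm \<alpha> \<beta>)) w = lookup (bracket (lead i \<alpha>) (lead j \<beta>)) w"
  proof (cases "w \<in> lists X \<and> length w = i + j")
    case True
    then show ?thesis
      using coef_comm[OF d assms(3,4), of w] assms
      by (simp add: bracket_def lookup_minus lookup_times_Ass_deg[OF lead_Ass_deg] lookup_lead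
          take_lists drop_lists del: in_lists_conv_set)
  next
    case False
    then show ?thesis
      using Ass_degD[OF bracket_Ass_deg[OF lead_Ass_deg lead_Ass_deg], of w i j \<alpha> \<beta>]
      by (auto simp: lookup_lead simp del: in_lists_conv_set)
  qed
qed

lemma lead_1_span: "lead 1 \<alpha> \<in> span_pm (var ` X)"
proof -
  have "lead 1 \<alpha> = (\<Sum>w | w \<in> lists X \<and> length w = 1. scale_pm (coef \<alpha> w) (Poly_Mapping.single w 1))"
    unfolding lead_def by (intro sum.cong refl poly_mapping_eqI) (simp add: lookup_single when_def)
  also have "\<dots> \<in> span_pm (var ` X)"
  proof (intro pm.span_sum pm.span_scale pm.span_base)
    fix w assume "w \<in> {w \<in> lists X. length w = 1}"
    then obtain x where "w = [x]" "x \<in> X" by (auto simp: length_Suc_conv)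
    then show "Poly_Mapping.single w 1 \<in> var ` X" by (auto simp: var_def)
  qed
  finally show ?thesis .
qed

lemma subgroup_additive_span:
  assumes "subgroup K FX" "\<And>\<alpha> \<beta>. \<lbrakk>\<alpha> \<in> K; \<beta> \<in> K\<rbrakk> \<Longrightarrow> f (\<alpha> \<otimes>\<^bsub>FX\<^esub> \<beta>) = f \<alpha> + (f \<beta> :: 'a \<Rightarrow>\<^sub>0 'K)"
    "\<And>\<alpha>. \<alpha> \<in> K \<Longrightarrow> f (inv\<^bsub>FX\<^esub> \<alpha>) = - f \<alpha>" "f \<one>\<^bsub>FX\<^esub> = 0"
  shows "subgroup {\<alpha> \<in> K. f \<alpha> \<in> span_pm S} FX"
proof
  show "{\<alpha> \<in> K. f \<alpha> \<in> span_pm S} \<subseteq> carrier FX" using subgroup.subset[OF assms(1)] by blast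
qed (use assms in \<open>auto simp: subgroup.m_closed subgroup.m_inv_closed subgroup.one_closed
    pm.span_add pm.span_neg pm.span_zero\<close>)

lemma lead_span_subgroup: "k \<ge> 1 \<Longrightarrow> subgroup {\<alpha> \<in> \<Gamma> k. lead k \<alpha> \<in> span_pm S} FX"
  using F.lower_central_subgroup lead_mult lead_inv lead_one by (intro subgroup_additive_span)

text \<open>Commutators generate \<gamma> (k + 1), and their leading terms are brackets of a linear
  form with a leading term of degree k; additivity extends this to the whole subgroup.\<close>

lemma lead_span:
  assumes "k \<ge> 1" "\<alpha> \<in> \<Gamma> k"
  shows "lead k \<alpha> \<in> span_pm (left_normed_brackets X k)"
  using assms
proof (induction k arbitrary: \<alpha> rule: dec_induct)
  case base
  then show ?case using lead_1_span left_normed_brackets_1 by metis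
next
  case (step k)
  let ?S = "left_normed_brackets X (Suc k)"
  have "\<Gamma> (Suc k) \<subseteq> {\<alpha> \<in> \<Gamma> (Suc k). lead (Suc k) \<alpha> \<in> span_pm ?S}"
    unfolding F.lower_central_Suc[OF step.hyps(1)]
  proof (rule F.generate_subset_subgroup, unfold F.lower_central_Suc[OF step.hyps(1), symmetric])
    show "subgroup {\<alpha> \<in> \<Gamma> (Suc k). lead (Suc k) \<alpha> \<in> span_pm ?S} FX"
      by (rule lead_span_subgroup) simp
    show "{F.comm a b | a b. a \<in> carrier FX \<and> b \<in> \<Gamma> k} \<subseteq> {\<alpha> \<in> \<Gamma> (Suc k). lead (Suc k) \<alpha> \<in> span_pm ?S}"
    proof clarify
      fix a b assume ab: "a \<in> carrier FX" "b \<in> \<Gamma> k"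
      have "lead (Suc k) (F.comm a b) = bracket (lead 1 a) (lead k b)"
        using lead_comm[of a 1 b k] ab step.hyps by simp
      also have "\<dots> \<in> span_pm ?S"
      proof (rule bracket_span[OF lead_1_span step.IH[OF ab(2)]])
        fix s t :: "('x, 'K) ncpoly" assume "s \<in> var ` X" "t \<in> left_normed_brackets X k"
        then have "bracket t s \<in> ?S" using left_normed_brackets_Suc[OF step.hyps(1), of X] by blast
        moreover have "bracket s t = - bracket t s" by (simp add: bracket_def)
        ultimately show "bracket s t \<in> span_pm ?S" by (simp add: pm.span_base pm.span_neg)
      qed
      finally show "F.comm a b \<in> \<Gamma> (Suc k) \<and> lead (Suc k) (F.comm a b) \<in> span_pm ?S"
        using F.comm_lower_central_Suc[OF ab step.hyps(1)] by simp
    qed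
  qed
  then show ?case using step.prems by blast
qed

section \<open>Integrals as inner products, and the induced map on classes\<close>

definition emb :: "('x, 'k) ncpoly \<Rightarrow> ('x, 'K) ncpoly"
  where "emb p = Poly_Mapping.map \<iota> p"

lemma lookup_emb [simp]: "lookup (emb p) w = \<iota> (lookup p w)"
  by (simp add: emb_def map.rep_eq when_def)

text \<open>Additivity of the integral is available between forms in \<open>Ass X\<close>, so
  membership of the partial sums is carried along in the induction.\<close>

lemma integral_sum:
  assumes "\<alpha> \<in> carrier FX" "finite S" "S \<subseteq> lists X"
  shows "I \<alpha> (\<Sum>w\<in>S. scale_pm (c w) (Poly_Mapping.single w 1)) = (\<Sum>w\<in>S. \<iota> (c w) * coef \<alpha> w) \<and>
    (\<Sum>w\<in>S. scale_pm (c w) (Poly_Mapping.single w 1)) \<in> Ass X"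
  using assms(2,3)
proof (induction S rule: finite_induct)
  case empty
  have "0 \<in> Ass X" by (simp add: Ass_def)
  moreover have "I \<alpha> 0 = 0" using add[OF assms(1) \<open>0 \<in> Ass X\<close> \<open>0 \<in> Ass X\<close>] by simp
  ultimately show ?case by simp
next
  case (insert w S)
  let ?p = "scale_pm (c w) (Poly_Mapping.single w (1 :: 'k))"
  let ?q = "\<Sum>w\<in>S. scale_pm (c w) (Poly_Mapping.single w (1 :: 'k))"
  have IH: "I \<alpha> ?q = (\<Sum>w\<in>S. \<iota> (c w) * coef \<alpha> w)" "?q \<in> Ass X" using insert by auto
  have w: "Poly_Mapping.single w (1 :: 'k) \<in> Ass X" using insert.prems single_Ass by blast
  have p: "?p \<in> Ass X" using w by (force simp: Ass_def in_keys_iff subset_iff)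
  have "?p + ?q \<in> Ass X" using p IH(2) Poly_Mapping.keys_add[of ?p ?q] by (auto simp: Ass_def)
  then show ?case
    using add[OF assms(1) p IH(2)] scale[OF assms(1) w, of "c w"] IH insert.hyps by (simp add: coef_def)
qed

lemma integral_eq_dot:
  assumes "\<alpha> \<in> carrier FX" "p \<in> Ass_deg X k"
  shows "I \<alpha> p = dot X k (lead k \<alpha>) (emb p)"
proof -
  let ?W = "{w. w \<in> lists X \<and> length w = k}"
  have "p = (\<Sum>w\<in>?W. scale_pm (lookup p w) (Poly_Mapping.single w 1))"
  proof (rule poly_mapping_eqI)
    fix v
    have "lookup (\<Sum>w\<in>?W. scale_pm (lookup p w) (Poly_Mapping.single w 1)) v =
      (\<Sum>w\<in>?W. if w = v then lookup p v else 0)"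
      unfolding lookup_sum by (intro sum.cong) (auto simp: lookup_single when_def)
    also have "\<dots> = (if v \<in> ?W then lookup p v else 0)"
      using finite_words[OF finite_X, of k] by (simp del: in_lists_conv_set)
    also have "\<dots> = lookup p v" using Ass_degD[OF assms(2), of v] by auto
    finally show "lookup p v = lookup (\<Sum>w\<in>?W. scale_pm (lookup p w) (Poly_Mapping.single w 1)) v" ..
  qed
  then have "I \<alpha> p = (\<Sum>w\<in>?W. \<iota> (lookup p w) * coef \<alpha> w)"
    using integral_sum[OF assms(1) finite_words[OF finite_X, of k], of "lookup p"]
    by (metis (no_types, lifting) mem_Collect_eq subsetI)
  also have "\<dots> = dot X k (lead k \<alpha>) (emb p)"
    unfolding dot_def by (intro sum.cong) (auto simp: lookup_lead mult.commute simp del: in_lists_conv_set)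
  finally show ?thesis .
qed

abbreviation "gr \<equiv> gr_group FX"

definition gr_class :: "nat \<Rightarrow> 'x letter list \<Rightarrow> 'x letter list set"
  where "gr_class k a = \<Gamma> (Suc k) #>\<^bsub>FX\<^esub> a"

lemma carrier_gr: "carrier (gr k) = gr_class k ` \<Gamma> k"
  by (auto simp: gr_group_def FactGroup_def RCOSETS_def gr_class_def r_coset_def)

lemma one_gr: "\<one>\<^bsub>gr k\<^esub> = \<Gamma> (Suc k)"
  by (simp add: gr_group_def FactGroup_def)

lemma gr_class_mult:
  assumes "a \<in> \<Gamma> k" "b \<in> \<Gamma> k"
  shows "gr_class k a \<otimes>\<^bsub>gr k\<^esub> gr_class k b = gr_class k (a \<otimes>\<^bsub>FX\<^esub> b)"
  using normal.rcos_sum[OF F.lower_central_normal, of a b "Suc k"] F.lower_central_carrier assms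
  by (auto simp: gr_group_def FactGroup_def gr_class_def set_mult_def)

lemma gr_class_one: "a \<in> \<Gamma> (Suc k) \<Longrightarrow> gr_class k a = \<one>\<^bsub>gr k\<^esub>"
  using F.lower_central_subgroup F.coset_join2 F.lower_central_carrier
  by (simp add: one_gr gr_class_def)

lemma lead_gr_class:
  assumes "k \<ge> 1" "a \<in> \<Gamma> k" "d \<in> gr_class k a"
  shows "lead k d = lead k a" "d \<in> carrier FX"
proof -
  obtain h where h: "h \<in> \<Gamma> (Suc k)" "d = h \<otimes>\<^bsub>FX\<^esub> a"
    using assms(3) by (auto simp: gr_class_def r_coset_def)
  have "h \<in> \<Gamma> k" using h(1) F.lower_central_Suc_subset by blast
  then show "lead k d = lead k a" "d \<in> carrier FX"
    using h lead_mult[of k h a] lead_Suc_zero[of k h] assms F.lower_central_carrier by auto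
qed

lemma gr_class_nonempty: "a \<in> \<Gamma> k \<Longrightarrow> gr_class k a \<noteq> {}"
  using F.normal_mem(1)[OF F.lower_central_normal] by (auto simp: gr_class_def r_coset_def)

text \<open>Representatives of a class share their leading term, so the integral takes a single
  value on the class and \<open>the_elem\<close> returns it: the induced map is well
  defined.\<close>

lemma gr_integral_class:
  assumes "k \<ge> 1" "a \<in> \<Gamma> k" "p \<in> Ass_deg X k"
  shows "gr_integral I (gr_class k a) p = dot X k (lead k a) (emb p)"
proof -
  have "(\<lambda>\<delta>. I \<delta> p) ` gr_class k a = {dot X k (lead k a) (emb p)}"
    using lead_gr_class[OF assms(1,2)] integral_eq_dot[OF _ assms(3)] gr_class_nonempty[OF assms(2)]
    by (auto simp: image_iff)
  then show ?thesis by (simp add: gr_integral_def)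
qed

definition gr_lead :: "nat \<Rightarrow> 'x letter list set \<Rightarrow> ('x, 'K) ncpoly"
  where "gr_lead k C = the_elem (lead k ` C)"

lemma gr_lead_class:
  assumes "k \<ge> 1" "a \<in> \<Gamma> k"
  shows "gr_lead k (gr_class k a) = lead k a"
proof -
  have "lead k ` gr_class k a = {lead k a}"
    using lead_gr_class[OF assms] gr_class_nonempty[OF assms(2)] by (auto simp: image_iff)
  then show ?thesis by (simp add: gr_lead_def)
qed

end

section \<open>Linear extension from a basis\<close>

interpretation pmp: vector_space_pair
  "scale_pm :: 'k::field \<Rightarrow> ('a \<Rightarrow>\<^sub>0 'k) \<Rightarrow> _" "scale_pm :: 'k \<Rightarrow> ('b \<Rightarrow>\<^sub>0 'k) \<Rightarrow> _"
  by unfold_locales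

abbreviation linear_pm :: "(('a \<Rightarrow>\<^sub>0 'k::field) \<Rightarrow> ('b \<Rightarrow>\<^sub>0 'k)) \<Rightarrow> bool"
  where "linear_pm \<equiv> Vector_Spaces.linear scale_pm scale_pm"

lemma linear_pmI:
  "(\<And>p q. f (p + q) = f p + f q) \<Longrightarrow> (\<And>c p. f (scale_pm c p) = scale_pm c (f p)) \<Longrightarrow> linear_pm f"
  by unfold_locales auto

lemma linear_span_zero:
  assumes "linear_pm f" "\<And>p. p \<in> S \<Longrightarrow> f p = 0" "p \<in> span_pm S"
  shows "f p = 0"
  using pmp.linear_eq_0_on_span[OF assms(1) _ assms(3)] assms(2) by blast

text \<open>Common pattern for both tensor products: R consists of the defining relations, S of the
  symbols of a generating family, and f evaluates symbols. If the values on S are distinct and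
  independent, f has no kernel beyond the relations.\<close>

lemma linear_kernel_span:
  assumes f: "linear_pm f" and R: "\<And>r. r \<in> R \<Longrightarrow> f r = 0"
    and S: "inj_on f S" "pm.independent (f ` S)" and s: "s \<in> span_pm (R \<union> S)" "f s = 0"
  shows "s \<in> span_pm R"
proof -
  obtain r t where rt: "s = r + t" "r \<in> span_pm R" "t \<in> span_pm S"
    using s(1) by (auto simp: pm.span_Un)
  have "f r = 0" by (rule linear_span_zero[OF f R rt(2)])
  then have "f t = f 0" using s(2) rt(1) pmp.linear_add[OF f] pmp.linear_0[OF f] by simp
  moreover have "inj_on f (span_pm S)"
    using pmp.linear_inj_on_span_independent_image[OF f S(2,1)] .
  ultimately have "t = 0" using rt(3) pm.span_zero by (auto dest: inj_onD)
  then show ?thesis using rt by simp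
qed

definition extend :: "('a \<Rightarrow> ('b \<Rightarrow>\<^sub>0 'k::field)) \<Rightarrow> ('a \<Rightarrow>\<^sub>0 'k) \<Rightarrow> ('b \<Rightarrow>\<^sub>0 'k)"
  where "extend g s = (\<Sum>a\<in>Poly_Mapping.keys s. scale_pm (lookup s a) (g a))"

lemma extend_superset:
  assumes "finite A" "Poly_Mapping.keys s \<subseteq> A"
  shows "extend g s = (\<Sum>a\<in>A. scale_pm (lookup s a) (g a))"
  unfolding extend_def using assms by (intro sum.mono_neutral_left) (auto simp: in_keys_iff)

lemma extend_linear:
  fixes g :: "'a \<Rightarrow> ('b \<Rightarrow>\<^sub>0 'k::field)"
  shows "linear_pm (extend g)"
proof (rule linear_pmI)
  fix s t :: "'a \<Rightarrow>\<^sub>0 'k"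
  let ?A = "Poly_Mapping.keys s \<union> Poly_Mapping.keys t"
  have "extend g (s + t) = (\<Sum>a\<in>?A. scale_pm (lookup (s + t) a) (g a))"
    by (rule extend_superset) (simp_all add: Poly_Mapping.keys_add)
  also have "\<dots> = (\<Sum>a\<in>?A. scale_pm (lookup s a) (g a)) + (\<Sum>a\<in>?A. scale_pm (lookup t a) (g a))"
    by (simp add: lookup_add pm.scale_left_distrib sum.distrib)
  also have "\<dots> = extend g s + extend g t"
    using extend_superset[of ?A s g] extend_superset[of ?A t g] by simp
  finally show "extend g (s + t) = extend g s + extend g t" .
  fix c
  have "Poly_Mapping.keys (scale_pm c s) \<subseteq> Poly_Mapping.keys s" by (auto simp: in_keys_iff)
  then have "extend g (scale_pm c s) = (\<Sum>a\<in>Poly_Mapping.keys s. scale_pm (lookup (scale_pm c s) a) (g a))"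
    by (intro extend_superset) simp_all
  then show "extend g (scale_pm c s) = scale_pm c (extend g s)"
    by (simp add: extend_def pm.scale_sum_right)
qed

lemma extend_single [simp]: "extend g (Poly_Mapping.single a c) = scale_pm c (g a)"
  by (cases "c = 0") (simp_all add: extend_def)

lemma extend_span: "(\<And>a. a \<in> Poly_Mapping.keys s \<Longrightarrow> g a \<in> span_pm S) \<Longrightarrow> extend g s \<in> span_pm S"
  unfolding extend_def by (intro pm.span_sum pm.span_scale)

lemma extend_singles: "extend (\<lambda>a. Poly_Mapping.single a 1) s = s"
proof (rule poly_mapping_eqI)
  fix b
  have "lookup (extend (\<lambda>a. Poly_Mapping.single a 1) s) b =
    (\<Sum>a\<in>Poly_Mapping.keys s. if a = b then lookup s b else 0)"
    unfolding extend_def lookup_sum by (intro sum.cong) (auto simp: lookup_single when_def)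
  then show "lookup (extend (\<lambda>a. Poly_Mapping.single a 1) s) b = lookup s b"
    by (auto simp: in_keys_iff)
qed

lemma mem_span_singles:
  assumes "\<And>a. a \<in> Poly_Mapping.keys s \<Longrightarrow> Poly_Mapping.single a 1 \<in> span_pm S"
  shows "s \<in> span_pm S"
  using extend_span[of s "\<lambda>a. Poly_Mapping.single a 1" S] assms by (simp add: extend_singles)

text \<open>Functionals are modelled as linear maps into another space of finitely supported
  functions; a scalar is read off as one coefficient of the value.\<close>

lemma exists_linear_separating:
  fixes v :: "'a \<Rightarrow>\<^sub>0 'k::field"
  assumes "v \<notin> span_pm S"
  shows "\<exists>\<phi> :: _ \<Rightarrow> ('b \<Rightarrow>\<^sub>0 'k). linear_pm \<phi> \<and> \<phi> v = u \<and> (\<forall>s\<in>span_pm S. \<phi> s = 0)"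
proof -
  obtain B where B: "B \<subseteq> S" "pm.independent B" "S \<subseteq> span_pm B"
    using pm.maximal_independent_subset by blast
  have SB: "span_pm S \<subseteq> span_pm B" using B(3) by (simp add: pm.span_minimal pm.subspace_span)
  have "span_pm B \<subseteq> span_pm S" using B(1) by (rule pm.span_mono)
  then have "v \<notin> span_pm B" using assms by blast
  then have ind: "pm.independent (insert v B)" and "v \<notin> B"
    using B(2) pm.independent_insertI pm.span_base by blast+
  obtain \<phi> :: "_ \<Rightarrow> ('b \<Rightarrow>\<^sub>0 'k)" where \<phi>: "linear_pm \<phi>" "\<forall>x\<in>insert v B. \<phi> x = (if x = v then u else 0)"
    using pmp.linear_independent_extend[OF ind, of "\<lambda>x. if x = v then u else 0"] by blast
  have "\<phi> b = 0" if "b \<in> B" for b using \<phi>(2) that \<open>v \<notin> B\<close> by auto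
  then have "\<phi> s = 0" if "s \<in> span_pm S" for s using linear_span_zero[OF \<phi>(1)] SB that by blast
  then show ?thesis using \<phi> by auto
qed

lemma ext_pairing_dot:
  assumes "\<And>a v. a \<in> Poly_Mapping.keys s \<Longrightarrow> v \<in> Poly_Mapping.keys t \<Longrightarrow> B a v = dot X k (g a) (h v)"
  shows "ext_pairing B s t = dot X k (extend g s) (extend h t)"
proof -
  have "dot X k p (extend h t) = (\<Sum>v\<in>Poly_Mapping.keys t. lookup t v * dot X k p (h v))" for p
    unfolding extend_def dot_commute[of X k p] by (simp add: dot_sum)
  then show ?thesis
    unfolding ext_pairing_def extend_def dot_sum
    by (simp add: assms sum_distrib_left mult.assoc cong: sum.cong)
qed

section \<open>Extension of scalars for spaces over the small field\<close>

context finite_iterated_integral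
begin

lemma emb_sum: "\<iota> (sum f A) = (\<Sum>a\<in>A. \<iota> (f a))"
  by (induction A rule: infinite_finite_induct) (auto simp: emb_add)

lemma emb_uminus: "\<iota> (- c) = - \<iota> c"
  using emb_add[of c "- c"] by (simp add: eq_neg_iff_add_eq_0 add.commute)

lemma emb_minus: "\<iota> (c - d) = \<iota> c - \<iota> d"
  using emb_add[of c "- d"] by (simp add: emb_uminus)

lemma emb_eq_0_iff [simp]: "\<iota> c = 0 \<longleftrightarrow> c = 0"
proof
  assume "\<iota> c = 0"
  then have "\<iota> (c * inverse c) = 0" by (simp add: emb_mult)
  then show "c = 0" by (cases "c = 0") (auto simp: emb_one)
qed simp

lemma emb_pm_add: "emb (p + q) = emb p + emb q"
  and emb_pm_scale: "emb (scale_pm c p) = scale_pm (\<iota> c) (emb p)"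
  by (auto intro!: poly_mapping_eqI simp: lookup_add emb_add emb_mult)

lemma emb_pm_eq_0_iff: "emb p = 0 \<longleftrightarrow> p = 0"
  by (auto simp: poly_mapping_eq_iff fun_eq_iff)

lemma emb_pm_diff: "emb (p - q) = emb p - emb q"
  by (auto intro!: poly_mapping_eqI simp: lookup_minus emb_minus)

lemma emb_pm_inj: "emb p = emb q \<Longrightarrow> p = q"
  using emb_pm_diff[of p q] emb_pm_eq_0_iff[of "p - q"] by simp

lemma emb_bracket: "emb (bracket p q) = bracket (emb p) (emb q)"
proof -
  have "emb (p * q) = emb p * emb q" for p q
    by (intro poly_mapping_eqI) (simp add: lookup_times_word emb_sum emb_mult)
  then show ?thesis by (simp add: bracket_def emb_pm_diff)
qed

lemma emb_var: "emb (var x) = var x"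
  by (intro poly_mapping_eqI) (simp add: var_def lookup_single when_def emb_one)

lemma emb_left_normed: "emb (left_normed p zs) = left_normed (emb p) zs"
  by (induction zs arbitrary: p) (auto simp: emb_bracket emb_var)

lemma emb_left_normed_brackets: "emb ` left_normed_brackets X k = left_normed_brackets X k"
proof (intro equalityI subsetI)
  fix p :: "('x, 'K) ncpoly" assume "p \<in> left_normed_brackets X k"
  then obtain x zs where "p = left_normed (var x) zs" "x \<in> X" "zs \<in> lists X" "Suc (length zs) = k"
    unfolding left_normed_brackets_def by blast
  then have "p = emb (left_normed (var x) zs)"
      "(left_normed (var x) zs :: ('x, 'k) ncpoly) \<in> left_normed_brackets X k"
    unfolding left_normed_brackets_def by (auto simp: emb_left_normed emb_var simp del: in_lists_conv_set)
  then show "p \<in> emb ` left_normed_brackets X k" by blast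
next
  fix p assume "p \<in> emb ` left_normed_brackets X k"
  then obtain x zs where "p = emb (left_normed (var x) zs)" "x \<in> X" "zs \<in> lists X" "Suc (length zs) = k"
    unfolding left_normed_brackets_def by blast
  then show "p \<in> left_normed_brackets X k"
    unfolding left_normed_brackets_def by (auto simp: emb_left_normed emb_var simp del: in_lists_conv_set)
qed

lemma emb_span:
  assumes "p \<in> span_pm S"
  shows "emb p \<in> span_pm (emb ` S)"
  using assms
proof (rule pm.span_induct)
  show "pm.subspace {p. emb p \<in> span_pm (emb ` S)}"
    by (rule pm.subspaceI)
      (auto simp: emb_pm_add emb_pm_scale pm.span_add pm.span_scale emb_pm_eq_0_iff[THEN iffD2] pm.span_zero)
qed (auto intro: pm.span_base)

text \<open>A linear map over the small field that separates p from the span extends, by its values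
  on words, to a linear map over the large field. The extension agrees with it on embedded
  polynomials and separates the embedded data.\<close>

lemma emb_not_mem_span:
  assumes "p \<notin> span_pm S"
  shows "emb p \<notin> span_pm (emb ` S)"
proof
  assume mem: "emb p \<in> span_pm (emb ` S)"
  obtain \<phi> :: "_ \<Rightarrow> ('x, 'k) ncpoly" where \<phi>: "linear_pm \<phi>" "\<phi> p = Poly_Mapping.single [] 1" "\<forall>s\<in>span_pm S. \<phi> s = 0"
    using exists_linear_separating[OF assms] by blast
  let ?\<Phi> = "extend (\<lambda>w. emb (\<phi> (Poly_Mapping.single w 1)))"
  have \<Phi>: "?\<Phi> (emb q) = emb (\<phi> q)" for q
  proof -
    have keys: "Poly_Mapping.keys (emb q) = Poly_Mapping.keys q" by (auto simp: in_keys_iff)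
    have "\<phi> q = \<phi> (extend (\<lambda>w. Poly_Mapping.single w 1) q)" by (simp add: extend_singles)
    also have "\<dots> = extend (\<lambda>w. \<phi> (Poly_Mapping.single w 1)) q"
      by (simp add: extend_def pmp.linear_sum[OF \<phi>(1)] pmp.linear_scale[OF \<phi>(1)])
    finally have "lookup (emb (\<phi> q)) v = lookup (?\<Phi> (emb q)) v" for v
      by (simp add: extend_def keys lookup_sum emb_sum emb_mult)
    then show ?thesis by (metis poly_mapping_eqI)
  qed
  have "?\<Phi> s = 0" if s: "s \<in> emb ` S" for s
  proof -
    obtain q where "q \<in> S" "s = emb q" using s by blast
    then show ?thesis using \<phi>(3) \<Phi>[of q] emb_pm_eq_0_iff[of 0] by (simp add: pm.span_base)
  qed
  then have "?\<Phi> (emb p) = 0" using linear_span_zero[OF extend_linear] mem by blast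
  then have "\<phi> p = 0" using \<Phi> emb_pm_eq_0_iff by simp
  then show False using \<phi>(2) by (metis lookup_single_eq lookup_zero zero_neq_one)
qed

lemma emb_independent:
  assumes "pm.independent S"
  shows "pm.independent (emb ` S)"
proof (unfold pm.dependent_def, clarify)
  fix p assume p: "p \<in> S" "emb p \<in> span_pm (emb ` S - {emb p})"
  have "emb ` S - {emb p} \<subseteq> emb ` (S - {p})" by blast
  then have "emb p \<in> span_pm (emb ` (S - {p}))" using p(2) pm.span_mono by blast
  then have "p \<in> span_pm (S - {p})" using emb_not_mem_span by blast
  then show False using assms p(1) by (auto simp: pm.dependent_def)
qed

lemma extend_emb_tensor_rel_space:
  assumes "t \<in> tensor_rel_space \<iota> V"
  shows "extend emb t = 0"
  using assms unfolding tensor_rel_space_def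
  by (rule linear_span_zero[OF extend_linear, rotated])
    (auto simp: pmp.linear_diff[OF extend_linear] emb_pm_add emb_pm_scale)

text \<open>Modulo the relations the symbols of a basis of V span everything, and the embedded basis
  stays independent over the large field.\<close>

lemma tensor_rel_space_kernel:
  assumes V: "pm.subspace V" and t: "Poly_Mapping.keys t \<subseteq> V" "extend emb t = 0"
  shows "t \<in> tensor_rel_space \<iota> V"
proof -
  define R :: "(('x, 'k) ncpoly \<Rightarrow>\<^sub>0 'K) set" where "R =
    {Poly_Mapping.single (u + v) 1 - Poly_Mapping.single u 1 - Poly_Mapping.single v 1 | u v.
        u \<in> V \<and> v \<in> V} \<union>
     {Poly_Mapping.single (scale_pm c v) 1 - Poly_Mapping.single v (\<iota> c) | c v. v \<in> V}"
  have rel: "tensor_rel_space \<iota> V = span_pm R" by (simp only: tensor_rel_space_def R_def)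
  obtain B where B: "B \<subseteq> V" "pm.independent B" "V \<subseteq> span_pm B"
    using pm.maximal_independent_subset by blast
  define S :: "(('x, 'k) ncpoly \<Rightarrow>\<^sub>0 'K) set" where "S = (\<lambda>b. Poly_Mapping.single b 1) ` B"
  have VB: "span_pm B = V" using B V pm.span_minimal by blast
  have single: "Poly_Mapping.single v 1 \<in> span_pm (R \<union> S)" if "v \<in> V" for v
  proof -
    have "v \<in> span_pm B" using that VB by simp
    then have "v \<in> V \<and> Poly_Mapping.single v 1 \<in> span_pm (R \<union> S)"
    proof (rule pm.span_induct)
      show "b \<in> V \<and> Poly_Mapping.single b 1 \<in> span_pm (R \<union> S)" if "b \<in> B" for b
        using that B by (auto simp: S_def intro: pm.span_base)
      have scale: "Poly_Mapping.single (scale_pm c v) 1 \<in> span_pm (R \<union> S)"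
        if v: "v \<in> V" "Poly_Mapping.single v 1 \<in> span_pm (R \<union> S)" for c v
      proof -
        have eq: "Poly_Mapping.single (scale_pm c v) 1 =
          (Poly_Mapping.single (scale_pm c v) 1 - Poly_Mapping.single v (\<iota> c)) +
            scale_pm (\<iota> c) (Poly_Mapping.single v 1)"
          by (intro poly_mapping_eqI) (simp add: lookup_add lookup_minus lookup_single when_def)
        have "Poly_Mapping.single (scale_pm c v) 1 - Poly_Mapping.single v (\<iota> c) \<in> R \<union> S"
          unfolding R_def using v(1) by blast
        then show ?thesis by (subst eq) (intro pm.span_add pm.span_scale v(2) pm.span_base)
      qed
      have add: "Poly_Mapping.single (u + v) 1 \<in> span_pm (R \<union> S)"
        if uv: "u \<in> V" "v \<in> V" "Poly_Mapping.single u 1 \<in> span_pm (R \<union> S)"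
          "Poly_Mapping.single v 1 \<in> span_pm (R \<union> S)" for u v
      proof -
        have eq: "Poly_Mapping.single (u + v) 1 =
          (Poly_Mapping.single (u + v) (1 :: 'K) - Poly_Mapping.single u 1 - Poly_Mapping.single v 1) +
            (Poly_Mapping.single u 1 + Poly_Mapping.single v 1)" by simp
        have "Poly_Mapping.single (u + v) 1 - Poly_Mapping.single u 1 - Poly_Mapping.single v 1 \<in> R \<union> S"
          unfolding R_def using uv(1,2) by blast
        then show ?thesis by (subst eq) (intro pm.span_add uv(3,4) pm.span_base)
      qed
      have zero: "Poly_Mapping.single 0 1 \<in> span_pm (R \<union> S)"
      proof -
        have "0 \<in> V" using V by (rule pm.subspace_0)
        \<comment> \<open>For the scalar 0 the relation is the symbol of the zero vector
          itself.\<close>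
        then have "Poly_Mapping.single (scale_pm 0 0) 1 - Poly_Mapping.single 0 (\<iota> 0) \<in> R"
          unfolding R_def by blast
        then have "Poly_Mapping.single 0 1 \<in> R \<union> S" by simp
        then show ?thesis by (rule pm.span_base)
      qed
      show "pm.subspace {v. v \<in> V \<and> Poly_Mapping.single v 1 \<in> span_pm (R \<union> S)}"
      proof (rule pm.subspaceI; clarify)
        show "0 \<in> V \<and> Poly_Mapping.single 0 1 \<in> span_pm (R \<union> S)"
          using V zero pm.subspace_0 by blast
        show "u + v \<in> V \<and> Poly_Mapping.single (u + v) 1 \<in> span_pm (R \<union> S)"
          if "u \<in> V" "Poly_Mapping.single u 1 \<in> span_pm (R \<union> S)"
            "v \<in> V" "Poly_Mapping.single v 1 \<in> span_pm (R \<union> S)" for u v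
          using that V add pm.subspace_add by blast
        show "scale_pm c v \<in> V \<and> Poly_Mapping.single (scale_pm c v) 1 \<in> span_pm (R \<union> S)"
          if "v \<in> V" "Poly_Mapping.single v 1 \<in> span_pm (R \<union> S)" for c v
          using that V scale pm.subspace_scale by blast
      qed
    qed
    then show ?thesis ..
  qed
  have "t \<in> span_pm R"
  proof (rule linear_kernel_span[OF extend_linear[of emb]])
    show "extend emb r = 0" if "r \<in> R" for r
      by (rule extend_emb_tensor_rel_space[of r V], unfold rel) (rule pm.span_base[OF that])
    show "inj_on (extend emb) S"
      unfolding S_def by (rule inj_onI) (auto dest: emb_pm_inj)
    have "extend emb ` S = emb ` B" by (simp add: S_def image_image)
    then show "pm.independent (extend emb ` S)" using emb_independent[OF B(2)] by simp
    show "t \<in> span_pm (R \<union> S)" by (rule mem_span_singles, rule single) (use t(1) in blast)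
  qed (rule t)
  then show ?thesis by (simp only: rel)
qed

end

section \<open>Non-degeneracy\<close>

context finite_iterated_integral
begin

definition enc :: "'x \<Rightarrow> nat"
  where "enc = (SOME e. inj_on e X)"

lemma enc_inj: "inj_on enc X"
  unfolding enc_def using finite_imp_inj_to_nat_seg[OF finite_X] by (metis someI_ex)

sublocale GG: generated_group FX "\<lambda>x. [(True, x)]" X enc
  by (rule generated_free_group[OF finite_X enc_inj])

definition hall_trees :: "nat \<Rightarrow> 'x tree set"
  where "hall_trees k = {h. hall enc X h \<and> length (foliage h) = k}"

lemma finite_hall_trees: "finite (hall_trees k)"
  unfolding hall_trees_def by (rule finite_hall[OF finite_X enc_inj])

abbreviation hall_lead :: "nat \<Rightarrow> 'x tree \<Rightarrow> ('x, 'K) ncpoly"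
  where "hall_lead k h \<equiv> lead k (GG.tree_comm h)"

lemma tree_comm_mem: "h \<in> hall_trees k \<Longrightarrow> GG.tree_comm h \<in> \<Gamma> k"
  using GG.tree_comm_lower_central by (auto simp: hall_trees_def)

text \<open>The usable form of non-degeneracy in degree 1: over \<open>K\<close>, the matrix of
  integrals of letters along paths has rank equal to the number of letters.\<close>

definition full_rank :: bool
  where "full_rank \<longleftrightarrow> (\<forall>x\<in>X. var x \<in> span_pm (lead 1 ` carrier FX))"

lemma brackets_span_lead:
  assumes full_rank "k \<ge> 1"
  shows "left_normed_brackets X k \<subseteq> span_pm (lead k ` \<Gamma> k)"
  using assms(2)
proof (induction k rule: dec_induct)
  case base
  show ?case unfolding left_normed_brackets_1 using assms(1) by (auto simp: full_rank_def)
next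
  case (step k)
  show ?case
  proof
    fix q :: "('x, 'K) ncpoly" assume "q \<in> left_normed_brackets X (Suc k)"
    then obtain p x where q: "q = bracket p (var x)" "p \<in> left_normed_brackets X k" "x \<in> X"
      unfolding left_normed_brackets_Suc[OF step.hyps(1)] by blast
    have "p \<in> span_pm (lead k ` \<Gamma> k)" "var x \<in> span_pm (lead 1 ` carrier FX)"
      using q step.IH assms(1) by (auto simp: full_rank_def)
    then have "bracket p (var x) \<in> span_pm (lead (Suc k) ` \<Gamma> (Suc k))"
    proof (rule bracket_span)
      fix s t assume "s \<in> lead k ` \<Gamma> k" "t \<in> lead 1 ` carrier FX"
      then obtain b a where ba: "s = lead k b" "b \<in> \<Gamma> k" "t = lead 1 a" "a \<in> \<Gamma> 1" by auto
      then have "bracket s t = lead (Suc k) (F.comm b a)" "F.comm b a \<in> \<Gamma> (Suc k)"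
        using lead_comm[of b k a 1] F.comm_lower_central[of b k a 1] step.hyps by simp_all
      then show "bracket s t \<in> span_pm (lead (Suc k) ` \<Gamma> (Suc k))" by (simp add: pm.span_base)
    qed
    then show "q \<in> span_pm (lead (Suc k) ` \<Gamma> (Suc k))" using q by simp
  qed
qed

lemma lead_mem_span_hall:
  assumes "k \<ge> 1" "a \<in> GG.hall_gen H k"
  shows "lead k a \<in> span_pm (hall_lead k ` (H \<inter> hall_trees k))"
proof -
  let ?S = "hall_lead k ` (H \<inter> hall_trees k)"
  have "GG.hall_gen H k \<subseteq> {a \<in> \<Gamma> k. lead k a \<in> span_pm ?S}"
  proof (rule GG.hall_gen_subset)
    show "subgroup {a \<in> \<Gamma> k. lead k a \<in> span_pm ?S} FX"
      using assms(1) by (rule lead_span_subgroup)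
    show "\<Gamma> (Suc k) \<subseteq> {a \<in> \<Gamma> k. lead k a \<in> span_pm ?S}"
      using lead_Suc_zero[OF assms(1)] F.lower_central_Suc_subset by (auto simp: pm.span_zero)
    fix h assume "h \<in> H" "hall enc X h" "length (foliage h) = k"
    then have "h \<in> H \<inter> hall_trees k" by (simp add: hall_trees_def)
    then show "GG.tree_comm h \<in> {a \<in> \<Gamma> k. lead k a \<in> span_pm ?S}"
      using tree_comm_mem by (auto intro: pm.span_base)
  qed
  then show ?thesis using assms(2) by blast
qed

text \<open>
  The leading terms of the Hall commutators span the same space as the Lie polynomials of the Hall
  trees, which are independent; so by counting they are independent as well.
\<close>

lemma hall_lead_independent:
  assumes full_rank "k \<ge> 1"
  shows "inj_on (hall_lead k) (hall_trees k)" "pm.independent (hall_lead k ` hall_trees k)"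
proof -
  let ?P = "lie_poly :: 'x tree \<Rightarrow> ('x, 'K) ncpoly"
  let ?H = "hall_trees k" and ?L = "hall_lead k ` hall_trees k"
  obtain B where B: "B \<subseteq> ?L" "pm.independent B" "?L \<subseteq> span_pm B"
    using pm.maximal_independent_subset by blast
  have finL: "finite ?L" using finite_hall_trees by blast
  then have finB: "finite B" using B(1) finite_subset by blast
  have "lead k ` \<Gamma> k \<subseteq> span_pm ?L"
    using lead_mem_span_hall[OF assms(2), of _ UNIV] GG.lower_central_eq_hall_gen[OF assms(2)] by auto
  then have "span_pm (lead k ` \<Gamma> k) \<subseteq> span_pm ?L" by (simp add: pm.span_minimal)
  moreover have "span_pm ?L \<subseteq> span_pm B" using B(3) by (simp add: pm.span_minimal)
  moreover have "span_pm (left_normed_brackets X k) \<subseteq> span_pm (lead k ` \<Gamma> k)"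
    using brackets_span_lead[OF assms] by (simp add: pm.span_minimal)
  moreover have "?P ` ?H \<subseteq> span_pm (left_normed_brackets X k)"
    using lie_poly_free_lie_deg free_lie_deg_subset_span by (fastforce simp: hall_trees_def)
  ultimately have PB: "?P ` ?H \<subseteq> span_pm B" by blast
  have P: "inj_on ?P ?H" "pm.independent (?P ` ?H)"
    using lie_poly_independent[OF finite_hall_trees _ enc_inj] by (auto simp: hall_trees_def)
  have "card ?H = card (?P ` ?H)" using P(1) by (simp add: card_image)
  also have "\<dots> \<le> card B" using pm.independent_span_bound[OF finB P(2) PB] by simp
  finally have HB: "card ?H \<le> card B" .
  moreover have "card B \<le> card ?L" using finL B(1) by (rule card_mono)
  moreover have "card ?L \<le> card ?H" using finite_hall_trees by (rule card_image_le)
  \<comment> \<open>The chain \<open>card ?H\<close> \<le> \<open>card B\<close> \<le>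
    \<open>card ?L\<close> \<le> \<open>card ?H\<close> closes, so the leading terms are distinct
    and B omits none of them.\<close>
  ultimately have "card ?L = card ?H" "card B = card ?L" by simp_all
  then show "inj_on (hall_lead k) ?H" using finite_hall_trees by (simp add: eq_card_imp_inj_on)
  have "B = ?L" using \<open>card B = card ?L\<close> B(1) finL by (simp add: card_subset_eq)
  then show "pm.independent ?L" using B(2) by simp
qed

lemma lead_int_pow:
  assumes "k \<ge> 1" "a \<in> \<Gamma> k"
  shows "lead k (a [^]\<^bsub>FX\<^esub> (n :: int)) = scale_pm (of_int n) (lead k a)"
proof -
  have nat: "lead k (a [^]\<^bsub>FX\<^esub> (m :: nat)) = scale_pm (of_nat m) (lead k a) \<and> a [^]\<^bsub>FX\<^esub> m \<in> \<Gamma> k" for m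
  proof (induction m)
    case 0
    then show ?case using lead_one assms F.normal_mem(1)[OF F.lower_central_normal] by simp
  next
    case (Suc m)
    then show ?case
      using lead_mult[OF assms(1) _ assms(2)] F.normal_mem(2)[OF F.lower_central_normal _ assms(2)]
      by (simp add: pm.scale_left_distrib add.commute)
  qed
  show ?thesis
  proof (cases n rule: int_cases2)
    case (nonneg m)
    then show ?thesis using nat[of m] by (simp add: int_pow_int)
  next
    case (nonpos m)
    have "a \<in> carrier FX" using assms(2) by (rule F.lower_central_carrier)
    then show ?thesis
      using nonpos nat[of m] lead_inv[OF assms(1), of "a [^]\<^bsub>FX\<^esub> m"]
      by (simp add: F.int_pow_neg int_pow_int)
  qed
qed

text \<open>Modulo the normal subgroup \<open>hall_gen S k\<close> the larger group is cyclic,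
  generated by the added commutator; n is the exponent that cancels the power of it contained in
  a.\<close>

lemma hall_gen_insert:
  assumes k: "k \<ge> 1" and h: "h \<in> hall_trees k" and a: "a \<in> GG.hall_gen (insert h S) k"
  shows "\<exists>n :: int. a \<otimes>\<^bsub>FX\<^esub> GG.tree_comm h [^]\<^bsub>FX\<^esub> n \<in> GG.hall_gen S k"
proof -
  let ?x = "GG.tree_comm h" and ?N = "GG.hall_gen S k"
  have N: "?N \<lhd> FX" using k by (rule GG.hall_gen_normal)
  have x [simp]: "?x \<in> carrier FX" using h by (simp add: hall_trees_def)
  define K where "K = {a \<in> carrier FX. \<exists>n :: int. a \<otimes>\<^bsub>FX\<^esub> ?x [^]\<^bsub>FX\<^esub> n \<in> ?N}"
  have "subgroup K FX"
  proof
    show "K \<subseteq> carrier FX" by (auto simp: K_def)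
    show "\<one>\<^bsub>FX\<^esub> \<in> K" using F.normal_mem(1)[OF N] by (auto simp: K_def intro!: exI[of _ 0])
  next
    fix a b assume "a \<in> K" "b \<in> K"
    then obtain n m :: int where c [simp]: "a \<in> carrier FX" "b \<in> carrier FX"
      and n: "a \<otimes>\<^bsub>FX\<^esub> ?x [^]\<^bsub>FX\<^esub> n \<in> ?N" and m: "b \<otimes>\<^bsub>FX\<^esub> ?x [^]\<^bsub>FX\<^esub> m \<in> ?N"
      by (auto simp: K_def)
    let ?y = "?x [^]\<^bsub>FX\<^esub> n"
    have "inv\<^bsub>FX\<^esub> ?y \<otimes>\<^bsub>FX\<^esub> (b \<otimes>\<^bsub>FX\<^esub> ?x [^]\<^bsub>FX\<^esub> m) \<otimes>\<^bsub>FX\<^esub> ?y \<in> ?N"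
      using F.normal_conj(2)[OF N _ m, of ?y] by simp
    from F.normal_mem(2)[OF N n this]
    have "a \<otimes>\<^bsub>FX\<^esub> b \<otimes>\<^bsub>FX\<^esub> (?x [^]\<^bsub>FX\<^esub> m \<otimes>\<^bsub>FX\<^esub> ?y) \<in> ?N"
      by (simp add: F.m_assoc F.inv_cancel_left)
    then have "a \<otimes>\<^bsub>FX\<^esub> b \<otimes>\<^bsub>FX\<^esub> ?x [^]\<^bsub>FX\<^esub> (m + n) \<in> ?N" by (simp add: F.int_pow_mult)
    then show "a \<otimes>\<^bsub>FX\<^esub> b \<in> K" unfolding K_def using c by blast
  next
    fix a assume "a \<in> K"
    then obtain n :: int where c [simp]: "a \<in> carrier FX" and n: "a \<otimes>\<^bsub>FX\<^esub> ?x [^]\<^bsub>FX\<^esub> n \<in> ?N"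
      by (auto simp: K_def)
    let ?y = "?x [^]\<^bsub>FX\<^esub> n"
    have "?y \<otimes>\<^bsub>FX\<^esub> (a \<otimes>\<^bsub>FX\<^esub> ?y) \<otimes>\<^bsub>FX\<^esub> inv\<^bsub>FX\<^esub> ?y \<in> ?N"
      using F.normal_conj(1)[OF N _ n, of ?y] by simp
    from F.normal_mem(3)[OF N this] have "inv\<^bsub>FX\<^esub> a \<otimes>\<^bsub>FX\<^esub> ?x [^]\<^bsub>FX\<^esub> (- n) \<in> ?N"
      by (simp add: F.m_assoc F.inv_mult_group F.int_pow_neg)
    then show "inv\<^bsub>FX\<^esub> a \<in> K" unfolding K_def using c F.inv_closed by blast
  qed
  moreover have "g \<in> K" if "g \<in> ?N" for g
    using that F.normal_mem(4)[OF N that] by (auto simp: K_def intro!: exI[of _ 0])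
  moreover have "?x \<in> K"
    using F.normal_mem(1)[OF N] by (auto simp: K_def F.int_pow_neg intro!: exI[of _ "- 1"])
  ultimately have "GG.hall_gen (insert h S) k \<subseteq> K"
    using GG.hall_gen_incl(1)[of _ S k] GG.hall_gen_incl(2)[of k S]
    by (intro GG.hall_gen_subset) auto
  then show ?thesis using a by (auto simp: K_def)
qed

text \<open>Generators are eliminated one at a time. If a power n of a Hall commutator carries a
  into the group of the remaining ones, then n times its leading term lies in the span of theirs;
  independence and characteristic zero force n = 0.\<close>

lemma lead_eq_zero:
  assumes full_rank "k \<ge> 1" "a \<in> \<Gamma> k" "lead k a = 0"
  shows "a \<in> \<Gamma> (Suc k)"
proof -
  have "a \<in> \<Gamma> (Suc k)" if "finite S" "S \<subseteq> hall_trees k" "a \<in> GG.hall_gen S k" "lead k a = 0" for S a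
    using that
  proof (induction S arbitrary: a rule: finite_induct)
    case empty
    have "GG.hall_gen {} k \<subseteq> \<Gamma> (Suc k)"
      using F.lower_central_subgroup by (intro GG.hall_gen_subset) auto
    then show ?case using empty by blast
  next
    case (insert h S)
    let ?x = "GG.tree_comm h"
    have h: "h \<in> hall_trees k" using insert.prems by blast
    obtain n :: int where n: "a \<otimes>\<^bsub>FX\<^esub> ?x [^]\<^bsub>FX\<^esub> n \<in> GG.hall_gen S k"
      using hall_gen_insert[OF assms(2) h insert.prems(2)] by blast
    have a: "a \<in> \<Gamma> k" using insert.prems GG.hall_gen_lower_central by blast
    have "?x [^]\<^bsub>FX\<^esub> n \<in> \<Gamma> k"
      using F.subgroup_int_pow_closed[OF F.lower_central_subgroup tree_comm_mem[OF h]] .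
    then have "lead k (a \<otimes>\<^bsub>FX\<^esub> ?x [^]\<^bsub>FX\<^esub> n) = scale_pm (of_int n) (hall_lead k h)"
      using lead_mult[OF assms(2) a] lead_int_pow[OF assms(2) tree_comm_mem[OF h]] insert.prems by simp
    moreover have "lead k (a \<otimes>\<^bsub>FX\<^esub> ?x [^]\<^bsub>FX\<^esub> n) \<in> span_pm (hall_lead k ` S)"
    proof -
      have "S \<inter> hall_trees k = S" using insert.prems by blast
      then show ?thesis using lead_mem_span_hall[OF assms(2) n] by simp
    qed
    ultimately have mem: "scale_pm (of_int n) (hall_lead k h) \<in> span_pm (hall_lead k ` S)" by simp
    have "n = 0"
    proof (rule ccontr)
      assume "n \<noteq> 0"
      then have "scale_pm (1 / of_int n) (scale_pm (of_int n) (hall_lead k h)) = hall_lead k h" by simp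
      then have "hall_lead k h \<in> span_pm (hall_lead k ` S)"
        using pm.span_scale[OF mem, of "1 / of_int n"] by simp
      moreover have "hall_lead k ` S \<subseteq> hall_lead k ` hall_trees k - {hall_lead k h}"
        using insert.hyps(2) insert.prems(1) hall_lead_independent(1)[OF assms(1,2)]
        by (auto simp: inj_on_def)
      ultimately have "hall_lead k h \<in> span_pm (hall_lead k ` hall_trees k - {hall_lead k h})"
        using pm.span_mono by blast
      then show False
        using hall_lead_independent(2)[OF assms(1,2)] h unfolding pm.dependent_def by blast
    qed
    then have "a \<in> GG.hall_gen S k" using n F.lower_central_carrier[OF a] by simp
    then show ?case using insert by simp
  qed
  moreover have "a \<in> GG.hall_gen (hall_trees k) k"
  proof -
    have "GG.hall_gen UNIV k \<subseteq> GG.hall_gen (hall_trees k) k"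
      using GG.hall_gen_incl(1)[of _ "hall_trees k" k] GG.hall_gen_incl(2)[of k "hall_trees k"]
      by (intro GG.hall_gen_subset GG.hall_gen_subgroup) (auto simp: hall_trees_def)
    then show ?thesis using assms(3) GG.lower_central_eq_hall_gen[OF assms(2)] by blast
  qed
  ultimately show ?thesis using finite_hall_trees assms(4) by blast
qed

section \<open>Extension of scalars for the graded quotients\<close>

lemma extend_lead_tensor_rel_group:
  assumes "k \<ge> 1" "s \<in> tensor_rel_group (gr k)"
  shows "extend (gr_lead k) s = 0"
  using assms(2) unfolding tensor_rel_group_def
proof (rule linear_span_zero[OF extend_linear, rotated])
  fix p assume "p \<in> {Poly_Mapping.single (a \<otimes>\<^bsub>gr k\<^esub> b) (1::'K) - Poly_Mapping.single a 1 - Poly_Mapping.single b 1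
    | a b. a \<in> carrier (gr k) \<and> b \<in> carrier (gr k)}"
  then obtain a b where ab: "a \<in> \<Gamma> k" "b \<in> \<Gamma> k"
    and p: "p = Poly_Mapping.single (gr_class k a \<otimes>\<^bsub>gr k\<^esub> gr_class k b) 1 -
      Poly_Mapping.single (gr_class k a) 1 - Poly_Mapping.single (gr_class k b) 1"
    unfolding carrier_gr by blast
  have "a \<otimes>\<^bsub>FX\<^esub> b \<in> \<Gamma> k" using F.normal_mem(2)[OF F.lower_central_normal] ab by blast
  then show "extend (gr_lead k) p = 0"
    using ab assms(1) unfolding p
    by (simp add: gr_class_mult pmp.linear_diff[OF extend_linear] gr_lead_class lead_mult)
qed

text \<open>Modulo the relations every symbol lies in the span of the symbols of Hall commutators,
  since the elements with this property form a subgroup. The leading terms of these commutators are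
  independent over \<open>K\<close>, so evaluation has no further kernel.\<close>

lemma tensor_rel_group_kernel:
  assumes full_rank "k \<ge> 1" and s: "Poly_Mapping.keys s \<subseteq> carrier (gr k)" "extend (gr_lead k) s = 0"
  shows "s \<in> tensor_rel_group (gr k)"
proof -
  define R :: "('x letter list set \<Rightarrow>\<^sub>0 'K) set" where
    "R = {Poly_Mapping.single (a \<otimes>\<^bsub>gr k\<^esub> b) 1 - Poly_Mapping.single a 1 - Poly_Mapping.single b 1
      | a b. a \<in> carrier (gr k) \<and> b \<in> carrier (gr k)}"
  have rel: "tensor_rel_group (gr k) = span_pm R" by (simp only: tensor_rel_group_def R_def)
  define sg :: "'x letter list \<Rightarrow> ('x letter list set \<Rightarrow>\<^sub>0 'K)"
    where "sg a = Poly_Mapping.single (gr_class k a) 1" for a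
  define S where "S = (\<lambda>h. sg (GG.tree_comm h)) ` hall_trees k"
  have sgR: "sg (a \<otimes>\<^bsub>FX\<^esub> b) - sg a - sg b \<in> R" if "a \<in> \<Gamma> k" "b \<in> \<Gamma> k" for a b
  proof -
    have "gr_class k a \<in> carrier (gr k)" "gr_class k b \<in> carrier (gr k)" using that by (auto simp: carrier_gr)
    then have "Poly_Mapping.single (gr_class k a \<otimes>\<^bsub>gr k\<^esub> gr_class k b) 1 -
      Poly_Mapping.single (gr_class k a) 1 - Poly_Mapping.single (gr_class k b) 1 \<in> R"
      unfolding R_def by blast
    then show ?thesis by (simp add: gr_class_mult[OF that] sg_def)
  qed
  have diff: "sg (a \<otimes>\<^bsub>FX\<^esub> b) - sg a - sg b \<in> span_pm (R \<union> S)" if "a \<in> \<Gamma> k" "b \<in> \<Gamma> k" for a b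
    using sgR[OF that] by (intro pm.span_base) blast
  note N = F.lower_central_normal[of k]
  \<comment> \<open>The relation for the product of 1 with 1 is minus the symbol of 1.\<close>
  have one: "sg \<one>\<^bsub>FX\<^esub> \<in> span_pm (R \<union> S)"
    using pm.span_neg[OF diff[OF F.normal_mem(1)[OF N] F.normal_mem(1)[OF N]]] by simp
  have sgl: "subgroup {a \<in> \<Gamma> k. sg a \<in> span_pm (R \<union> S)} FX"
  proof
    show "{a \<in> \<Gamma> k. sg a \<in> span_pm (R \<union> S)} \<subseteq> carrier FX" using F.lower_central_carrier by blast
    show "\<one>\<^bsub>FX\<^esub> \<in> {a \<in> \<Gamma> k. sg a \<in> span_pm (R \<union> S)}" using one F.normal_mem(1)[OF N] by blast
  next
    fix a b assume "a \<in> {a \<in> \<Gamma> k. sg a \<in> span_pm (R \<union> S)}" "b \<in> {a \<in> \<Gamma> k. sg a \<in> span_pm (R \<union> S)}"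
    then have ab: "a \<in> \<Gamma> k" "b \<in> \<Gamma> k" "sg a \<in> span_pm (R \<union> S)" "sg b \<in> span_pm (R \<union> S)" by auto
    have "sg (a \<otimes>\<^bsub>FX\<^esub> b) = (sg (a \<otimes>\<^bsub>FX\<^esub> b) - sg a - sg b) + (sg a + sg b)" by simp
    also have "\<dots> \<in> span_pm (R \<union> S)" by (intro pm.span_add diff ab)
    finally show "a \<otimes>\<^bsub>FX\<^esub> b \<in> {a \<in> \<Gamma> k. sg a \<in> span_pm (R \<union> S)}"
      using F.normal_mem(2)[OF N ab(1,2)] by simp
  next
    fix a assume "a \<in> {a \<in> \<Gamma> k. sg a \<in> span_pm (R \<union> S)}"
    then have a: "a \<in> \<Gamma> k" "sg a \<in> span_pm (R \<union> S)" by auto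
    have i: "inv\<^bsub>FX\<^esub> a \<in> \<Gamma> k" using F.normal_mem(3)[OF N a(1)] .
    have "sg \<one>\<^bsub>FX\<^esub> - sg a - sg (inv\<^bsub>FX\<^esub> a) \<in> span_pm (R \<union> S)"
      using diff[OF a(1) i] F.lower_central_carrier[OF a(1)] by simp
    note pm.span_diff[OF pm.span_diff[OF one a(2)] this]
    moreover have "sg (inv\<^bsub>FX\<^esub> a) = sg \<one>\<^bsub>FX\<^esub> - sg a - (sg \<one>\<^bsub>FX\<^esub> - sg a - sg (inv\<^bsub>FX\<^esub> a))"
      by (simp add: algebra_simps)
    ultimately have "sg (inv\<^bsub>FX\<^esub> a) \<in> span_pm (R \<union> S)" by (simp only:)
    then show "inv\<^bsub>FX\<^esub> a \<in> {a \<in> \<Gamma> k. sg a \<in> span_pm (R \<union> S)}" using i by simp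
  qed
  have "GG.hall_gen UNIV k \<subseteq> {a \<in> \<Gamma> k. sg a \<in> span_pm (R \<union> S)}"
  proof (rule GG.hall_gen_subset[OF sgl])
    show "\<Gamma> (Suc k) \<subseteq> {a \<in> \<Gamma> k. sg a \<in> span_pm (R \<union> S)}"
    proof
      fix a assume a: "a \<in> \<Gamma> (Suc k)"
      have "gr_class k a = gr_class k \<one>\<^bsub>FX\<^esub>"
        using gr_class_one[OF a] gr_class_one[OF F.normal_mem(1)[OF F.lower_central_normal]] by simp
      then have "sg a = sg \<one>\<^bsub>FX\<^esub>" by (simp add: sg_def)
      then show "a \<in> {a \<in> \<Gamma> k. sg a \<in> span_pm (R \<union> S)}"
        using one a F.lower_central_Suc_subset by auto
    qed
    fix h assume "hall enc X h" "length (foliage h) = k"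
    then have h: "h \<in> hall_trees k" by (simp add: hall_trees_def)
    then have "sg (GG.tree_comm h) \<in> R \<union> S" by (simp add: S_def)
    then show "GG.tree_comm h \<in> {a \<in> \<Gamma> k. sg a \<in> span_pm (R \<union> S)}"
      using tree_comm_mem[OF h] by (simp add: pm.span_base)
  qed
  then have sg_mem: "sg a \<in> span_pm (R \<union> S)" if "a \<in> \<Gamma> k" for a
    using that GG.lower_central_eq_hall_gen[OF assms(2)] by blast
  have ext: "extend (gr_lead k) (sg (GG.tree_comm h)) = hall_lead k h" if "h \<in> hall_trees k" for h
    using gr_lead_class[OF assms(2) tree_comm_mem[OF that]] by (simp add: sg_def)
  have "s \<in> span_pm R"
  proof (rule linear_kernel_span[OF extend_linear[of "gr_lead k"]])
    show "extend (gr_lead k) r = 0" if "r \<in> R" for r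
      by (rule extend_lead_tensor_rel_group[OF assms(2)], unfold rel) (rule pm.span_base[OF that])
    show "inj_on (extend (gr_lead k)) S"
    proof (rule inj_onI)
      fix p q assume "p \<in> S" "q \<in> S" and eq: "extend (gr_lead k) p = extend (gr_lead k) q"
      then obtain g h where "g \<in> hall_trees k" "h \<in> hall_trees k"
        "p = sg (GG.tree_comm g)" "q = sg (GG.tree_comm h)" by (auto simp: S_def)
      then show "p = q" using eq ext hall_lead_independent(1)[OF assms(1,2)] by (auto dest: inj_onD)
    qed
    have "extend (gr_lead k) ` S = hall_lead k ` hall_trees k"
      unfolding S_def image_image using ext by (intro image_cong) auto
    then show "pm.independent (extend (gr_lead k) ` S)"
      using hall_lead_independent(2)[OF assms(1,2)] by simp
    show "s \<in> span_pm (R \<union> S)"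
    proof (rule mem_span_singles)
      fix C assume "C \<in> Poly_Mapping.keys s"
      then obtain a where "a \<in> \<Gamma> k" "C = gr_class k a" using s(1) unfolding carrier_gr by blast
      then show "Poly_Mapping.single C 1 \<in> span_pm (R \<union> S)" using sg_mem by (simp add: sg_def)
    qed
  qed (rule s)
  then show ?thesis by (simp only: rel)
qed

section \<open>Orthogonality and the four kernels\<close>

lemma free_lie_deg_subspace: "pm.subspace (free_lie_deg X k)"
  unfolding free_lie_deg_def
  by (rule pm.subspaceI) (simp_all add: free_lie.zero free_lie.add free_lie.scale
    pm.subspace_0 pm.subspace_add pm.subspace_scale Ass_deg_subspace)

lemma gr_integral_dot:
  assumes "k \<ge> 1" "C \<in> carrier (gr k)" "p \<in> Ass_deg X k"
  shows "gr_integral I C p = dot X k (gr_lead k C) (emb p)"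
  using assms gr_integral_class gr_lead_class by (auto simp: carrier_gr)

lemma ext_pairing_gr:
  assumes "k \<ge> 1" "Poly_Mapping.keys s \<subseteq> carrier (gr k)" "Poly_Mapping.keys t \<subseteq> free_lie_deg X k"
  shows "ext_pairing (gr_integral I) s t = dot X k (extend (gr_lead k) s) (extend emb t)"
proof (rule ext_pairing_dot)
  fix C v assume "C \<in> Poly_Mapping.keys s" "v \<in> Poly_Mapping.keys t"
  then have "C \<in> carrier (gr k)" "v \<in> Ass_deg X k" using assms(2,3) by (auto simp: free_lie_deg_def)
  then show "gr_integral I C v = dot X k (gr_lead k C) (emb v)" by (rule gr_integral_dot[OF assms(1)])
qed

lemma gr_lead_span: "k \<ge> 1 \<Longrightarrow> C \<in> carrier (gr k) \<Longrightarrow> gr_lead k C \<in> span_pm (left_normed_brackets X k)"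
  using gr_lead_class lead_span by (auto simp: carrier_gr)

lemma emb_free_lie_deg_span:
  assumes "p \<in> free_lie_deg X k"
  shows "emb p \<in> span_pm (left_normed_brackets X k)"
  using emb_span[of p "left_normed_brackets X k"] free_lie_deg_subset_span[of X k] assms
  by (auto simp: emb_left_normed_brackets)

lemma orthogonal_brackets_zero:
  assumes "p \<in> span_pm (left_normed_brackets X k)" "\<And>v. v \<in> free_lie_deg X k \<Longrightarrow> dot X k p (emb v) = 0"
  shows "p = 0"
proof (rule dot_nondegenerate_lie[OF finite_X assms(1)])
  fix q :: "('x, 'K) ncpoly" assume "q \<in> left_normed_brackets X k"
  then obtain v where "v \<in> left_normed_brackets X k" "q = emb v"
    unfolding emb_left_normed_brackets[symmetric] by blast
  then show "dot X k p q = 0" using assms(2) left_normed_brackets_free_lie_deg by blast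
qed

lemma orthogonal_leads_zero:
  assumes full_rank "k \<ge> 1" "p \<in> span_pm (left_normed_brackets X k)"
    and "\<And>C. C \<in> carrier (gr k) \<Longrightarrow> dot X k (gr_lead k C) p = 0"
  shows "p = 0"
proof (rule dot_nondegenerate_lie[OF finite_X assms(3)])
  fix q :: "('x, 'K) ncpoly" assume "q \<in> left_normed_brackets X k"
  then have "q \<in> span_pm (lead k ` \<Gamma> k)" using brackets_span_lead[OF assms(1,2)] by blast
  moreover have "dot X k p r = 0" if r: "r \<in> lead k ` \<Gamma> k" for r
  proof -
    obtain a where a: "a \<in> \<Gamma> k" "r = lead k a" using r by blast
    then have "r = gr_lead k (gr_class k a)" "gr_class k a \<in> carrier (gr k)"
      using gr_lead_class[OF assms(2)] by (auto simp: carrier_gr)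
    then show ?thesis using assms(4) dot_commute by metis
  qed
  ultimately show "dot X k p q = 0" using dot_span_zero by blast
qed

text \<open>Each clause becomes orthogonality in the inner product of words. Embedded Lie
  polynomials and leading terms both have the left-normed brackets in their span, and so does the
  vector under test lie in the span of these brackets; it is therefore zero. Injectivity of leading
  terms, or of the evaluation of tensors, finishes each clause.\<close>

lemma nondegenerate_gr:
  assumes full_rank "k \<ge> 1"
  shows "nondegenerate \<iota> (gr k) (free_lie_deg X k) (gr_integral I)"
  unfolding nondegenerate_def
proof (intro conjI ballI allI impI)
  fix C assume C: "C \<in> carrier (gr k)" and zero: "\<forall>v\<in>free_lie_deg X k. gr_integral I C v = 0"
  have "gr_lead k C = 0"
  proof (rule orthogonal_brackets_zero[OF gr_lead_span[OF assms(2) C]])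
    show "dot X k (gr_lead k C) (emb v) = 0" if "v \<in> free_lie_deg X k" for v
      using zero that gr_integral_dot[OF assms(2) C, of v] by (simp add: free_lie_deg_def)
  qed
  moreover obtain a where "a \<in> \<Gamma> k" "C = gr_class k a" using C unfolding carrier_gr by blast
  ultimately show "C = \<one>\<^bsub>gr k\<^esub>"
    using lead_eq_zero[OF assms] gr_lead_class[OF assms(2)] gr_class_one by simp
next
  fix v assume v: "v \<in> free_lie_deg X k" and zero: "\<forall>C\<in>carrier (gr k). gr_integral I C v = 0"
  have "emb v = 0"
  proof (rule orthogonal_leads_zero[OF assms emb_free_lie_deg_span[OF v]])
    show "dot X k (gr_lead k C) (emb v) = 0" if "C \<in> carrier (gr k)" for C
      using zero that gr_integral_dot[OF assms(2) that, of v] v by (simp add: free_lie_deg_def)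
  qed
  then show "v = 0" by (simp add: emb_pm_eq_0_iff)
next
  fix s :: "'x letter list set \<Rightarrow>\<^sub>0 'K"
  assume s: "Poly_Mapping.keys s \<subseteq> carrier (gr k)"
    and zero: "\<forall>t. Poly_Mapping.keys t \<subseteq> free_lie_deg X k \<longrightarrow> ext_pairing (gr_integral I) s t = 0"
  show "s \<in> tensor_rel_group (gr k)"
  proof (rule tensor_rel_group_kernel[OF assms s], rule orthogonal_brackets_zero)
    show "extend (gr_lead k) s \<in> span_pm (left_normed_brackets X k)"
      using s gr_lead_span[OF assms(2)] by (intro extend_span) blast
    fix v :: "('x, 'k) ncpoly" assume v: "v \<in> free_lie_deg X k"
    then have "Poly_Mapping.keys (Poly_Mapping.single v (1 :: 'K)) \<subseteq> free_lie_deg X k" by simp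
    then show "dot X k (extend (gr_lead k) s) (emb v) = 0"
      using zero ext_pairing_gr[OF assms(2) s] by (metis extend_single pm.scale_one)
  qed
next
  fix t :: "('x, 'k) ncpoly \<Rightarrow>\<^sub>0 'K"
  assume t: "Poly_Mapping.keys t \<subseteq> free_lie_deg X k"
    and zero: "\<forall>s. Poly_Mapping.keys s \<subseteq> carrier (gr k) \<longrightarrow> ext_pairing (gr_integral I) s t = 0"
  show "t \<in> tensor_rel_space \<iota> (free_lie_deg X k)"
  proof (rule tensor_rel_space_kernel[OF free_lie_deg_subspace t], rule orthogonal_leads_zero[OF assms])
    show "extend emb t \<in> span_pm (left_normed_brackets X k)"
      using t emb_free_lie_deg_span by (intro extend_span) blast
    fix C assume "C \<in> carrier (gr k)"
    then have "Poly_Mapping.keys (Poly_Mapping.single C (1 :: 'K)) \<subseteq> carrier (gr k)" by simp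
    then show "dot X k (gr_lead k C) (extend emb t) = 0"
      using zero ext_pairing_gr[OF assms(2) _ t] by (metis extend_single pm.scale_one)
  qed
qed

lemma Ass_deg_1_expand:
  assumes "p \<in> Ass_deg X 1"
  shows "p = (\<Sum>y\<in>X. scale_pm (lookup p [y]) (var y :: ('x, 'K) ncpoly))"
proof (rule poly_mapping_eqI)
  fix w
  have "lookup (\<Sum>y\<in>X. scale_pm (lookup p [y]) (var y)) w = (\<Sum>y\<in>X. if w = [y] then lookup p w else 0)"
    unfolding lookup_sum by (intro sum.cong) (auto simp: var_def lookup_single when_def)
  also have "\<dots> = lookup p w"
  proof (cases "\<exists>y\<in>X. w = [y]")
    case True
    then show ?thesis using finite_X by auto
  next
    case False
    then have "lookup p w = 0" by (intro Ass_degD[OF assms]) (auto simp: length_Suc_conv)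
    then show ?thesis by (auto intro: sum.neutral)
  qed
  finally show "lookup p w = lookup (\<Sum>y\<in>X. scale_pm (lookup p [y]) (var y)) w" ..
qed

text \<open>If a letter is outside the span of the leading terms, a functional kills these but not
  the letter. Written as a tensor t, it pairs to zero with all classes, so t is a relation and
  evaluates to zero, yet its coefficient at that letter is 1.\<close>

lemma full_rank_of_nondegenerate:
  assumes "nondegenerate \<iota> (gr 1) (free_lie_deg X 1) (gr_integral I)"
  shows full_rank
  unfolding full_rank_def
proof (rule ballI, rule ccontr)
  fix x assume x: "x \<in> X" and not: "var x \<notin> span_pm (lead 1 ` carrier FX)"
  obtain \<phi> :: "_ \<Rightarrow> ('x, 'K) ncpoly" where \<phi>: "linear_pm \<phi>" "\<phi> (var x) = Poly_Mapping.single [] 1"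
    "\<forall>p\<in>span_pm (lead 1 ` carrier FX). \<phi> p = 0"
    using exists_linear_separating[OF not] by blast
  define c where "c y = lookup (\<phi> (var y)) []" for y
  \<comment> \<open>The coefficients c y lie in \<open>K\<close>, so t need not come from a form
    over the small field. This is where non-degeneracy of the extended pairing is used.\<close>
  define t :: "('x, 'k) ncpoly \<Rightarrow>\<^sub>0 'K" where "t = (\<Sum>y\<in>X. Poly_Mapping.single (var y) (c y))"
  have "Poly_Mapping.keys t \<subseteq> (\<Union>y\<in>X. Poly_Mapping.keys (Poly_Mapping.single (var y :: ('x, 'k) ncpoly) (c y)))"
    unfolding t_def by (rule Poly_Mapping.keys_sum)
  also have "\<dots> \<subseteq> var ` X" by auto
  also have "\<dots> \<subseteq> free_lie_deg X 1"
    using left_normed_brackets_free_lie_deg unfolding left_normed_brackets_1[symmetric] .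
  finally have t: "Poly_Mapping.keys t \<subseteq> free_lie_deg X 1" .
  have ext_t: "extend emb t = (\<Sum>y\<in>X. scale_pm (c y) (var y))"
    unfolding t_def pmp.linear_sum[OF extend_linear] by (simp add: emb_var)
  have lookup_t: "lookup (extend emb t) [y] = c y" if "y \<in> X" for y
  proof -
    have "lookup (extend emb t) [y] = (\<Sum>z\<in>X. if z = y then c y else 0)"
      unfolding ext_t lookup_sum by (intro sum.cong) (auto simp: var_def lookup_single when_def)
    then show ?thesis using that finite_X by simp
  qed
  have dot_t: "dot X 1 p (extend emb t) = lookup (\<phi> p) []" if p: "p \<in> Ass_deg X 1" for p
  proof -
    have "dot X 1 p (extend emb t) = (\<Sum>y\<in>X. lookup p [y] * c y)"
    proof -
      have "{w. w \<in> lists X \<and> length w = 1} = (\<lambda>y. [y]) ` X" by (auto simp: length_Suc_conv)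
      then show ?thesis
        by (simp add: dot_def sum.reindex inj_on_def lookup_t del: in_lists_conv_set)
    qed
    also have "\<dots> = lookup (\<phi> (\<Sum>y\<in>X. scale_pm (lookup p [y]) (var y))) []"
      by (simp add: pmp.linear_sum[OF \<phi>(1)] pmp.linear_scale[OF \<phi>(1)] lookup_sum c_def)
    finally show ?thesis using Ass_deg_1_expand[OF p] by simp
  qed
  have lead0: "dot X 1 (gr_lead 1 C) (extend emb t) = 0" if C: "C \<in> carrier (gr 1)" for C
  proof -
    obtain a where "a \<in> \<Gamma> 1" "C = gr_class 1 a" using C unfolding carrier_gr by blast
    then have "gr_lead 1 C = lead 1 a" "a \<in> carrier FX" using gr_lead_class[of 1 a] by auto
    then show ?thesis
      using dot_t[OF lead_Ass_deg] \<phi>(3) pm.span_base[of "lead 1 a" "lead 1 ` carrier FX"] by simp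
  qed
  have "ext_pairing (gr_integral I) s t = 0" if s: "Poly_Mapping.keys s \<subseteq> carrier (gr 1)" for s
  proof -
    have "dot X 1 (extend (gr_lead 1) s) (extend emb t) = 0"
      unfolding extend_def[of "gr_lead 1"] dot_sum using lead0 s by (intro sum.neutral) auto
    then show ?thesis using ext_pairing_gr[OF _ s t] by simp
  qed
  then have "t \<in> tensor_rel_space \<iota> (free_lie_deg X 1)"
    using assms t unfolding nondegenerate_def by blast
  then have "c x = 0" using lookup_t[OF x] extend_emb_tensor_rel_space by simp
  then show False using \<phi>(2) by (simp add: c_def)
qed

end

section \<open>Shuffles\<close>

text \<open>The shuffle of words counted with multiplicity, by recursion on the first
  letter.\<close>

fun word_shuffle :: "'x list \<Rightarrow> 'x list \<Rightarrow> ('x, 'k::field) ncpoly" where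
  "word_shuffle [] v = Poly_Mapping.single v 1"
| "word_shuffle u [] = Poly_Mapping.single u 1"
| "word_shuffle (a # u) (b # v) = var a * word_shuffle u (b # v) + var b * word_shuffle (a # u) v"

text \<open>Distinct indices keep the two branches of the recursion disjoint, so the sum over a set
  counts every interleaving once even if g repeats letters.\<close>

lemma sum_shuffles:
  assumes "distinct (xs @ ys)"
  shows "(\<Sum>ks\<in>shuffles xs ys. prod_list (map (\<lambda>k. var (g k)) ks)) = (word_shuffle (map g xs) (map g ys) :: ('x, 'k::field) ncpoly)"
  using assms
proof (induction xs ys rule: shuffles.induct)
  case (1 ys)
  show ?case using prod_list_var[of "map g ys"] by (simp add: o_def)
next
  case (2 xs)
  show ?case using prod_list_var[of "map g xs"] by (cases xs) (simp_all add: o_def)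
next
  case (3 x xs y ys)
  let ?p = "\<lambda>ks. prod_list (map (\<lambda>k. var (g k) :: ('x, 'k) ncpoly) ks)"
  have "(\<Sum>ks\<in>shuffles (x # xs) (y # ys). ?p ks) =
    (\<Sum>ks\<in>(#) x ` shuffles xs (y # ys). ?p ks) + (\<Sum>ks\<in>(#) y ` shuffles (x # xs) ys. ?p ks)"
    unfolding shuffles.simps using 3(3) by (intro sum.union_disjoint) auto
  also have "(\<Sum>ks\<in>(#) x ` shuffles xs (y # ys). ?p ks) = var (g x) * (\<Sum>ks\<in>shuffles xs (y # ys). ?p ks)"
    by (simp add: sum.reindex sum_distrib_left)
  also have "(\<Sum>ks\<in>(#) y ` shuffles (x # xs) ys. ?p ks) = var (g y) * (\<Sum>ks\<in>shuffles (x # xs) ys. ?p ks)"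
    by (simp add: sum.reindex sum_distrib_left)
  finally show ?case using 3 by simp
qed

lemma shuffle_forms_var:
  "shuffle_forms (map var u) (map var v) = (word_shuffle u v :: ('x, 'k::field) ncpoly)"
proof -
  let ?var = "var :: 'x \<Rightarrow> ('x, 'k) ncpoly"
  let ?g = "\<lambda>k. (u @ v) ! k"
  let ?xs = "[0..<length u]" and ?ys = "[length u..<length u + length v]"
  have "shuffle_forms (map ?var u) (map ?var v) =
      (\<Sum>ks\<in>shuffles ?xs ?ys. prod_list (map (\<lambda>k. map ?var (u @ v) ! k) ks))"
    unfolding shuffle_forms_def by (simp only: length_map map_append)
  also have "\<dots> = (\<Sum>ks\<in>shuffles ?xs ?ys. prod_list (map (\<lambda>k. ?var (?g k)) ks))"
  proof (intro sum.cong refl arg_cong[of _ _ prod_list] map_cong)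
    fix ks k assume "ks \<in> shuffles ?xs ?ys" "k \<in> set ks"
    then have "k < length (u @ v)" using set_shuffles[of ks ?xs ?ys] by auto
    then show "map ?var (u @ v) ! k = ?var (?g k)" by (rule nth_map)
  qed
  also have "\<dots> = word_shuffle (map ?g ?xs) (map ?g ?ys)" by (rule sum_shuffles) auto
  also have "map ?g ?xs = u" by (auto intro!: nth_equalityI simp: nth_append)
  also have "map ?g ?ys = v" by (auto intro!: nth_equalityI simp: nth_append)
  finally show ?thesis .
qed

lemma word_shuffle_Ass_deg:
  "u \<in> lists X \<Longrightarrow> v \<in> lists X \<Longrightarrow>
    (word_shuffle u v :: ('x, 'k::field) ncpoly) \<in> Ass_deg X (length u + length v)"
proof (induction u v rule: word_shuffle.induct)
  case (3 a u b v)
  let ?s = "word_shuffle :: 'x list \<Rightarrow> 'x list \<Rightarrow> ('x, 'k) ncpoly"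
  have "var a * ?s u (b # v) \<in> Ass_deg X (1 + (length u + length (b # v)))"
    using 3 by (intro times_Ass_deg var_Ass_deg) auto
  moreover have "var b * ?s (a # u) v \<in> Ass_deg X (1 + (length (a # u) + length v))"
    using 3 by (intro times_Ass_deg var_Ass_deg) auto
  ultimately show ?case by (simp add: pm.subspace_add[OF Ass_deg_subspace])
qed (auto simp: Ass_deg_iff lookup_single when_def split: if_splits)

lemma lookup_var_times:
  fixes p :: "('x, 'k::field) ncpoly"
  shows "lookup (var a * p) [] = 0" "lookup (var a * p) (x # w) = (if a = x then lookup p w else 0)"
  unfolding lookup_times_Ass_deg[OF var_Ass_deg[OF UNIV_I]]
  by (simp_all add: var_def lookup_single when_def)

lemma lookup_word_shuffle_Nil: "lookup (word_shuffle u v) [] = (if u = [] \<and> v = [] then 1 else 0 :: 'k::field)"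
  by (cases "(u, v)" rule: word_shuffle.cases) (auto simp: lookup_add lookup_var_times lookup_single)

text \<open>Deleting a given first letter is a derivation of the shuffle product.\<close>

lemma lookup_word_shuffle_Cons:
  "lookup (word_shuffle u v) (x # w) =
    (case u of [] \<Rightarrow> 0 | a # u' \<Rightarrow> if a = x then lookup (word_shuffle u' v) w else 0) +
    (case v of [] \<Rightarrow> 0 | b # v' \<Rightarrow> if b = x then lookup (word_shuffle u v') w else (0 :: 'k::field))"
proof (cases "(u, v)" rule: word_shuffle.cases)
  case (1 v)
  then show ?thesis by (cases v) (auto simp: lookup_single when_def)
next
  case (2 a u)
  then show ?thesis by (cases u) (auto simp: lookup_single when_def)
qed (auto simp: lookup_add lookup_var_times)

lemma word_shuffle_span:
  assumes "u \<in> lists X" "v \<in> lists X" "u \<noteq> []" "v \<noteq> []"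
  shows "word_shuffle u v \<in> shuffle_span X (length u + length v)"
proof -
  have "word_shuffle u v = shuffle (Poly_Mapping.single u 1) (Poly_Mapping.single v 1)"
    by (simp add: shuffle_def shuffle_forms_var)
  moreover have "Poly_Mapping.single u 1 \<in> Ass_deg X (length u)" "Poly_Mapping.single v 1 \<in> Ass_deg X (length v)"
    using assms by (auto simp: Ass_deg_def Ass_def simp del: in_lists_conv_set)
  moreover have "1 \<le> length u" "1 \<le> length v" using assms by (simp_all add: Suc_le_eq)
  ultimately show ?thesis unfolding shuffle_span_def by (intro pm.span_base) blast
qed

subsection \<open>The adjoint of the left-normed bracketing\<close>

text \<open>
  The words \<open>w\<close> of \<open>[\<dots>[z\<^sub>1, z\<^sub>2], \<dots>, z\<^sub>k]\<close> arise by putting each \<open>z\<^sub>i\<close> to the right of the word formed so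
  far, or to its left with a sign.  Hence the adjoint of \<open>z\<^sub>1\<dots>z\<^sub>k \<mapsto> [\<dots>[z\<^sub>1, z\<^sub>2], \<dots>, z\<^sub>k]\<close> sends \<open>w\<close> to
  the sum over \<open>w = u a v\<close> of \<open>(-1)\<^bsup>|u|\<^esup> a (rev u * v)\<close>, with the shuffle product in the bracket.
\<close>

definition bracket_adjoint :: "'x list \<Rightarrow> ('x, 'k::field) ncpoly" where
  "bracket_adjoint w = (\<Sum>j<length w.
    scale_pm ((- 1) ^ j) (var (w ! j) * word_shuffle (rev (take j w)) (drop (Suc j) w)))"

lemma finite_factorizations: "finite {(u, v). u @ q @ v = w}"
proof (rule finite_subset)
  show "{(u, v). u @ q @ v = w} \<subseteq> (\<lambda>j. (take j w, drop (j + length q) w)) ` {..length w}"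
  proof clarify
    fix u v
    have "(u, v) = (take (length u) (u @ q @ v), drop (length u + length q) (u @ q @ v))" by simp
    then show "(u, v) \<in> (\<lambda>j. (take j (u @ q @ v), drop (j + length q) (u @ q @ v))) ` {..length (u @ q @ v)}"
      by (rule image_eqI) simp
  qed
qed simp

lemma left_normed_diff: "left_normed (p - q) zs = left_normed p zs - left_normed q zs"
proof (induction zs arbitrary: p q)
  case (Cons z zs)
  have "bracket (p - q) (var z) = bracket p (var z) - bracket q (var z)"
    by (simp add: bracket_def algebra_simps)
  then show ?case using Cons.IH by simp
qed simp

text \<open>The start word q is arbitrary because bracketing with x turns it into
  \<open>q @ [x]\<close> or, with a sign, into \<open>x # q\<close>. The surrounding parts u and v
  then lose the letter x at their inner ends, which are the first letters of \<open>rev u\<close>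
  and v, as in the recursion for shuffles.\<close>

lemma lookup_left_normed:
  "lookup (left_normed (Poly_Mapping.single q 1) zs) w =
    (\<Sum>(u, v) | u @ q @ v = w. (- 1) ^ length u * lookup (word_shuffle (rev u) v) zs :: 'k::field)"
proof (induction zs arbitrary: q)
  case Nil
  have "(\<Sum>(u, v) | u @ q @ v = w. (- 1) ^ length u * lookup (word_shuffle (rev u) v) [] :: 'k) =
    (\<Sum>(u, v)\<in>{(u, v). u @ q @ v = w \<and> u = [] \<and> v = []}. 1)"
    using finite_factorizations[of q w]
    by (intro sum.mono_neutral_cong_right) (auto simp: lookup_word_shuffle_Nil split: if_splits)
  also have "{(u, v). u @ q @ v = w \<and> u = [] \<and> v = []} = (if q = w then {([], [])} else {})" by auto
  finally show ?case by (simp add: lookup_single when_def)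
next
  case (Cons x zs)
  let ?c = "\<lambda>u v. (- 1) ^ length u * lookup (word_shuffle (rev u) v :: ('a, 'k) ncpoly) zs"
  let ?D = "\<lambda>q. {(u, v). u @ q @ v = w}"
  let ?l = "\<lambda>u v. case rev u of [] \<Rightarrow> 0 | a # u' \<Rightarrow> if a = x then lookup (word_shuffle u' v :: ('a, 'k) ncpoly) zs else 0"
  let ?r = "\<lambda>u v. case v of [] \<Rightarrow> 0 | b # v' \<Rightarrow> if b = x then lookup (word_shuffle (rev u) v' :: ('a, 'k) ncpoly) zs else 0"
  have "bracket (Poly_Mapping.single q (1 :: 'k)) (var x) = Poly_Mapping.single (q @ [x]) 1 - Poly_Mapping.single (x # q) 1"
    by (simp add: bracket_def var_def mult_single plus_list_def)
  then have "lookup (left_normed (Poly_Mapping.single q 1) (x # zs)) w =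
    (\<Sum>(u, v)\<in>?D (q @ [x]). ?c u v) - (\<Sum>(u, v)\<in>?D (x # q). ?c u v)"
    using Cons.IH by (simp add: left_normed_diff lookup_minus)
  also have "(\<Sum>(u, v)\<in>?D (q @ [x]). ?c u v) = (\<Sum>(u, v)\<in>?D q. (- 1) ^ length u * ?r u v)"
  proof -
    have "(\<Sum>(u, v)\<in>?D q. (- 1) ^ length u * ?r u v) =
      (\<Sum>(u, v)\<in>(\<lambda>(u, v). (u, x # v)) ` ?D (q @ [x]). (- 1) ^ length u * ?r u v)"
    proof (rule sum.mono_neutral_right)
      show "\<forall>p\<in>?D q - (\<lambda>(u, v). (u, x # v)) ` ?D (q @ [x]). (case p of (u, v) \<Rightarrow> (- 1) ^ length u * ?r u v) = 0"
      proof clarify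
        fix u v assume uv: "w = u @ q @ v" "(u, v) \<notin> (\<lambda>(u', v'). (u', x # v')) ` {(u', v'). u' @ (q @ [x]) @ v' = u @ q @ v}"
        show "(- 1) ^ length u * ?r u v = 0"
        proof (cases v)
          case (Cons b v')
          then have "b \<noteq> x" using uv(2) by (force simp: image_iff)
          then show ?thesis using Cons by simp
        qed simp
      qed
    qed (use finite_factorizations in \<open>auto\<close>)
    also have "\<dots> = (\<Sum>(u, v)\<in>?D (q @ [x]). ?c u v)"
      by (subst sum.reindex) (auto simp: inj_on_def intro!: sum.cong)
    finally show ?thesis ..
  qed
  \<comment> \<open>Moving x from the middle part to the end of u lengthens u by one letter, which
    produces the sign.\<close>
  also have "(\<Sum>(u, v)\<in>?D (x # q). ?c u v) = - (\<Sum>(u, v)\<in>?D q. (- 1) ^ length u * ?l u v)"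
  proof -
    have "(\<Sum>(u, v)\<in>?D q. (- 1) ^ length u * ?l u v) =
      (\<Sum>(u, v)\<in>(\<lambda>(u, v). (u @ [x], v)) ` ?D (x # q). (- 1) ^ length u * ?l u v)"
    proof (rule sum.mono_neutral_right)
      show "\<forall>p\<in>?D q - (\<lambda>(u, v). (u @ [x], v)) ` ?D (x # q). (case p of (u, v) \<Rightarrow> (- 1) ^ length u * ?l u v) = 0"
      proof clarify
        fix u v assume uv: "w = u @ q @ v" "(u, v) \<notin> (\<lambda>(u', v'). (u' @ [x], v')) ` {(u', v'). u' @ (x # q) @ v' = u @ q @ v}"
        show "(- 1) ^ length u * ?l u v = 0"
        proof (cases u rule: rev_cases)
          case (snoc u' b)
          then have "b \<noteq> x" using uv(2) by (force simp: image_iff)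
          then show ?thesis using snoc by simp
        qed simp
      qed
    qed (use finite_factorizations in \<open>auto\<close>)
    also have "\<dots> = (\<Sum>(u, v)\<in>?D (x # q). - ?c u v)"
      by (subst sum.reindex) (auto simp: inj_on_def intro!: sum.cong)
    also have "\<dots> = - (\<Sum>(u, v)\<in>?D (x # q). ?c u v)" by (simp add: sum_negf case_prod_unfold)
    finally show ?thesis by simp
  qed
  also have "(\<Sum>(u, v)\<in>?D q. (- 1) ^ length u * ?r u v) - - (\<Sum>(u, v)\<in>?D q. (- 1) ^ length u * ?l u v) =
    (\<Sum>(u, v)\<in>?D q. (- 1) ^ length u * (?l u v + ?r u v))"
    by (simp add: sum.distrib case_prod_unfold distrib_left)
  finally show ?case by (simp add: lookup_word_shuffle_Cons)
qed

lemma lookup_bracket_adjoint: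
  "lookup (bracket_adjoint w) (z # zs) = (lookup (left_normed (var z) zs) w :: 'k::field)"
proof -
  let ?f = "\<lambda>u v. (- 1) ^ length u * lookup (word_shuffle (rev u) v :: ('a, 'k) ncpoly) zs"
  let ?J = "{j. j < length w \<and> w ! j = z}"
  have "lookup (bracket_adjoint w) (z # zs) = (\<Sum>j<length w. if w ! j = z then ?f (take j w) (drop (Suc j) w) else 0)"
    unfolding bracket_adjoint_def lookup_sum by (intro sum.cong) (auto simp: lookup_var_times min_def)
  also have "\<dots> = (\<Sum>j\<in>?J. ?f (take j w) (drop (Suc j) w))"
    by (simp add: sum.inter_filter[symmetric])
  also have "\<dots> = (\<Sum>(u, v) | u @ [z] @ v = w. ?f u v)"
    by (rule sum.reindex_bij_witness[of _ "\<lambda>(u, v). length u" "\<lambda>j. (take j w, drop (Suc j) w)"])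
      (auto simp: id_take_nth_drop[symmetric] nth_append)
  also have "\<dots> = lookup (left_normed (var z) zs) w"
    unfolding var_def by (rule lookup_left_normed[symmetric])
  finally show ?thesis .
qed

lemma bracket_adjoint_Ass_deg:
  assumes "w \<in> lists X"
  shows "(bracket_adjoint w :: ('x, 'k::field) ncpoly) \<in> Ass_deg X (length w)"
  unfolding bracket_adjoint_def
proof (intro pm.subspace_sum[OF Ass_deg_subspace] pm.subspace_scale[OF Ass_deg_subspace])
  fix j assume "j \<in> {..<length w}"
  then have j: "j < length w" by simp
  let ?p = "var (w ! j) * word_shuffle (rev (take j w)) (drop (Suc j) w) :: ('x, 'k) ncpoly"
  have "?p \<in> Ass_deg X (1 + (length (rev (take j w)) + length (drop (Suc j) w)))"
    using assms j take_lists[OF assms, of j] drop_lists[OF assms, of "Suc j"]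
    by (intro times_Ass_deg var_Ass_deg word_shuffle_Ass_deg) (auto simp: in_lists_conv_set)
  moreover have "1 + (length (rev (take j w)) + length (drop (Suc j) w)) = length w" using j by simp
  ultimately show "?p \<in> Ass_deg X (length w)" by (simp only:)
qed

text \<open>
  The sum \<open>\<Sum>\<^sub>i (n - i) (-1)\<^sup>i rev(take i w) * drop i w\<close> telescopes after splitting each shuffle by its
  first letter; its term \<open>i = 0\<close> is \<open>n w\<close> and the others are proper shuffles.
\<close>

lemma bracket_adjoint_mod_shuffles:
  fixes w :: "'x list"
  assumes "w \<in> lists X" "w \<noteq> []"
  shows "scale_pm (of_nat (length w)) (Poly_Mapping.single w 1) - bracket_adjoint w
    \<in> (shuffle_span X (length w) :: ('x, 'k::field) ncpoly set)"
proof -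
  let ?n = "length w"
  define s :: "nat \<Rightarrow> ('x, 'k) ncpoly" where "s i = word_shuffle (rev (take i w)) (drop i w)" for i
  define A :: "nat \<Rightarrow> ('x, 'k) ncpoly"
    where "A j = var (w ! j) * word_shuffle (rev (take j w)) (drop (Suc j) w)" for j
  define T :: "nat \<Rightarrow> ('x, 'k) ncpoly" where "T i = scale_pm (of_nat (?n - i) * (- 1) ^ i) (s i)" for i
  have s0: "s 0 = A 0"
    using assms(2) by (cases w) (auto simp: s_def A_def var_def mult_single plus_list_def)
  \<comment> \<open>The first letter of the shuffle is either \<open>w ! i\<close>, the head of the
    reversed prefix, or \<open>w ! Suc i\<close>, the head of the rest.\<close>
  have sSuc: "s (Suc i) = A i + A (Suc i)" if "Suc i < ?n" for i
    using that by (simp add: s_def A_def take_Suc_conv_app_nth Cons_nth_drop_Suc[symmetric])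
  \<comment> \<open>A j occurs in s j and s (j + 1) with opposite signs and weights n - j and n - j
    - 1, which differ by 1. At m = n - 1 the leftover weight is 1, the missing last term of the
    adjoint.\<close>
  have tele: "(\<Sum>i\<le>m. T i) = (\<Sum>j<m. scale_pm ((- 1) ^ j) (A j)) + scale_pm (of_nat (?n - m) * (- 1) ^ m) (A m)"
    if "m < ?n" for m
    using that
  proof (induction m)
    case 0
    then show ?case by (simp add: T_def s0)
  next
    case (Suc m)
    have "?n - m = Suc (?n - Suc m)" using Suc.prems by simp
    then have "of_nat (?n - m) = (1 + of_nat (?n - Suc m) :: 'k)" by (simp only: of_nat_Suc)
    then show ?case using Suc
      by (simp add: T_def sSuc pm.scale_right_distrib pm.scale_left_distrib algebra_simps)
  qed
  obtain m where m: "?n = Suc m" using assms(2) by (cases w) auto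
  have "bracket_adjoint w = (\<Sum>i\<le>m. T i)"
    using tele[of m] m by (simp add: bracket_adjoint_def A_def)
  also have "\<dots> = T 0 + (\<Sum>i\<in>{1..m}. T i)"
    by (simp add: sum.atMost_shift sum.atLeast1_atMost_eq lessThan_Suc_atMost)
  also have "T 0 = scale_pm (of_nat ?n) (Poly_Mapping.single w 1)" by (simp add: T_def s_def)
  finally have "scale_pm (of_nat ?n) (Poly_Mapping.single w 1) - bracket_adjoint w = - (\<Sum>i\<in>{1..m}. T i)"
    by simp
  also have "\<dots> \<in> shuffle_span X ?n"
    unfolding shuffle_span_def
  proof (intro pm.span_neg pm.span_sum, unfold shuffle_span_def[symmetric])
    fix i assume i: "i \<in> {1..m}"
    have "s i \<in> shuffle_span X (length (rev (take i w)) + length (drop i w))"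
      unfolding s_def using assms i m take_lists[OF assms(1), of i] drop_lists[OF assms(1), of i]
      by (intro word_shuffle_span) (auto simp: in_lists_conv_set)
    then have "s i \<in> shuffle_span X ?n" using i m by (simp add: min_def)
    then show "T i \<in> shuffle_span X ?n"
      unfolding T_def shuffle_span_def by (rule pm.span_scale)
  qed
  finally show ?thesis .
qed

lemma Ass_deg_expand:
  assumes "finite X" "p \<in> Ass_deg X k"
  shows "p = (\<Sum>w | w \<in> lists X \<and> length w = k. scale_pm (lookup p w) (Poly_Mapping.single w 1))"
proof -
  have "p = extend (\<lambda>w. Poly_Mapping.single w 1) p" by (simp add: extend_singles)
  also have "\<dots> = (\<Sum>w | w \<in> lists X \<and> length w = k. scale_pm (lookup p w) (Poly_Mapping.single w 1))"
    using finite_words[OF assms(1)] assms(2)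
    by (intro extend_superset) (auto simp: Ass_deg_def Ass_def)
  finally show ?thesis .
qed

text \<open>Applying the adjoint to p gives r, whose coefficients are the inner products of p with
  left-normed brackets, so r = 0. Since k w and the adjoint of w agree modulo shuffles, k p is a
  shuffle combination, and k is invertible.\<close>

lemma shuffle_span_of_orthogonal:
  fixes p :: "('x, 'k::field_char_0) ncpoly"
  assumes "finite X" "k \<ge> 1" "p \<in> Ass_deg X k"
    and orth: "\<And>q. q \<in> left_normed_brackets X k \<Longrightarrow> dot X k p q = 0"
  shows "p \<in> shuffle_span X k"
proof -
  let ?W = "{w. w \<in> lists X \<and> length w = k}"
  define r where "r = (\<Sum>w\<in>?W. scale_pm (lookup p w) (bracket_adjoint w :: ('x, 'k) ncpoly))"
  have r: "r \<in> Ass_deg X k"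
    unfolding r_def
  proof (intro pm.subspace_sum[OF Ass_deg_subspace] pm.subspace_scale[OF Ass_deg_subspace])
    fix w assume "w \<in> ?W"
    then have "w \<in> lists X" "length w = k" by blast+
    then show "(bracket_adjoint w :: ('x, 'k) ncpoly) \<in> Ass_deg X k"
      using bracket_adjoint_Ass_deg by metis
  qed
  have "lookup r z = 0" for z
  proof (cases "z \<in> lists X \<and> length z = k")
    case True
    then obtain y zs where z: "z = y # zs" using assms(2) by (cases z) auto
    have "lookup r z = (\<Sum>w\<in>?W. lookup p w * lookup (left_normed (var y) zs) w)"
      by (simp add: r_def lookup_sum z lookup_bracket_adjoint)
    also have "\<dots> = dot X k p (left_normed (var y) zs)" by (simp add: dot_def)
    also have "\<dots> = 0"
      using True z by (intro orth) (auto simp: left_normed_brackets_def simp del: in_lists_conv_set)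
    finally show ?thesis .
  next
    case False
    then show ?thesis using Ass_degD[OF r] by blast
  qed
  then have "r = 0" by (intro poly_mapping_eqI) simp
  have "scale_pm (of_nat k) p = scale_pm (of_nat k) (\<Sum>w\<in>?W. scale_pm (lookup p w) (Poly_Mapping.single w 1)) - r"
    unfolding \<open>r = 0\<close> diff_zero by (rule arg_cong[OF Ass_deg_expand[OF assms(1,3)]])
  also have "\<dots> = (\<Sum>w\<in>?W. scale_pm (lookup p w) (scale_pm (of_nat k) (Poly_Mapping.single w 1) - bracket_adjoint w))"
    by (simp add: r_def pm.scale_sum_right sum_subtractf pm.scale_right_diff_distrib mult.commute)
  also have "\<dots> \<in> shuffle_span X k"
    unfolding shuffle_span_def
  proof (intro pm.span_sum pm.span_scale, unfold shuffle_span_def[symmetric])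
    fix w assume "w \<in> ?W"
    then have "w \<in> lists X" "w \<noteq> []" "length w = k" using assms(2) by auto
    then show "scale_pm (of_nat k) (Poly_Mapping.single w (1 :: 'k)) - bracket_adjoint w \<in> shuffle_span X k"
      using bracket_adjoint_mod_shuffles[of w X, where 'k = 'k] by (simp del: in_lists_conv_set)
  qed
  finally have "scale_pm (of_nat k) p \<in> shuffle_span X k" .
  then have "scale_pm (1 / of_nat k) (scale_pm (of_nat k) p) \<in> shuffle_span X k"
    unfolding shuffle_span_def by (rule pm.span_scale)
  then show ?thesis using assms(2) by simp
qed

section \<open>Forms whose integrals vanish on the graded quotient\<close>

context finite_iterated_integral
begin

text \<open>By (A4) the integral of a shuffle of two words is the product of their integrals. The
  first word has positive length below k, and paths in \<gamma> k have no coefficients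
  there.\<close>

lemma integral_shuffle_zero:
  assumes "a \<in> \<Gamma> k" "p \<in> Ass_deg X i" "q \<in> Ass_deg X j" "1 \<le> i" "1 \<le> j" "i + j = k"
  shows "shuffle p q \<in> Ass_deg X k" "dot X k (lead k a) (emb (shuffle p q)) = 0"
proof -
  let ?V = "{r \<in> Ass_deg X k. dot X k (lead k a) (emb r) = 0}"
  have V: "pm.subspace ?V"
    by (intro pm.subspaceI)
      (simp_all add: emb_pm_add emb_pm_scale emb_pm_eq_0_iff[THEN iffD2] Ass_deg_subspace
        pm.subspace_0 pm.subspace_add pm.subspace_scale)
  have "shuffle p q \<in> ?V"
    unfolding shuffle_def shuffle_forms_var
  proof (intro pm.subspace_sum[OF V] pm.subspace_scale[OF V])
    fix u v assume "u \<in> Poly_Mapping.keys p" "v \<in> Poly_Mapping.keys q"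
    then have u: "u \<in> lists X" "length u = i" and v: "v \<in> lists X" "length v = j"
      using assms(2,3) by (auto simp: Ass_deg_def Ass_def)
    have deg: "word_shuffle u v \<in> Ass_deg X k"
      using word_shuffle_Ass_deg[OF u(1) v(1)] u v assms(6) by simp
    have a: "a \<in> carrier FX" using assms(1) by (rule F.lower_central_carrier)
    have "a \<in> deep k" using lower_central_deep[of k] assms by auto
    then have "coef a u = 0" using u assms(4-6) by (intro deepD) auto
    have "dot X k (lead k a) (emb (word_shuffle u v)) = I a (word_shuffle u v)"
      using integral_eq_dot[OF a deg] by simp
    also have "\<dots> = coef a u * coef a v"
      using shuffle_rel[OF a set_var_Ass_deg[OF u(1)] set_var_Ass_deg[OF v(1)]]
      by (simp add: shuffle_forms_var prod_list_var coef_def)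
    finally show "word_shuffle u v \<in> ?V" using deg \<open>coef a u = 0\<close> by simp
  qed
  then show "shuffle p q \<in> Ass_deg X k" "dot X k (lead k a) (emb (shuffle p q)) = 0" by auto
qed

lemma gr_integral_shuffle_span:
  assumes "k \<ge> 1" "p \<in> Ass_deg X k" "p \<in> shuffle_span X k" "C \<in> carrier (gr k)"
  shows "gr_integral I C p = 0"
proof -
  obtain a where a: "a \<in> \<Gamma> k" "C = gr_class k a" using assms(4) unfolding carrier_gr by blast
  have "dot X k (lead k a) (emb p) = 0"
    using assms(3) unfolding shuffle_span_def
  proof (rule pm.span_induct)
    show "pm.subspace {p. dot X k (lead k a) (emb p) = 0}"
      by (rule pm.subspaceI) (auto simp: emb_pm_add emb_pm_scale emb_pm_eq_0_iff[THEN iffD2])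
  qed (use integral_shuffle_zero[OF a(1)] in blast)
  then show ?thesis using gr_integral_class[OF assms(1) a(1) assms(2)] a(2) by simp
qed

lemma dot_emb: "dot X k (emb p) (emb q) = \<iota> (dot X k p q)"
  by (simp add: dot_def emb_sum emb_mult)

text \<open>Full rank makes the leading terms span all brackets over \<open>K\<close>, so p is
  orthogonal to every bracket. The axioms alone do not give this: sending a form to its constant
  term along every path is an iterated integral that kills the letters, which are not
  shuffles.\<close>

lemma shuffle_span_of_gr_integral_zero:
  assumes full_rank "k \<ge> 1" "p \<in> Ass_deg X k"
    and zero: "\<And>C. C \<in> carrier (gr k) \<Longrightarrow> gr_integral I C p = 0"
  shows "p \<in> shuffle_span X k"
proof (rule shuffle_span_of_orthogonal[OF finite_X assms(2,3)])
  fix q :: "('x, 'k) ncpoly" assume "q \<in> left_normed_brackets X k"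
  then have "emb q \<in> left_normed_brackets X k" using emb_left_normed_brackets by blast
  then have q: "emb q \<in> span_pm (lead k ` \<Gamma> k)" using brackets_span_lead[OF assms(1,2)] by blast
  have "dot X k (emb p) (emb q) = 0"
  proof (rule dot_span_zero[OF _ q])
    fix r assume "r \<in> lead k ` \<Gamma> k"
    then obtain a where a: "a \<in> \<Gamma> k" "r = lead k a" by blast
    then have "gr_class k a \<in> carrier (gr k)" by (auto simp: carrier_gr)
    from zero[OF this] show "dot X k (emb p) r = 0"
      using gr_integral_class[OF assms(2) a(1) assms(3)] a(2) by (simp add: dot_commute)
  qed
  then show "dot X k p q = 0" by (simp add: dot_emb)
qed

end

theorem theorem1:
  fixes \<iota> :: "'k::field_char_0 \<Rightarrow> 'K::field_char_0"
    and X :: "'x set"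
    and I :: "'x letter list \<Rightarrow> ('x, 'k) ncpoly \<Rightarrow> 'K"
  defines "gr \<equiv> gr_group (free_group X)"
  defines "nondeg \<equiv> (\<lambda>k. nondegenerate \<iota> (gr k) (free_lie_deg X k) (gr_integral I))"
  assumes "finite X"
    and "iterated_integral \<iota> X I"
  shows "(nondeg 1 \<longrightarrow> (\<forall>k\<ge>1. nondeg k)) \<and>
    (\<forall>k\<ge>1. \<forall>\<omega>\<in>Ass_deg X k.
       (\<omega> \<in> shuffle_span X k \<longrightarrow> (\<forall>C\<in>carrier (gr k). gr_integral I C \<omega> = 0)) \<and>
       (nondeg 1 \<longrightarrow>
          ((\<forall>C\<in>carrier (gr k). gr_integral I C \<omega> = 0) \<longleftrightarrow> \<omega> \<in> shuffle_span X k)))"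
proof -
  interpret iterated_integral \<iota> X I by fact
  interpret finite_iterated_integral \<iota> X I by unfold_locales fact
  have "full_rank" if "nondeg 1"
    using full_rank_of_nondegenerate that by (simp only: nondeg_def gr_def)
  moreover have "nondeg k" if "full_rank" "k \<ge> 1" for k
    using nondegenerate_gr[OF that] by (simp only: nondeg_def gr_def)
  ultimately show ?thesis
    using gr_integral_shuffle_span shuffle_span_of_gr_integral_zero unfolding gr_def by blast
qed

end
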